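(* Let $w$ be a $cd$-word of length $n$ (where $c$ has length $1$ and $d$ has length $2$), and regard the coefficient $[w]_P$ of $w$ in the $cd$-index of $P$ as a function of $P$, where $P$ ranges over all Eulerian posets of rank $n+1$. 1. If $w$ is of one of the following forms, then the coefficient of $w$ as a function of Eulerian posets has greatest lower bound $0$ (that is, $\inf_P [w]_P = 0$) and has no upper bound (that is, $\sup_P [w]_P=+\infty$): (a) $w=c^i d c^j$ with $i,j\ge 0$ and $\min\{i,j\}\le 1$; (b) $w=c^i\, dcd\cdots cd\, c^j$, that is, $w=c^i d(cd)^{r-1}c^j$ with $r\ge 2$ and $i,j\ge 0$ arbitrary (at least two $d$'s, alternating with single $c$'s). 2. The coefficient of $c^n$ in the $cd$-index of every Eulerian poset of rank $n+1$ is $1$. 3. For every other $cd$-word $w$ (that is, $w$ is not of the form (a) or (b) and $w\neq c^n$), the coefficient of $w$ as a function of Eulerian posets has neither a lower nor an upper bound: $\inf_P [w]_P=-\infty$ and $\sup_P [w]_P=+\infty$.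
   Context: An Eulerian poset is a finite graded partially ordered set $P$ with minimum $\hat 0$ and maximum $\hat 1$ in which every interval $[x,y]$ with $x<y$ has the same number of elements of even rank and of odd rank. The rank of $P$ is the rank of $\hat 1$ (with $\hat 0$ of rank $0$). For $P$ an Eulerian poset of rank $n+1$ and $S\subseteq [1,n]=\{1,\dots,n\}$, let $f_S(P)$ be the number of chains $\hat 0< x_1< x_2<\cdots< x_k<\hat 1$ in $P$ with $\{\mathrm{rank}(x_i):1\le i\le k\}=S$. Let $h_S(P)=\sum_{T\subseteq S}(-1)^{|S\setminus T|}f_T(P)$. In noncommuting variables $a,b$, let $\Psi_P(a,b)=\sum_{S\subseteq[1,n]}h_S(P)\,u_S$, where $u_S=u_1u_2\cdots u_n$ with $u_i=a$ if $i\notin S$ and $u_i=b$ if $i\in S$. For every Eulerian poset $P$ there is a (unique) polynomial $\Phi_P(c,d)$ in noncommuting variables $c,d$ with $\Psi_P(a,b)=\Phi_P(a+b,ab+ba)$; it is called the $cd$-index of $P$. A $cd$-word is a (noncommutative) word in the letters $c$ and $d$; its length is (number of $c$'s) $+\,2\cdot$(number of $d$'s). For a $cd$-word $w$ of length $n$ and an Eulerian poset $P$ of rank $n+1$, $[w]_P$ denotes the coefficient of $w$ in $\Phi_P(c,d)$. *)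

theory Defs
  imports
    Complex_Main
    "HOL-Library.Poly_Mapping"
    "HOL-Library.Extended_Real"
    "HOL-Library.Infinite_Typeclass"
begin

section \<open>Eulerian posets\<close>

text \<open>A poset is represented by its reflexive order relation \<open>P\<close>; its underlying set is
  \<open>Field P\<close>.\<close>

definition is_min :: "'a rel \<Rightarrow> 'a \<Rightarrow> bool" where
  "is_min P x \<longleftrightarrow> x \<in> Field P \<and> (\<forall>y\<in>Field P. (x, y) \<in> P)"

definition is_max :: "'a rel \<Rightarrow> 'a \<Rightarrow> bool" where
  "is_max P x \<longleftrightarrow> x \<in> Field P \<and> (\<forall>y\<in>Field P. (y, x) \<in> P)"

definition pmin :: "'a rel \<Rightarrow> 'a" where
  "pmin P = (THE x. is_min P x)"

definition pmax :: "'a rel \<Rightarrow> 'a" where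
  "pmax P = (THE x. is_max P x)"

definition max_chains :: "'a rel \<Rightarrow> 'a set set" where
  "max_chains P = {C \<in> Chains P. \<forall>D\<in>Chains P. C \<subseteq> D \<longrightarrow> C = D}"

definition graded :: "'a rel \<Rightarrow> bool" where
  "graded P \<longleftrightarrow> (\<forall>C\<in>max_chains P. \<forall>D\<in>max_chains P. card C = card D)"

text \<open>The length of a longest chain from the minimum up to \<open>x\<close>, counted by its elements other
  than \<open>x\<close>.\<close>

definition rank :: "'a rel \<Rightarrow> 'a \<Rightarrow> nat" where
  "rank P x = Max (card ` {C \<in> Chains P. C \<subseteq> underS P x})"

definition poset_rank :: "'a rel \<Rightarrow> nat" where
  "poset_rank P = rank P (pmax P)"

definition interval :: "'a rel \<Rightarrow> 'a \<Rightarrow> 'a \<Rightarrow> 'a set" where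
  "interval P x y = {z. (x, z) \<in> P \<and> (z, y) \<in> P}"

definition eulerian :: "'a rel \<Rightarrow> bool" where
  "eulerian P \<longleftrightarrow>
     finite (Field P) \<and> Partial_order P \<and> (\<exists>x. is_min P x) \<and> (\<exists>x. is_max P x) \<and> graded P \<and>
     (\<forall>x y. (x, y) \<in> P \<and> x \<noteq> y \<longrightarrow>
        card {z \<in> interval P x y. even (rank P z)} = card {z \<in> interval P x y. odd (rank P z)})"

definition eulerian_posets :: "nat \<Rightarrow> 'a rel set" where
  "eulerian_posets m = {P. eulerian P \<and> poset_rank P = m}"


section \<open>Flag numbers\<close>

definition flag_f :: "'a rel \<Rightarrow> nat set \<Rightarrow> nat" where
  "flag_f P S = card {C \<in> Chains P. C \<subseteq> Field P - {pmin P, pmax P} \<and> rank P ` C = S}"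

definition flag_h :: "'a rel \<Rightarrow> nat set \<Rightarrow> int" where
  "flag_h P S = (\<Sum>T\<in>Pow S. (-1) ^ card (S - T) * int (flag_f P T))"


section \<open>Polynomials in noncommuting variables\<close>

text \<open>With concatenation as addition, lists form the free monoid, so that \<open>'x list \<Rightarrow>\<^sub>0 int\<close>
  with its convolution product is the free associative ring on \<open>'x\<close>.\<close>

instantiation list :: (type) monoid_add
begin

definition zero_list :: "'a list" where
  "zero_list = []"

definition plus_list :: "'a list \<Rightarrow> 'a list \<Rightarrow> 'a list" where
  "plus_list xs ys = xs @ ys"

instance
  by standard (simp_all add: zero_list_def plus_list_def)

end

type_synonym 'x ncpoly = "'x list \<Rightarrow>\<^sub>0 int"

definition ncvar :: "'x \<Rightarrow> 'x ncpoly" where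
  "ncvar x = Poly_Mapping.single [x] 1"

definition ncsubst :: "('x \<Rightarrow> 'r::ring_1) \<Rightarrow> 'x ncpoly \<Rightarrow> 'r" where
  "ncsubst g F =
     (\<Sum>w\<in>Poly_Mapping.keys F. of_int (Poly_Mapping.lookup F w) * prod_list (map g w))"


section \<open>The cd-index\<close>

datatype ab = La | Lb
datatype cd = Lc | Ld

definition ab_monomial :: "nat \<Rightarrow> nat set \<Rightarrow> ab ncpoly" where
  "ab_monomial n S = prod_list (map (\<lambda>i. if i \<in> S then ncvar Lb else ncvar La) [1..<n+1])"

definition ab_index :: "'a rel \<Rightarrow> ab ncpoly" where
  "ab_index P =
     (let n = poset_rank P - 1 in \<Sum>S\<in>Pow {1..n}. of_int (flag_h P S) * ab_monomial n S)"

primrec cd_to_ab :: "cd \<Rightarrow> ab ncpoly" where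
  "cd_to_ab Lc = ncvar La + ncvar Lb"
| "cd_to_ab Ld = ncvar La * ncvar Lb + ncvar Lb * ncvar La"

definition cd_index :: "'a rel \<Rightarrow> cd ncpoly" where
  "cd_index P = (THE F. ab_index P = ncsubst cd_to_ab F)"

definition cd_coeff :: "cd list \<Rightarrow> 'a rel \<Rightarrow> int" where
  "cd_coeff w P = Poly_Mapping.lookup (cd_index P) w"


section \<open>cd-words\<close>

primrec cd_letter_length :: "cd \<Rightarrow> nat" where
  "cd_letter_length Lc = 1"
| "cd_letter_length Ld = 2"

definition cd_length :: "cd list \<Rightarrow> nat" where
  "cd_length w = sum_list (map cd_letter_length w)"

definition one_d_form :: "cd list \<Rightarrow> bool" where
  "one_d_form w \<longleftrightarrow>
     (\<exists>i j. min i j \<le> 1 \<and> w = replicate i Lc @ [Ld] @ replicate j Lc)"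

definition alternating_form :: "cd list \<Rightarrow> bool" where
  "alternating_form w \<longleftrightarrow>
     (\<exists>i j r. r \<ge> 2 \<and>
        w = replicate i Lc @ [Ld] @ concat (replicate (r - 1) [Lc, Ld]) @ replicate j Lc)"

end

theory Submission
  imports Defs
begin

text \<open>The \<open>cd\<close>-index is a homomorphism of coalgebras. Comparing coefficients in the coproduct
  expresses \<open>2 [u c v]\<close>, up to two correction terms, as the sum over intermediate elements \<open>z\<close>
  of the products of \<open>[u]\<close> below \<open>z\<close> and \<open>[v]\<close> above \<open>z\<close>. If \<open>u\<close> ends and \<open>v\<close> begins with
  \<open>d\<close>, the correction terms vanish; so \<open>[w]\<close> is nonnegative for alternating words because it
  is for \<open>c\<^sup>i d c\<^sup>j\<close> with \<open>min i j \<le> 1\<close>, where it is a difference of numbers of elements of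
  given ranks.

  For the bounds, the ordinal sum of the posets without their bounds (the star product)
  multiplies \<open>cd\<close>-indices, so it suffices to attain values for single factors of a word.
  Disjoint unions of ladders make the coefficient of \<open>d\<close> large, and that of \<open>d c\<^sup>m d\<close> with even
  \<open>m\<close> very negative. For odd \<open>m \<ge> 3\<close> the latter is affine in the numbers of atoms, coatoms and
  incidences between them, and is made very negative by a product of complexes collapsed at the
  top. For \<open>ccdcc\<close>, disjoint copies of the double of a half-Eulerian poset of the graph
  \<open>K\<^sub>4\<close> suffice.\<close>

section \<open>Coefficients of substituted cd-words\<close>

text \<open>\<open>cd_index\<close> is a definite description, so the existence of the cd-index has
  to be proved. Splitting chains at their top element gives a recursion for the ab-index; the
  Eulerian condition yields a second one with a and b exchanged above that element. Their sum
  involves only c and even powers of a - b, and \<open>(a - b)^2 = c^2 - 2d\<close>. As the sum is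
  twice the ab-index, integrality also requires independence of the substituted words modulo 2. The
  obstacle for the lower bounds is the Euler characteristic. A complex of rank n can be given bounds
  only if its alternating sum of signs is (-1)^n - 1. These sums add under disjoint union: for even
  n the value 0 is stable, but for odd n each ladder contributes -2, and d c^m d has odd length
  exactly for odd m. Since a ladder changes the coefficient by -4, many of them are wanted, and a
  component with large positive sum has to pay for them. The collapsed product is such a component:
  with N pairs of facets it contributes 12N - 12 to the coefficient but pays for 5N - 5 ladders,
  which contribute -20N + 20.\<close>

fun word_coeff :: "cd list \<Rightarrow> ab list \<Rightarrow> int" where
  "word_coeff [] v = (if v = [] then 1 else 0)"
| "word_coeff (Lc # w) (_ # v) = word_coeff w v"
| "word_coeff (Ld # w) (l # l' # v) = (if l \<noteq> l' then word_coeff w v else 0)"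
| "word_coeff _ _ = 0"

lemma word_coeff_length: "length v \<noteq> cd_length w \<Longrightarrow> word_coeff w v = 0"
  by (induction w v rule: word_coeff.induct) (auto simp: cd_length_def)

lemma cd_length_simps [simp]:
  "cd_length [] = 0" "cd_length (x # w) = cd_letter_length x + cd_length w"
  "cd_length (u @ v) = cd_length u + cd_length v"
  by (auto simp: cd_length_def)

lemma cd_length_replicate [simp]: "cd_length (replicate n x) = n * cd_letter_length x"
  by (induction n) auto

text \<open>A letter d brings in both ab-letters, so only the power of c contributes to the power of
  a. This isolates the coefficient of \<open>replicate n Lc\<close>.\<close>

lemma word_coeff_La: "word_coeff w (replicate n La) = (if w = replicate n Lc then 1 else 0)"
proof (induction n arbitrary: w)
  case 0
  then show ?case by (cases w) auto
next
  case (Suc n)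
  show ?case
  proof (cases w)
    case (Cons x w')
    show ?thesis
    proof (cases x)
      case Ld
      then show ?thesis using Cons by (cases n) auto
    qed (simp add: Cons Suc)
  qed auto
qed

lemma length_le_cd_length: "length w \<le> cd_length w"
proof (induction w)
  case (Cons x w)
  then show ?case by (cases x) auto
qed auto

text \<open>The number of letters is bounded, rather than \<open>cd_length\<close>, so that removing
  a first c or a first d leads to the same smaller set.\<close>

definition words :: "nat \<Rightarrow> cd list set" where
  "words N = {w. length w \<le> N}"

lemma finite_words [simp]: "finite (words N)"
proof -
  have "words N \<subseteq> {w. set w \<subseteq> {Lc, Ld} \<and> length w \<le> N}"
    unfolding words_def using cd.exhaust by auto
  then show ?thesis
    using finite_lists_length_le[of "{Lc, Ld}" N] finite_subset by auto
qed

lemma words_0 [simp]: "words 0 = {[]}"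
  by (auto simp: words_def)

lemma sum_words_Suc:
  "(\<Sum>w\<in>words (Suc N). f w) =
     f [] + (\<Sum>w\<in>words N. f (Lc # w)) + (\<Sum>w\<in>words N. f (Ld # w))"
proof -
  have "words (Suc N) = insert [] (Cons Lc ` words N \<union> Cons Ld ` words N)"
  proof (intro set_eqI iffI)
    fix w assume w: "w \<in> words (Suc N)"
    show "w \<in> insert [] (Cons Lc ` words N \<union> Cons Ld ` words N)"
    proof (cases w)
      case (Cons x w')
      then show ?thesis using w by (cases x) (auto simp: words_def)
    qed auto
  qed (auto simp: words_def)
  moreover have "sum f (Cons Lc ` words N \<union> Cons Ld ` words N) =
      sum f (Cons Lc ` words N) + sum f (Cons Ld ` words N)"
    by (rule sum.union_disjoint) auto
  moreover have "sum f (insert [] (Cons Lc ` words N \<union> Cons Ld ` words N)) =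
      f [] + sum f (Cons Lc ` words N \<union> Cons Ld ` words N)"
    by (rule sum.insert) auto
  ultimately show ?thesis
    by (simp add: sum.reindex add.assoc)
qed

text \<open>The case \<open>m = 0\<close> gives linear independence of the substituted words, the case \<open>m = 2\<close>
  allows halving. The induction works because the coefficients of \<open>aav\<close> and \<open>bav\<close> are
  those of \<open>av\<close> in the part beginning with \<open>c\<close>, plus, for \<open>bav\<close>, that of \<open>v\<close> in the
  part beginning with \<open>d\<close>.\<close>

lemma word_coeff_independent:
  assumes "\<And>v. m dvd (\<Sum>w\<in>words N. G w * word_coeff w v)" and "w \<in> words N"
  shows "(m::int) dvd G w"
  using assms
proof (induction N arbitrary: G w)
  case 0
  then show ?case using "0.prems"(1)[of "[]"] by simp
next
  case (Suc N)
  define S where "S G v = (\<Sum>w\<in>words N. G w * word_coeff w v)" for G v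
  have eq: "(\<Sum>w\<in>words (Suc N). G w * word_coeff w (l # v)) =
      S (\<lambda>w. G (Lc # w)) v +
      (case v of [] \<Rightarrow> 0 | l' # v' \<Rightarrow> if l \<noteq> l' then S (\<lambda>w. G (Ld # w)) v' else 0)" for l v
    by (cases v) (auto simp: sum_words_Suc S_def)
  have d: "m dvd S (\<lambda>w. G (Ld # w)) v" for v
  proof -
    have "m dvd S (\<lambda>w. G (Lc # w)) (La # v)"
      using Suc.prems(1)[of "La # La # v"] unfolding eq by simp
    moreover have "m dvd S (\<lambda>w. G (Lc # w)) (La # v) + S (\<lambda>w. G (Ld # w)) v"
      using Suc.prems(1)[of "Lb # La # v"] unfolding eq by simp
    ultimately show ?thesis
      by (simp add: dvd_add_right_iff)
  qed
  have c: "m dvd S (\<lambda>w. G (Lc # w)) v" for v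
  proof -
    have "m dvd (case v of [] \<Rightarrow> 0 | l' # v' \<Rightarrow> if La \<noteq> l' then S (\<lambda>w. G (Ld # w)) v' else 0)"
      using d by (auto split: list.split)
    then show ?thesis
      using Suc.prems(1)[of "La # v"] unfolding eq by (simp add: dvd_add_left_iff)
  qed
  show ?case
  proof (cases w)
    case Nil
    then show ?thesis using Suc.prems(1)[of "[]"] by (simp add: sum_words_Suc)
  next
    case (Cons x w')
    then have "w' \<in> words N" using Suc.prems(2) by (auto simp: words_def)
    then show ?thesis
      using Suc.IH[of "\<lambda>w. G (Lc # w)" w'] Suc.IH[of "\<lambda>w. G (Ld # w)" w'] c d
      unfolding S_def Cons by (cases x) auto
  qed
qed

text \<open>The terms of the coproduct: one letter is cut out, \<open>c\<close> leaving \<open>1 \<otimes> 1\<close> twice and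
  \<open>d\<close> leaving \<open>c \<otimes> 1 + 1 \<otimes> c\<close>.\<close>

fun cuts :: "cd list \<Rightarrow> (cd list \<times> cd list) list" where
  "cuts [] = []"
| "cuts (Lc # w) = ([], w) # ([], w) # map (apfst (Cons Lc)) (cuts w)"
| "cuts (Ld # w) = ([Lc], w) # ([], Lc # w) # map (apfst (Cons Ld)) (cuts w)"

text \<open>Summing over the letter at one position forgets it. If the position belongs to a c, both
  choices match, whence the double cut. If it belongs to a d, exactly one choice matches and the
  other letter of the d becomes free, as in a c at the end of \<open>p\<close> or at the start of
  \<open>q\<close>.\<close>

lemma word_coeff_cuts:
  "word_coeff w (v @ La # v') + word_coeff w (v @ Lb # v') =
     (\<Sum>(p, q)\<leftarrow>cuts w. word_coeff p v * word_coeff q v')"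
proof (induction w arbitrary: v)
  case (Cons x w)
  show ?case
  proof (cases x)
    case Lc
    then show ?thesis
      by (cases v) (auto simp: Cons o_def case_prod_beta)
  next
    case Ld
    consider "v = []" | l where "v = [l]" | l l' u where "v = l # l' # u"
      by (metis neq_Nil_conv)
    then show ?thesis
    proof cases
      case 1
      show ?thesis
        by (cases v') (use 1 Ld in \<open>auto simp: o_def case_prod_beta\<close>, (metis ab.exhaust)+)
    next
      case 2
      then show ?thesis
        using Ld by (cases l) (auto simp: o_def case_prod_beta)
    next
      case 3
      then show ?thesis
        using Ld by (auto simp: Cons o_def case_prod_beta)
    qed
  qed
qed auto

lemma count_list_map_apfst:
  "count_list (map (apfst (Cons x)) ps) (p, q) =
     (case p of [] \<Rightarrow> 0 | y # p' \<Rightarrow> if x = y then count_list ps (p', q) else 0)"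
  by (induction ps) (auto split: list.split)

text \<open>Read backwards, the gap between \<open>p\<close> and \<open>q\<close> is filled by a c,
  or a c adjacent to the gap is enlarged to a d. These three possibilities become the three terms of
  \<open>coeff_coproduct\<close>.\<close>

lemma count_list_cuts:
  "int (count_list (cuts w) (p, q)) =
     2 * of_bool (w = p @ Lc # q)
     + of_bool (p \<noteq> [] \<and> last p = Lc \<and> w = butlast p @ Ld # q)
     + of_bool (q \<noteq> [] \<and> hd q = Lc \<and> w = p @ Ld # tl q)"
proof (induction w arbitrary: p)
  case (Cons x w)
  show ?case
  proof (cases x)
    case Lc
    then show ?thesis
      by (cases p) (auto simp: Cons count_list_map_apfst)
  next
    case Ld
    show ?thesis
    proof (cases p)
      case Nil
      then show ?thesis using Ld by (cases q) (auto simp: count_list_map_apfst)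
    next
      case (Cons y p')
      then show ?thesis using Ld Cons.IH
        by (cases p') (auto simp: count_list_map_apfst Cons.IH)
    qed
  qed
qed auto

lemma keys_subset_words: "\<exists>N. Poly_Mapping.keys F \<subseteq> words N" for F :: "cd ncpoly"
proof -
  have "\<forall>w\<in>Poly_Mapping.keys F. length w \<le> Max (length ` Poly_Mapping.keys F)"
    by (simp add: Max_ge)
  then show ?thesis unfolding words_def by blast
qed

section \<open>Substitution into noncommutative polynomials\<close>

lemma ncsubst_superset:
  assumes "finite S" "Poly_Mapping.keys F \<subseteq> S"
  shows "ncsubst g F = (\<Sum>w\<in>S. of_int (Poly_Mapping.lookup F w) * prod_list (map g w))"
  unfolding ncsubst_def
  by (rule sum.mono_neutral_left) (use assms in \<open>auto simp: in_keys_iff\<close>)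

lemma ncsubst_diff: "ncsubst g (F - G) = ncsubst g F - ncsubst g G"
proof -
  let ?S = "Poly_Mapping.keys F \<union> Poly_Mapping.keys G"
  have "Poly_Mapping.keys (F - G) \<subseteq> ?S"
    by (auto simp: in_keys_iff lookup_minus)
  then have "ncsubst g (F - G) =
      (\<Sum>w\<in>?S. of_int (Poly_Mapping.lookup (F - G) w) * prod_list (map g w))"
    by (intro ncsubst_superset) auto
  then show ?thesis
    by (simp add: ncsubst_superset[of ?S] lookup_minus left_diff_distrib sum_subtractf)
qed

lemma ncsubst_0 [simp]: "ncsubst g 0 = 0"
  by (simp add: ncsubst_def)

lemma ncsubst_add: "ncsubst g (F + G) = ncsubst g F + ncsubst g G"
  using ncsubst_diff[of g F "0 - G"] ncsubst_diff[of g 0 G] by simp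

lemma ncsubst_frag_of: "ncsubst g (frag_of w) = prod_list (map g w)"
  by (simp add: ncsubst_def)

lemma frag_of_mult: "frag_of u * frag_of v = frag_of (u @ v)"
  by (simp add: mult_single plus_list_def)

lemma frag_of_Nil: "frag_of [] = 1"
  by (metis single_one zero_list_def)

text \<open>Integral polynomials form the free abelian group on the words, so
  \<open>frag_induction\<close> in both factors reduces the claim to concatenation of words.\<close>

lemma ncsubst_mult: "ncsubst g (F * G) = ncsubst g F * ncsubst g G" for F :: "'x ncpoly"
proof (rule frag_induction[of F UNIV])
  fix u :: "'x list"
  show "ncsubst g (frag_of u * G) = ncsubst g (frag_of u) * ncsubst g G"
  proof (rule frag_induction[of G UNIV])
    fix v :: "'x list"
    show "ncsubst g (frag_of u * frag_of v) = ncsubst g (frag_of u) * ncsubst g (frag_of v)"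
      unfolding frag_of_mult ncsubst_frag_of by simp
  qed (auto simp: right_diff_distrib ncsubst_diff)
qed (auto simp: left_diff_distrib ncsubst_diff)

lemma ncsubst_1 [simp]: "ncsubst g 1 = 1"
  using ncsubst_frag_of[of g "[]"] by (simp add: frag_of_Nil)

lemma ncsubst_ncvar [simp]: "ncsubst g (ncvar x) = g x"
  using ncsubst_frag_of[of g "[x]"] by (simp add: ncvar_def)

lemma ncsubst_power: "ncsubst g (F ^ k) = ncsubst g F ^ k"
  by (induction k) (auto simp: ncsubst_mult)

lemma lookup_ncvar_mult:
  "Poly_Mapping.lookup (ncvar x * F) v =
     (case v of [] \<Rightarrow> 0 | y # v' \<Rightarrow> if x = y then Poly_Mapping.lookup F v' else 0)"
proof (rule frag_induction[of F UNIV])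
  fix u
  have "ncvar x * frag_of u = frag_of (x # u)"
    by (simp add: ncvar_def frag_of_mult)
  then show "Poly_Mapping.lookup (ncvar x * frag_of u) v =
     (case v of [] \<Rightarrow> 0 | y # v' \<Rightarrow> if x = y then Poly_Mapping.lookup (frag_of u) v' else 0)"
    by (auto simp: lookup_single split: list.split)
qed (auto simp: right_diff_distrib lookup_minus split: list.split)

lemma lookup_of_int_mult:
  "Poly_Mapping.lookup (of_int k * F) v = k * Poly_Mapping.lookup F v" for F :: "'x ncpoly"
  by (induction k rule: int_induct[of _ 0]) (auto simp: distrib_right left_diff_distrib lookup_add lookup_minus)

lemma lookup_frag_of_mult:
  "Poly_Mapping.lookup (frag_of u * F) v =
     (if take (length u) v = u then Poly_Mapping.lookup F (drop (length u) v) else 0)"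
proof (rule frag_induction[of F UNIV])
  fix w
  show "Poly_Mapping.lookup (frag_of u * frag_of w) v =
     (if take (length u) v = u then Poly_Mapping.lookup (frag_of w) (drop (length u) v) else 0)"
    unfolding frag_of_mult by (auto simp: lookup_single) (metis append_take_drop_id)
qed (auto simp: right_diff_distrib lookup_minus)

section \<open>Degrees of cd-words and homogeneous polynomials\<close>

lemma cd_length_pos: "w \<noteq> [] \<Longrightarrow> cd_length w > 0"
  using length_le_cd_length[of w] by (cases w) auto

text \<open>Of two prefixes of a word one extends the other, and a nonempty extension has positive
  length. So the degree alone locates the cut in a product.\<close>

lemma append_eq_append_cd_length:
  assumes "u @ v = p @ q" "cd_length u = cd_length p"
  shows "u = p"
proof -
  obtain us where "u @ us = p \<or> u = p @ us"
    using assms(1) by (auto simp: append_eq_append_conv2)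
  then show ?thesis
    using assms(2) cd_length_pos[of us] by (metis add_cancel_left_right cd_length_simps(3)
        append.right_neutral less_irrefl)
qed

definition homogeneous :: "nat \<Rightarrow> cd ncpoly \<Rightarrow> bool" where
  "homogeneous n F \<longleftrightarrow> (\<forall>w. Poly_Mapping.lookup F w \<noteq> 0 \<longrightarrow> cd_length w = n)"

lemma frag_of_expansion:
  "F = (\<Sum>u\<in>Poly_Mapping.keys F. of_int (Poly_Mapping.lookup F u) * frag_of u)" for F :: "'x ncpoly"
  by (intro poly_mapping_eqI)
     (simp add: lookup_sum lookup_of_int_mult in_keys_iff if_distrib cong: if_cong)

lemma lookup_mult_frag_of_expansion:
  "Poly_Mapping.lookup (F * G) w =
    (\<Sum>u\<in>Poly_Mapping.keys F. Poly_Mapping.lookup F u * Poly_Mapping.lookup (frag_of u * G) w)"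
  for F :: "'x ncpoly"
proof -
  have "F * G = (\<Sum>u\<in>Poly_Mapping.keys F. of_int (Poly_Mapping.lookup F u) * (frag_of u * G))"
    by (subst frag_of_expansion) (simp add: sum_distrib_right mult.assoc)
  then show ?thesis
    by (simp add: lookup_sum lookup_of_int_mult)
qed

text \<open>Homogeneity admits only one splitting of the word, so no sum over splittings remains.
  This makes a single coefficient multiplicative for star products.\<close>

lemma lookup_mult_homogeneous:
  assumes "homogeneous (cd_length p) F"
  shows "Poly_Mapping.lookup (F * G) (p @ q) = Poly_Mapping.lookup F p * Poly_Mapping.lookup G q"
proof -
  have *: "Poly_Mapping.lookup F u * Poly_Mapping.lookup (frag_of u * G) (p @ q) =
      (if u = p then Poly_Mapping.lookup F p * Poly_Mapping.lookup G q else 0)" for u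
  proof (cases "Poly_Mapping.lookup F u = 0")
    case False
    then have "cd_length u = cd_length p"
      using assms by (simp add: homogeneous_def)
    then have "take (length u) (p @ q) = u \<Longrightarrow> u = p"
      by (metis append_take_drop_id append_eq_append_cd_length)
    then show ?thesis
      by (auto simp: lookup_frag_of_mult)
  qed auto
  show ?thesis
    by (subst lookup_mult_frag_of_expansion) (simp add: * in_keys_iff)
qed

lemma homogeneous_mult:
  assumes "homogeneous m F" "homogeneous n G"
  shows "homogeneous (m + n) (F * G)"
  unfolding homogeneous_def
proof (intro allI impI)
  fix w
  assume "Poly_Mapping.lookup (F * G) w \<noteq> 0"
  then obtain u where u: "Poly_Mapping.lookup F u * Poly_Mapping.lookup (frag_of u * G) w \<noteq> 0"
    by (subst (asm) lookup_mult_frag_of_expansion) (elim sum.not_neutral_contains_not_neutral)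
  then have "take (length u) w = u" "Poly_Mapping.lookup G (drop (length u) w) \<noteq> 0"
    by (auto simp: lookup_frag_of_mult split: if_splits)
  then have "cd_length w = cd_length u + cd_length (drop (length u) w)"
    by (metis append_take_drop_id cd_length_simps(3))
  then show "cd_length w = m + n"
    using u assms \<open>Poly_Mapping.lookup G _ \<noteq> 0\<close> by (simp add: homogeneous_def)
qed

lemma lookup_cd_to_ab_mult_Nil [simp]: "Poly_Mapping.lookup (cd_to_ab x * F) [] = 0"
  by (cases x) (auto simp: distrib_right lookup_add lookup_ncvar_mult mult.assoc)

lemma lookup_prod_letters:
  "Poly_Mapping.lookup (prod_list (map cd_to_ab w)) v = word_coeff w v"
proof (induction w v rule: word_coeff.induct)
  case (1 v)
  then show ?case by (auto simp: lookup_one zero_list_def when_def)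
next
  case (2 w l v)
  then show ?case
    by (cases l) (auto simp: distrib_right lookup_add lookup_ncvar_mult)
next
  case (3 w l l' v)
  then show ?case
    by (cases l; cases l') (auto simp: distrib_right lookup_add lookup_ncvar_mult mult.assoc)
qed (auto simp: distrib_right lookup_add lookup_ncvar_mult mult.assoc)

lemma lookup_ncsubst:
  assumes "Poly_Mapping.keys F \<subseteq> words N"
  shows "Poly_Mapping.lookup (ncsubst cd_to_ab F) v =
    (\<Sum>w\<in>words N. Poly_Mapping.lookup F w * word_coeff w v)"
  by (simp add: ncsubst_superset[OF finite_words assms] lookup_sum lookup_of_int_mult
      lookup_prod_letters)

lemma ncsubst_dvd:
  assumes "\<And>v. m dvd Poly_Mapping.lookup (ncsubst cd_to_ab F) v"
  shows "m dvd Poly_Mapping.lookup F w"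
proof (cases "w \<in> Poly_Mapping.keys F")
  case True
  obtain N where "Poly_Mapping.keys F \<subseteq> words N"
    using keys_subset_words by blast
  then show ?thesis
    using word_coeff_independent[of m "Poly_Mapping.lookup F" N w] assms True
    by (auto simp: lookup_ncsubst)
qed (simp add: in_keys_iff)

lemma ncsubst_inj: "ncsubst cd_to_ab F = ncsubst cd_to_ab G \<Longrightarrow> F = G"
proof -
  assume "ncsubst cd_to_ab F = ncsubst cd_to_ab G"
  then have "ncsubst cd_to_ab (F - G) = 0"
    by (simp add: ncsubst_diff)
  then have "0 dvd Poly_Mapping.lookup (F - G) w" for w
    by (intro ncsubst_dvd) (simp only: lookup_zero dvd_0_right)
  then have "Poly_Mapping.lookup F w = Poly_Mapping.lookup G w" for w
    by (simp add: lookup_minus)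
  then show "F = G"
    by (rule poly_mapping_eqI)
qed

text \<open>The recursion for the ab-index reaches only its double. Independence modulo 2 makes all
  coefficients of \<open>F\<close> even, so no denominators arise.\<close>

lemma ncsubst_halve:
  assumes "2 * X = ncsubst cd_to_ab F"
  shows "\<exists>G. X = ncsubst cd_to_ab G"
proof -
  define G where "G = Poly_Mapping.map (\<lambda>k. k div 2) F"
  have "2 dvd Poly_Mapping.lookup F w" for w
    by (rule ncsubst_dvd)
       (use lookup_of_int_mult[of 2 X] in \<open>simp only: assms[symmetric] of_int_numeral dvd_triv_left\<close>)
  then have "F = G + G"
    by (intro poly_mapping_eqI) (auto simp: G_def lookup_add Poly_Mapping.map.rep_eq when_def)
  then have "2 * X = 2 * ncsubst cd_to_ab G"
    using assms by (simp add: ncsubst_add mult_2)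
  then have "2 * Poly_Mapping.lookup X v = 2 * Poly_Mapping.lookup (ncsubst cd_to_ab G) v" for v
    using lookup_of_int_mult[of 2 X v] lookup_of_int_mult[of 2 "ncsubst cd_to_ab G" v]
    by (simp only: of_int_numeral)
  then have "X = ncsubst cd_to_ab G"
    by (intro poly_mapping_eqI) simp
  then show ?thesis by blast
qed

section \<open>Chains in Eulerian posets\<close>

text \<open>The rank function is a parameter and no bounds are fixed, so that one locale serves all
  intervals with their ambient ranks as well as constructed posets with explicit ranks. Gradedness
  enters in the form \<open>rank_gap\<close>; \<open>euler\<close> is the equality of even and odd
  counts written as a signed sum.\<close>

locale euler_poset =
  fixes P :: "'a rel" and r :: "'a \<Rightarrow> nat"
  assumes finite_Field: "finite (Field P)"
    and partial_order: "Partial_order P"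
    and rank_less: "(x, y) \<in> P \<Longrightarrow> x \<noteq> y \<Longrightarrow> r x < r y"
    and rank_gap: "(x, y) \<in> P \<Longrightarrow> r x + 1 < r y \<Longrightarrow> \<exists>z. (x, z) \<in> P \<and> (z, y) \<in> P \<and> r x < r z \<and> r z < r y"
    and euler: "(x, y) \<in> P \<Longrightarrow> x \<noteq> y \<Longrightarrow> (\<Sum>z\<in>interval P x y. (-1) ^ r z) = (0::int)"
begin

lemma P_refl: "x \<in> Field P \<Longrightarrow> (x, x) \<in> P"
  using partial_order by (auto simp: partial_order_on_def preorder_on_def refl_on_def)

lemma P_trans: "(x, y) \<in> P \<Longrightarrow> (y, z) \<in> P \<Longrightarrow> (x, z) \<in> P"
  using partial_order by (meson partial_order_on_def preorder_on_def transD)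

lemma P_antisym: "(x, y) \<in> P \<Longrightarrow> (y, x) \<in> P \<Longrightarrow> x = y"
  using partial_order by (meson partial_order_on_def antisymD)

definition between :: "'a \<Rightarrow> 'a \<Rightarrow> 'a set" where
  "between x y = {z. (x, z) \<in> P \<and> (z, y) \<in> P \<and> z \<noteq> x \<and> z \<noteq> y}"

lemma between_Field: "between x y \<subseteq> Field P"
  by (auto simp: between_def FieldI1)

lemma finite_between [simp]: "finite (between x y)"
  using finite_subset[OF between_Field finite_Field] .

lemma between_rank: "z \<in> between x y \<Longrightarrow> r x < r z \<and> r z < r y"
  using rank_less by (auto simp: between_def)

lemma betweenD: "z \<in> between x y \<Longrightarrow> (x, z) \<in> P" "z \<in> between x y \<Longrightarrow> (z, y) \<in> P"
  by (auto simp: between_def)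

lemma between_lower: "w \<in> between x z \<Longrightarrow> z \<in> between x y \<Longrightarrow> w \<in> between x y"
  using P_trans P_antisym unfolding between_def by blast

lemma between_upper: "w \<in> between z y \<Longrightarrow> z \<in> between x y \<Longrightarrow> w \<in> between x y"
  using P_trans P_antisym unfolding between_def by blast

lemma between_swap:
  "z \<in> between x y \<and> w \<in> between x z \<longleftrightarrow> w \<in> between x y \<and> z \<in> between w y"
proof
  assume *: "z \<in> between x y \<and> w \<in> between x z"
  then have "r w < r z" "r z < r y" by (auto dest: between_rank)
  then have "w \<noteq> y" by auto
  moreover have "(w, y) \<in> P" using * P_trans[of w z y] by (simp add: between_def)
  ultimately show "w \<in> between x y \<and> z \<in> between w y"
    using * by (auto simp: between_def)
next
  assume *: "w \<in> between x y \<and> z \<in> between w y"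
  then have "r x < r w" "r w < r z" by (auto dest: between_rank)
  then have "z \<noteq> x" by auto
  moreover have "(x, z) \<in> P" using * P_trans[of x w z] by (simp add: between_def)
  ultimately show "z \<in> between x y \<and> w \<in> between x z"
    using * by (auto simp: between_def)
qed

definition chains :: "'a \<Rightarrow> 'a \<Rightarrow> 'a set set" where
  "chains x y = {C \<in> Chains P. C \<subseteq> between x y}"

lemma finite_chains [simp]: "finite (chains x y)"
  by (rule finite_subset[of _ "Pow (between x y)"]) (auto simp: chains_def)

lemma chains_between: "C \<in> chains x y \<Longrightarrow> C \<subseteq> between x y"
  by (simp add: chains_def)

lemma finite_chain: "C \<in> chains x y \<Longrightarrow> finite C"
  using chains_between finite_between finite_subset by metis

lemma empty_chain [simp]: "{} \<in> chains x y"
  by (simp add: chains_def Chains_def)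

lemma chains_rank_less:
  assumes "C \<in> chains x y" "u \<in> C" "v \<in> C" "r u < r v"
  shows "(u, v) \<in> P"
proof -
  have "(u, v) \<in> P \<or> (v, u) \<in> P"
    using assms by (auto simp: chains_def Chains_def)
  then show ?thesis
    using rank_less[of v u] assms(4) by auto
qed

lemma chains_rank_inj:
  assumes "C \<in> chains x y" "u \<in> C" "v \<in> C" "r u = r v"
  shows "u = v"
proof -
  have "(u, v) \<in> P \<or> (v, u) \<in> P"
    using assms by (auto simp: chains_def Chains_def)
  then show ?thesis
    using rank_less[of v u] rank_less[of u v] assms(4) by auto
qed

lemma chains_rank:
  "C \<in> chains x y \<Longrightarrow> u \<in> C \<Longrightarrow> r x < r u \<and> r u < r y"
  using chains_between between_rank by blast

lemma chains_subset: "C \<in> chains x y \<Longrightarrow> D \<subseteq> C \<Longrightarrow> D \<subseteq> between u v \<Longrightarrow> D \<in> chains u v"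
  unfolding chains_def Chains_def by blast

lemma chains_join:
  assumes z: "z \<in> between x y" and C: "C \<in> chains x z" and D: "D \<in> chains z y"
  shows "insert z (C \<union> D) \<in> chains x y"
proof -
  have "insert z (C \<union> D) \<subseteq> between x y"
    using assms between_lower between_upper chains_between by blast
  moreover have "(u, z) \<in> P" if "u \<in> C" for u
    using that C chains_between betweenD(2) by blast
  moreover have "(z, v) \<in> P" if "v \<in> D" for v
    using that D chains_between betweenD(1) by blast
  moreover have "(z, z) \<in> P"
    using z between_Field P_refl by blast
  ultimately show ?thesis
    using C D P_trans unfolding chains_def Chains_def by blast
qed

lemma chains_cut:
  assumes C: "C \<in> chains x y" and z: "z \<in> C"
  shows "{u\<in>C. r u < r z} \<in> chains x z" "{u\<in>C. r u > r z} \<in> chains z y"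
    "insert z ({u\<in>C. r u < r z} \<union> {u\<in>C. r u > r z}) = C"
proof -
  have "u \<in> between x z" if "u \<in> C" "r u < r z" for u
    using that chains_between[OF C] chains_rank_less[OF C _ z] unfolding between_def by blast
  then show "{u\<in>C. r u < r z} \<in> chains x z"
    by (intro chains_subset[OF C]) auto
  have "u \<in> between z y" if "u \<in> C" "r u > r z" for u
    using that chains_between[OF C] chains_rank_less[OF C z] unfolding between_def by blast
  then show "{u\<in>C. r u > r z} \<in> chains z y"
    by (intro chains_subset[OF C]) auto
  show "insert z ({u\<in>C. r u < r z} \<union> {u\<in>C. r u > r z}) = C"
    using chains_rank_inj[OF C _ z] z linorder_neqE_nat by blast
qed

lemma chains_join_cut:
  assumes z: "z \<in> between x y" and C: "C \<in> chains x z" and D: "D \<in> chains z y"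
  shows "{u\<in>insert z (C \<union> D). r u < r z} = C" "{u\<in>insert z (C \<union> D). r u > r z} = D"
  using chains_rank[OF C] chains_rank[OF D] by (auto dest: less_asym)

text \<open>Ranks are injective on a chain, so it has at most one element \<open>z\<close> of rank
  \<open>k\<close>; its parts below and above \<open>z\<close> can be chosen independently.\<close>

lemma sum_chains_split:
  fixes G :: "'a set \<Rightarrow> 'b::comm_monoid_add"
  shows "(\<Sum>C | C \<in> chains x y \<and> k \<in> r ` C. G C) =
    (\<Sum>z | z \<in> between x y \<and> r z = k. \<Sum>C\<in>chains x z. \<Sum>D\<in>chains z y. G (insert z (C \<union> D)))"
proof -
  define el where "el C = (THE z. z \<in> C \<and> r z = k)" for C
  have el: "el C = z" if "C \<in> chains x y" "z \<in> C" "r z = k" for C z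
    unfolding el_def using that chains_rank_inj by blast
  let ?S = "Sigma {z \<in> between x y. r z = k} (\<lambda>z. chains x z \<times> chains z y)"
  have "(\<Sum>C | C \<in> chains x y \<and> k \<in> r ` C. G C) = (\<Sum>(z, C, D)\<in>?S. G (insert z (C \<union> D)))"
  proof (rule sum.reindex_bij_witness[where i = "\<lambda>(z, C, D). insert z (C \<union> D)"
        and j = "\<lambda>C. (el C, {u\<in>C. r u < r (el C)}, {u\<in>C. r u > r (el C)})"])
    fix C assume "C \<in> {C \<in> chains x y. k \<in> r ` C}"
    then obtain z where C: "C \<in> chains x y" "z \<in> C" "r z = k" "el C = z"
      using el by blast
    note cut = chains_cut[OF C(1,2)]
    show "(case (el C, {u\<in>C. r u < r (el C)}, {u\<in>C. r u > r (el C)}) of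
        (z, C, D) \<Rightarrow> insert z (C \<union> D)) = C"
      using cut by (simp add: C(4))
    show "(el C, {u\<in>C. r u < r (el C)}, {u\<in>C. r u > r (el C)}) \<in> ?S"
      using cut C chains_between[OF C(1)] by auto
    show "(case (el C, {u\<in>C. r u < r (el C)}, {u\<in>C. r u > r (el C)}) of
        (z, C, D) \<Rightarrow> G (insert z (C \<union> D))) = G C"
      using cut by (simp add: C(4))
  next
    fix t assume "t \<in> ?S"
    then obtain z C D where t: "t = (z, C, D)" "z \<in> between x y" "r z = k"
      "C \<in> chains x z" "D \<in> chains z y" by blast
    have j: "insert z (C \<union> D) \<in> chains x y"
      using chains_join t by blast
    moreover have "el (insert z (C \<union> D)) = z"
      using el[OF j] t by simp
    ultimately show "(case t of (z, C, D) \<Rightarrow> insert z (C \<union> D)) \<in> {C \<in> chains x y. k \<in> r ` C}"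
      "(el (case t of (z, C, D) \<Rightarrow> insert z (C \<union> D)),
        {u \<in> (case t of (z, C, D) \<Rightarrow> insert z (C \<union> D)). r u < r (el (case t of (z, C, D) \<Rightarrow> insert z (C \<union> D)))},
        {u \<in> (case t of (z, C, D) \<Rightarrow> insert z (C \<union> D)). r u > r (el (case t of (z, C, D) \<Rightarrow> insert z (C \<union> D)))}) = t"
      using chains_join_cut[OF t(2,4,5)] t by auto
  qed
  also have "\<dots> = (\<Sum>z | z \<in> between x y \<and> r z = k. \<Sum>(C, D)\<in>chains x z \<times> chains z y. G (insert z (C \<union> D)))"
    by (subst sum.Sigma) (auto simp: case_prod_beta)
  finally show ?thesis
    by (simp add: sum.cartesian_product)
qed

text \<open>A nonempty chain amounts to its largest element \<open>z\<close> and a chain below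
  \<open>z\<close>.\<close>

lemma sum_chains_top:
  fixes G :: "'a set \<Rightarrow> 'b::comm_monoid_add"
  shows "(\<Sum>C\<in>chains x y. G C) = G {} + (\<Sum>z\<in>between x y. \<Sum>C\<in>chains x z. G (insert z C))"
proof -
  define el where "el C = (THE z. z \<in> C \<and> (\<forall>u\<in>C. r u \<le> r z))" for C
  have el: "el C = z" if "C \<in> chains x y" "z \<in> C" "\<forall>u\<in>C. r u \<le> r z" for C z
    unfolding el_def
  proof (rule the_equality)
    show "w = z" if "w \<in> C \<and> (\<forall>u\<in>C. r u \<le> r w)" for w
      using that \<open>C \<in> chains x y\<close> \<open>z \<in> C\<close> \<open>\<forall>u\<in>C. r u \<le> r z\<close> chains_rank_inj le_antisym by metis
  qed (use that in auto)
  let ?S = "Sigma (between x y) (\<lambda>z. chains x z)"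
  have "(\<Sum>C\<in>chains x y - {{}}. G C) = (\<Sum>(z, C)\<in>?S. G (insert z C))"
  proof (rule sum.reindex_bij_witness[where i = "\<lambda>(z, C). insert z C"
        and j = "\<lambda>C. (el C, {u\<in>C. r u < r (el C)})"])
    fix C assume C: "C \<in> chains x y - {{}}"
    then have "Max (r ` C) \<in> r ` C"
      by (intro Max_in) (auto simp: finite_chain)
    then obtain z where z: "z \<in> C" "Max (r ` C) = r z" by blast
    then have max: "\<forall>u\<in>C. r u \<le> r z"
      using C by (metis DiffD1 Max_ge finite_chain finite_imageI imageI)
    have zb: "z \<in> between x y" using chains_between C z by blast
    have "el C = z" using el C z max by blast
    have "{u\<in>C. r u > r z} = {}" using max by (auto simp: not_less)
    then have cut: "insert z {u\<in>C. r u < r z} = C" "{u\<in>C. r u < r z} \<in> chains x z"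
      using chains_cut[of C x y z] C z by auto
    show "(case (el C, {u\<in>C. r u < r (el C)}) of (z, C) \<Rightarrow> insert z C) = C"
      using cut by (simp add: \<open>el C = z\<close>)
    show "(el C, {u\<in>C. r u < r (el C)}) \<in> ?S"
      using cut zb by (simp add: \<open>el C = z\<close>)
    show "(case (el C, {u\<in>C. r u < r (el C)}) of (z, C) \<Rightarrow> G (insert z C)) = G C"
      using cut by (simp add: \<open>el C = z\<close>)
  next
    fix t assume "t \<in> ?S"
    then obtain z C where t: "t = (z, C)" "z \<in> between x y" "C \<in> chains x z" by blast
    have j: "insert z C \<in> chains x y"
      using chains_join[OF t(2,3) empty_chain] by simp
    moreover have "el (insert z C) = z"
      using el[OF j, of z] chains_rank[OF t(3)] by (simp add: less_imp_le)
    moreover have "{u\<in>insert z C. r u < r z} = C"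
      using chains_rank[OF t(3)] by auto
    ultimately show "(case t of (z, C) \<Rightarrow> insert z C) \<in> chains x y - {{}}"
      "(el (case t of (z, C) \<Rightarrow> insert z C),
        {u \<in> (case t of (z, C) \<Rightarrow> insert z C). r u < r (el (case t of (z, C) \<Rightarrow> insert z C))}) = t"
      using t by auto
  qed
  also have "\<dots> = (\<Sum>z\<in>between x y. \<Sum>C\<in>chains x z. G (insert z C))"
    by (subst sum.Sigma) auto
  finally show ?thesis
    by (subst sum.remove[of _ "{}"]) auto
qed

lemma rank_image_join:
  assumes z: "z \<in> between x y" and C: "C \<in> chains x z" and D: "D \<in> chains z y"
  shows "i < r z \<Longrightarrow> i \<in> r ` insert z (C \<union> D) \<longleftrightarrow> i \<in> r ` C"
    "r z < i \<Longrightarrow> i \<in> r ` insert z (C \<union> D) \<longleftrightarrow> i \<in> r ` D"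
  using chains_rank[OF C] chains_rank[OF D] by (auto dest: less_asym)

section \<open>The chain polynomial and its two recursions\<close>

lemma upt_split: "r x < r z \<Longrightarrow> r z < r y \<Longrightarrow>
    [Suc (r x)..<r y] = [Suc (r x)..<r z] @ r z # [Suc (r z)..<r y]"
  using upt_add_eq_append[of "Suc (r x)" "r z" "r y - r z"] upt_conv_Cons[of "r z" "r y"] by simp

text \<open>For \<open>e = a - b\<close> this is the ab-index of the interval, expressed by flag
  f-numbers: expanding the factors a - b performs the inclusion-exclusion that leads to the
  h-numbers, see \<open>prod_list_ab_expand\<close>.\<close>

definition chain_poly :: "'r::ring_1 \<Rightarrow> 'r \<Rightarrow> 'a \<Rightarrow> 'a \<Rightarrow> 'r" where
  "chain_poly e b x y =
     (\<Sum>C\<in>chains x y. prod_list (map (\<lambda>i. if i \<in> r ` C then b else e) [Suc (r x)..<r y]))"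

lemma prod_list_replicate: "prod_list (map (\<lambda>i. c) xs) = c ^ length xs"
  by (induction xs) auto

text \<open>Above the top element \<open>z\<close> of a chain all factors are \<open>e\<close>; the
  first summand belongs to the empty chain.\<close>

lemma chain_poly_top:
  fixes e b :: "'r::ring_1"
  shows "chain_poly e b x y = e ^ (r y - r x - 1) +
    (\<Sum>z\<in>between x y. chain_poly e b x z * b * e ^ (r y - r z - 1))"
proof -
  have "prod_list (map (\<lambda>i. if i \<in> r ` insert z C then b else e) [Suc (r x)..<r y]) =
      prod_list (map (\<lambda>i. if i \<in> r ` C then b else e) [Suc (r x)..<r z]) * b * e ^ (r y - r z - 1)"
    if z: "z \<in> between x y" and C: "C \<in> chains x z" for z C
  proof -
    have 1: "map (\<lambda>i. if i \<in> r ` insert z C then b else e) [Suc (r x)..<r z] =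
        map (\<lambda>i. if i \<in> r ` C then b else e) [Suc (r x)..<r z]"
      using rank_image_join(1)[OF z C empty_chain] by (intro map_cong) simp_all
    have "map (\<lambda>i. if i \<in> r ` insert z C then b else e) [Suc (r z)..<r y] =
        map (\<lambda>i. e) [Suc (r z)..<r y]"
      using rank_image_join(2)[OF z C empty_chain] by (intro map_cong) simp_all
    then have "prod_list (map (\<lambda>i. if i \<in> r ` insert z C then b else e) [Suc (r z)..<r y]) =
        e ^ (r y - r z - 1)"
      by (simp only: prod_list_replicate) simp
    then show ?thesis
      using between_rank[OF z]
      by (simp only: upt_split[of x z y] map_append list.map prod_list.append prod_list.Cons 1)
         (simp add: mult.assoc)
  qed
  then show ?thesis
    unfolding chain_poly_def
    by (subst sum_chains_top) (simp add: sum_distrib_right prod_list_replicate)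
qed

lemma euler_between:
  assumes "(x, y) \<in> P" "x \<noteq> y"
  shows "(\<Sum>z\<in>between x y. (-1) ^ r z) = - ((-1) ^ r x) - (-1::int) ^ r y"
proof -
  have "interval P x y = insert x (insert y (between x y))"
    using assms P_refl by (auto simp: interval_def between_def FieldI1 FieldI2)
  moreover have "x \<notin> between x y" "y \<notin> between x y" by (auto simp: between_def)
  ultimately show ?thesis
    using euler[OF assms] assms(2) by (simp add: algebra_simps)
qed

lemma sum_between_swap:
  fixes g :: "'a \<Rightarrow> 'a \<Rightarrow> 'b::comm_monoid_add"
  shows "(\<Sum>z\<in>between x y. \<Sum>w\<in>between x z. g w z) = (\<Sum>w\<in>between x y. \<Sum>z\<in>between w y. g w z)"
proof -
  have "between x z = {w\<in>between x y. z \<in> between w y}" if "z \<in> between x y" for z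
    using that between_swap by blast
  moreover have "between w y = {z\<in>between x y. z \<in> between w y}" if "w \<in> between x y" for w
    using that between_upper by blast
  ultimately show ?thesis
    using sum.swap_restrict[of "between x y" "between x y" "\<lambda>z w. g w z" "\<lambda>z w. z \<in> between w y"]
    by simp
qed

text \<open>All summands are the same power of \<open>e\<close> up to a sign that alternates with
  the rank of \<open>z\<close>, so the Eulerian condition evaluates the sum. This is what trades
  \<open>e\<close> for \<open>- e\<close> in the recursion.\<close>

lemma euler_convolution:
  fixes e :: "'r::ring_1"
  assumes "(x, y) \<in> P" "x \<noteq> y"
  shows "(\<Sum>z\<in>between x y. e ^ (r z - r x - 1) * e * (- e) ^ (r y - r z - 1)) =
    e ^ (r y - r x - 1) - (- e) ^ (r y - r x - 1)"
proof -
  have lt: "r x < r y" using rank_less assms by auto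
  have "e ^ (r z - r x - 1) * e * (- e) ^ (r y - r z - 1) =
      of_int (- ((-1) ^ r y * (-1) ^ r z)) * e ^ (r y - r x - 1)" if "z \<in> between x y" for z
  proof -
    have z: "r x < r z" "r z < r y" using between_rank that by auto
    have 1: "(- e) ^ (r y - r z - 1) = of_int ((-1) ^ (r y - r z - 1)) * e ^ (r y - r z - 1)"
      by (subst power_minus) simp
    have 2: "(-1::int) ^ (r y - r z - 1) = - ((-1) ^ r y * (-1) ^ r z)"
      using z by (auto simp: minus_one_power_iff)
    have 3: "e ^ (r z - r x - 1) * e * e ^ (r y - r z - 1) = e ^ (r y - r x - 1)"
      using z by (simp only: power_add[symmetric] power_Suc2[symmetric])
        (simp add: Suc_diff_Suc flip: power_Suc)
    have "e ^ (r z - r x - 1) * e * (of_int k * e ^ (r y - r z - 1)) =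
        of_int k * (e ^ (r z - r x - 1) * e * e ^ (r y - r z - 1))" for k
      by (metis mult.assoc mult_of_int_commute)
    then show ?thesis
      by (simp only: 1 2 3)
  qed
  then have "(\<Sum>z\<in>between x y. e ^ (r z - r x - 1) * e * (- e) ^ (r y - r z - 1)) =
      of_int (- ((-1) ^ r y * (\<Sum>z\<in>between x y. (-1) ^ r z))) * e ^ (r y - r x - 1)"
    by (simp add: sum_distrib_left sum_distrib_right sum_negf)
  also have "- ((-1) ^ r y * (\<Sum>z\<in>between x y. (-1) ^ r z)) = (1::int) - (-1) ^ (r y - r x - 1)"
    unfolding euler_between[OF assms] using lt by (auto simp: minus_one_power_iff)
  finally show ?thesis
    by (simp add: left_diff_distrib power_minus[of e])
qed

text \<open>For \<open>e = a - b\<close> the factors \<open>e + b\<close> and \<open>- e\<close> are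
  a and b - a, so this is \<open>chain_poly_top\<close> with a and b exchanged from \<open>z\<close>
  upwards. It results from inserting that recursion into the sum with middle factor
  \<open>e\<close>, interchanging the summations and applying \<open>euler_convolution\<close> to
  the inner one.\<close>

lemma chain_poly_dual_top:
  fixes e b :: "'r::ring_1"
  assumes "(x, y) \<in> P" "x \<noteq> y"
  shows "chain_poly e b x y = (- e) ^ (r y - r x - 1) +
    (\<Sum>z\<in>between x y. chain_poly e b x z * (e + b) * (- e) ^ (r y - r z - 1))"
proof -
  let ?f = "chain_poly e b x" and ?K = "\<lambda>u v. e ^ (r v - r u - 1)"
    and ?L = "\<lambda>u v. (- e) ^ (r v - r u - 1)"
  have "(\<Sum>z\<in>between x y. ?f z * e * ?L z y) =
      (\<Sum>z\<in>between x y. ?K x z * e * ?L z y) +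
      (\<Sum>z\<in>between x y. \<Sum>w\<in>between x z. ?f w * b * (?K w z * e * ?L z y))"
    by (subst chain_poly_top) (simp add: distrib_right sum.distrib sum_distrib_right mult.assoc)
  also have "(\<Sum>z\<in>between x y. \<Sum>w\<in>between x z. ?f w * b * (?K w z * e * ?L z y)) =
      (\<Sum>w\<in>between x y. \<Sum>z\<in>between w y. ?f w * b * (?K w z * e * ?L z y))"
    by (rule sum_between_swap)
  also have "\<dots> = (\<Sum>w\<in>between x y. ?f w * b * (?K w y - ?L w y))"
  proof (rule sum.cong)
    fix w assume "w \<in> between x y"
    then have "(w, y) \<in> P" "w \<noteq> y" by (auto simp: between_def)
    from euler_convolution[OF this, of e]
    show "(\<Sum>z\<in>between w y. ?f w * b * (?K w z * e * ?L z y)) = ?f w * b * (?K w y - ?L w y)"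
      by (simp only: sum_distrib_left[symmetric])
  qed simp
  finally have "(\<Sum>z\<in>between x y. ?f z * e * ?L z y) =
      ?K x y - ?L x y + (\<Sum>w\<in>between x y. ?f w * b * ?K w y)
      - (\<Sum>w\<in>between x y. ?f w * b * ?L w y)"
    by (simp only: euler_convolution[OF assms, of e] right_diff_distrib sum_subtractf)
       (simp only: algebra_simps)
  then show ?thesis
    by (subst chain_poly_top) (simp add: distrib_left distrib_right sum.distrib)
qed

text \<open>Adding both recursions leaves after \<open>chain_poly e b x z\<close> the factor
  \<open>(e + 2b) e^k\<close> for even k and \<open>- e^(k+1)\<close> for odd k. With
  \<open>e = a - b\<close> the former is c times an even power of a - b, the latter minus an even
  power; both are polynomials in c and d.\<close>

lemma two_chain_poly:
  fixes e b :: "'r::ring_1"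
  assumes "(x, y) \<in> P" "x \<noteq> y"
  shows "2 * chain_poly e b x y = (e ^ (r y - r x - 1) + (- e) ^ (r y - r x - 1)) +
    (\<Sum>z\<in>between x y. chain_poly e b x z *
       (b * e ^ (r y - r z - 1) + (e + b) * (- e) ^ (r y - r z - 1)))"
proof -
  have "chain_poly e b x y + chain_poly e b x y = (e ^ (r y - r x - 1) +
      (\<Sum>z\<in>between x y. chain_poly e b x z * b * e ^ (r y - r z - 1))) +
      ((- e) ^ (r y - r x - 1) +
      (\<Sum>z\<in>between x y. chain_poly e b x z * (e + b) * (- e) ^ (r y - r z - 1)))"
    by (rule arg_cong2[of _ _ _ _ "(+)", OF chain_poly_top chain_poly_dual_top[OF assms]])
  then show ?thesis
    by (simp only: mult_2 distrib_left distrib_right sum.distrib mult.assoc add_ac)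
qed

end

section \<open>The cd-index of an interval\<close>

abbreviation "var_a \<equiv> ncvar La"
abbreviation "var_b \<equiv> ncvar Lb"

lemma ab_difference_square:
  "(var_a - var_b) ^ 2 = ncsubst cd_to_ab (ncvar Lc ^ 2 - 2 * ncvar Ld)"
  by (simp add: ncsubst_diff ncsubst_power ncsubst_mult mult_2 ncsubst_add power2_eq_square
      algebra_simps)

lemma ab_difference_even_power:
  "even k \<Longrightarrow> \<exists>F. (var_a - var_b) ^ k = ncsubst cd_to_ab F"
  by (elim evenE) (simp only: power_mult ab_difference_square ncsubst_power[symmetric], blast)

text \<open>The coefficient of \<open>l\<close> in \<open>b\<close>, respectively in \<open>a - b\<close>.\<close>

definition letter_coeff :: "bool \<Rightarrow> ab \<Rightarrow> int" where
  "letter_coeff q l = (if q then of_bool (l = Lb) else if l = La then 1 else -1)"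

lemma letter_coeff_sum: "letter_coeff q La + letter_coeff q Lb = of_bool q"
  by (simp add: letter_coeff_def)

lemma lookup_letter_product:
  "Poly_Mapping.lookup (prod_list (map (\<lambda>i. if Q i then var_b else var_a - var_b) is)) v =
     (if length v = length is then prod_list (map2 (\<lambda>i. letter_coeff (Q i)) is v) else 0)"
proof (induction "is" arbitrary: v)
  case Nil
  then show ?case by (auto simp: lookup_one zero_list_def when_def)
next
  case (Cons i "is")
  then show ?case
    by (cases v; cases "hd v")
       (auto simp: left_diff_distrib lookup_minus lookup_ncvar_mult letter_coeff_def)
qed

lemma even_power_combination:
  "even k \<Longrightarrow> b * e ^ k + (e + b) * (- e) ^ k = (b + (e + b)) * e ^ k" for e b :: "'r::ring_1"
  by (simp add: distrib_right)

lemma odd_power_combination: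
  "odd k \<Longrightarrow> b * e ^ k + (e + b) * (- e) ^ k = - (e ^ Suc k)" for e b :: "'r::ring_1"
  by (simp add: distrib_right)

context euler_poset
begin

abbreviation ab_poly :: "'a \<Rightarrow> 'a \<Rightarrow> ab ncpoly" where
  "ab_poly \<equiv> chain_poly (var_a - var_b) var_b"

lemma lookup_ab_poly:
  "Poly_Mapping.lookup (ab_poly x y) v =
     (if length v = r y - Suc (r x)
      then \<Sum>C\<in>chains x y. prod_list (map2 (\<lambda>i. letter_coeff (i \<in> r ` C)) [Suc (r x)..<r y] v) else 0)"
  unfolding chain_poly_def by (simp add: lookup_sum lookup_letter_product)

text \<open>Existence of the cd-index by induction on the rank of the top:
  \<open>two_chain_poly\<close> builds twice the polynomial from lower intervals, c and even powers
  of a - b, and \<open>ncsubst_halve\<close> removes the factor 2.\<close>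

lemma ab_poly_in_range:
  assumes "(x, y) \<in> P" "x \<noteq> y"
  shows "\<exists>F. ab_poly x y = ncsubst cd_to_ab F"
  using assms
proof (induction "r y" arbitrary: y rule: less_induct)
  case less
  let ?e = "var_a - var_b"
  let ?R = "range (ncsubst cd_to_ab)"
  have add: "X + Y \<in> ?R" if "X \<in> ?R" "Y \<in> ?R" for X Y
    using that by (elim imageE) (simp flip: ncsubst_add)
  have mult: "X * Y \<in> ?R" if "X \<in> ?R" "Y \<in> ?R" for X Y
    using that by (elim imageE) (simp flip: ncsubst_mult)
  have neg: "- X \<in> ?R" if X: "X \<in> ?R" for X
  proof -
    obtain F where "X = ncsubst cd_to_ab F" using X by blast
    then have "- X = ncsubst cd_to_ab (- F)"
      using ncsubst_diff[of cd_to_ab 0 F] by simp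
    then show ?thesis by blast
  qed
  have sum: "(\<Sum>z\<in>A. X z) \<in> ?R" if "\<And>z. z \<in> A \<Longrightarrow> X z \<in> ?R" for A and X :: "'a \<Rightarrow> ab ncpoly"
    using that
  proof (induction A rule: infinite_finite_induct)
    case (insert z A)
    then show ?case by (simp add: add)
  qed (simp_all, (rule image_eqI[of _ _ 0], simp_all)+)
  have even: "?e ^ k \<in> ?R" if "even k" for k
    using ab_difference_even_power[OF that] by auto
  have c: "var_b + (?e + var_b) \<in> ?R"
    by (rule image_eqI[of _ _ "ncvar Lc"]) auto
  have factor: "var_b * ?e ^ k + (?e + var_b) * (- ?e) ^ k \<in> ?R" for k
  proof (cases "even k")
    case True
    then show ?thesis
      using mult[OF c even[OF True]] by (simp only: even_power_combination)
  next
    case False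
    then have "even (Suc k)" by simp
    from neg[OF even[OF this]] show ?thesis
      by (simp only: odd_power_combination[OF False])
  qed
  have head: "?e ^ k + (- ?e) ^ k \<in> ?R" for k
  proof (cases "even k")
    case True
    then show ?thesis using add[OF even even] by (simp only: power_minus_even)
  next
    case False
    then have "?e ^ k + (- ?e) ^ k = ncsubst cd_to_ab 0"
      by (simp only: power_minus_odd[OF False] ncsubst_0 add.right_inverse)
    then show ?thesis by (metis rangeI)
  qed
  have "ab_poly x z \<in> ?R" if "z \<in> between x y" for z
    using less.hyps[of z] between_rank[OF that] betweenD[OF that] that
    by (auto simp: between_def)
  then have "2 * ab_poly x y \<in> ?R"
    unfolding two_chain_poly[OF less.prems] by (intro add[OF head sum] mult[OF _ factor])
  then show ?case
    using ncsubst_halve by blast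
qed

definition cd_poly :: "'a \<Rightarrow> 'a \<Rightarrow> cd ncpoly" where
  "cd_poly x y = (THE F. ab_poly x y = ncsubst cd_to_ab F)"

definition coeff :: "'a \<Rightarrow> 'a \<Rightarrow> cd list \<Rightarrow> int" where
  "coeff x y = Poly_Mapping.lookup (cd_poly x y)"

lemma ab_poly_eq: "(x, y) \<in> P \<Longrightarrow> x \<noteq> y \<Longrightarrow> ab_poly x y = ncsubst cd_to_ab (cd_poly x y)"
proof -
  assume "(x, y) \<in> P" "x \<noteq> y"
  then obtain F where F: "ab_poly x y = ncsubst cd_to_ab F"
    using ab_poly_in_range by blast
  then have "cd_poly x y = F"
    unfolding cd_poly_def by (intro the_equality) (auto dest: ncsubst_inj)
  with F show ?thesis by simp
qed

lemma lookup_ab_poly_coeff: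
  assumes "(x, y) \<in> P" "x \<noteq> y" "Poly_Mapping.keys (cd_poly x y) \<subseteq> words N"
  shows "Poly_Mapping.lookup (ab_poly x y) v = (\<Sum>w\<in>words N. coeff x y w * word_coeff w v)"
  using ab_poly_eq[OF assms(1,2)] lookup_ncsubst[OF assms(3)] by (simp add: coeff_def)

text \<open>Words of the wrong degree contribute only to ab-words of the wrong length, where the
  ab-polynomial vanishes. Collected in \<open>G\<close>, their coefficients therefore vanish by
  independence.\<close>

lemma homogeneous_cd_poly:
  assumes "(x, y) \<in> P" "x \<noteq> y"
  shows "homogeneous (r y - r x - 1) (cd_poly x y)"
  unfolding homogeneous_def
proof (intro allI impI)
  fix w assume w: "Poly_Mapping.lookup (cd_poly x y) w \<noteq> 0"
  let ?n = "r y - r x - 1"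
  obtain N where N: "Poly_Mapping.keys (cd_poly x y) \<subseteq> words N"
    using keys_subset_words by blast
  define G where "G w = (if cd_length w = ?n then 0 else coeff x y w)" for w
  have "(\<Sum>w\<in>words N. G w * word_coeff w v) = 0" for v
  proof (cases "length v = ?n")
    case True
    then show ?thesis
      by (intro sum.neutral) (auto simp: G_def word_coeff_length)
  next
    case False
    then have "Poly_Mapping.lookup (ab_poly x y) v = 0"
      by (simp add: lookup_ab_poly)
    moreover have "(\<Sum>w\<in>words N. coeff x y w * word_coeff w v) = (\<Sum>w\<in>words N. G w * word_coeff w v)"
      by (rule sum.cong) (use False in \<open>auto simp: G_def word_coeff_length\<close>)
    ultimately show ?thesis
      by (simp add: lookup_ab_poly_coeff[OF assms N])
  qed
  then have "0 dvd G w"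
    using word_coeff_independent[of 0 G N w] N w by (auto simp: in_keys_iff subset_iff)
  then show "cd_length w = ?n"
    using w by (auto simp: G_def coeff_def split: if_splits)
qed

lemma coeff_length:
  assumes "(x, y) \<in> P" "x \<noteq> y" "coeff x y w \<noteq> 0"
  shows "r y = Suc (r x + cd_length w)"
  using homogeneous_cd_poly[OF assms(1,2)] assms(3) rank_less[OF assms(1,2)]
  by (auto simp: homogeneous_def coeff_def)

text \<open>Compare coefficients at the power of a. On one side it occurs in the image of no other
  cd-word; on the other only the empty chain contributes, because every element of a chain brings a
  factor b.\<close>

lemma coeff_replicate_Lc:
  assumes "(x, y) \<in> P" "x \<noteq> y" "r y = Suc (r x + n)"
  shows "coeff x y (replicate n Lc) = 1"
proof -
  let ?v = "replicate n La"
  obtain N where N: "Poly_Mapping.keys (cd_poly x y) \<subseteq> words N"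
    using keys_subset_words by blast
  have "prod_list (map2 (\<lambda>i. letter_coeff (i \<in> A)) js (replicate (length js) La)) =
      of_bool (A \<inter> set js = {})" for A :: "nat set" and js
    by (induction js) (auto simp: letter_coeff_def)
  note prods = this[of _ "[Suc (r x)..<r y]"]
  have *: "prod_list (map2 (\<lambda>i. letter_coeff (i \<in> r ` C)) [Suc (r x)..<r y] ?v) = of_bool (C = {})"
    if "C \<in> chains x y" for C
  proof -
    have "r ` C \<inter> set [Suc (r x)..<r y] = {} \<longleftrightarrow> C = {}"
      using chains_rank[OF that] by fastforce
    moreover have "length [Suc (r x)..<r y] = n"
      using assms(3) by simp
    ultimately show ?thesis
      using prods[of "r ` C"] by (simp only: Int_commute)
  qed
  have "length ?v = r y - Suc (r x)"
    using assms(3) by simp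
  then have "Poly_Mapping.lookup (ab_poly x y) ?v = (\<Sum>C\<in>chains x y. of_bool (C = {}))"
    unfolding lookup_ab_poly using * by (simp only: refl if_True cong: sum.cong)
  then have "1 = Poly_Mapping.lookup (ab_poly x y) ?v"
    by (simp add: of_bool_def)
  also have "\<dots> = (\<Sum>w\<in>words N. coeff x y w * (if w = replicate n Lc then 1 else 0))"
    unfolding lookup_ab_poly_coeff[OF assms(1,2) N] word_coeff_La by simp
  also have "\<dots> = (if replicate n Lc \<in> words N then coeff x y (replicate n Lc) else 0)"
    by (simp add: if_distrib cong: if_cong)
  also have "\<dots> = coeff x y (replicate n Lc)"
    using N by (auto simp: coeff_def in_keys_iff)
  finally show ?thesis by simp
qed

text \<open>Only the chains with an element \<open>z\<close> of the rank of the middle letter survive on the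
  left-hand side, because \<open>a - b\<close> vanishes under \<open>a, b \<mapsto> 1\<close>.\<close>

lemma lookup_ab_poly_split:
  "Poly_Mapping.lookup (ab_poly x y) (v @ La # v') + Poly_Mapping.lookup (ab_poly x y) (v @ Lb # v') =
     (\<Sum>z\<in>between x y. Poly_Mapping.lookup (ab_poly x z) v * Poly_Mapping.lookup (ab_poly z y) v')"
proof (cases "r y = Suc (Suc (r x + length v + length v'))")
  case False
  then have "Poly_Mapping.lookup (ab_poly x z) v * Poly_Mapping.lookup (ab_poly z y) v' = 0"
    if "z \<in> between x y" for z
    using between_rank[OF that] by (auto simp: lookup_ab_poly)
  then have "(\<Sum>z\<in>between x y. Poly_Mapping.lookup (ab_poly x z) v * Poly_Mapping.lookup (ab_poly z y) v') = 0"
    by (intro sum.neutral ballI)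
  moreover have "Suc (length v + length v') \<noteq> r y - Suc (r x)"
    using False by linarith
  ultimately show ?thesis
    by (simp add: lookup_ab_poly)
next
  case True
  define k where "k = Suc (r x + length v)"
  let ?W = "\<lambda>A m n v. prod_list (map2 (\<lambda>i. letter_coeff (i \<in> A)) [m..<n] v)"
  have W: "?W A (Suc (r x)) (r y) (v @ l # v') =
      ?W A (Suc (r x)) k v * (letter_coeff (k \<in> A) l * ?W A (Suc k) (r y) v')" for A l
  proof -
    have "[Suc (r x)..<r y] = [Suc (r x)..<k] @ k # [Suc k..<r y]"
      using True upt_add_eq_append[of "Suc (r x)" k "r y - k"] upt_conv_Cons[of k "r y"]
      by (simp add: k_def)
    then show ?thesis by (simp add: k_def del: upt_Suc)
  qed
  have split: "Poly_Mapping.lookup (ab_poly x y) (v @ l # v') = (\<Sum>C\<in>chains x y.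
      ?W (r ` C) (Suc (r x)) k v * (letter_coeff (k \<in> r ` C) l * ?W (r ` C) (Suc k) (r y) v'))" for l
  proof -
    have "length (v @ l # v') = r y - Suc (r x)"
      using True by simp
    then show ?thesis
      unfolding lookup_ab_poly by (simp only: refl if_True W)
  qed
  have "Poly_Mapping.lookup (ab_poly x y) (v @ La # v') + Poly_Mapping.lookup (ab_poly x y) (v @ Lb # v') =
      (\<Sum>C\<in>chains x y. ?W (r ` C) (Suc (r x)) k v * of_bool (k \<in> r ` C) * ?W (r ` C) (Suc k) (r y) v')"
    unfolding split sum.distrib[symmetric]
    by (intro sum.cong refl) (simp add: letter_coeff_sum[symmetric] algebra_simps)
  also have "\<dots> = (\<Sum>C | C \<in> chains x y \<and> k \<in> r ` C. ?W (r ` C) (Suc (r x)) k v * ?W (r ` C) (Suc k) (r y) v')"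
    by (intro sum.mono_neutral_cong_right) auto
  also have "\<dots> = (\<Sum>z | z \<in> between x y \<and> r z = k. \<Sum>C\<in>chains x z. \<Sum>D\<in>chains z y.
      ?W (r ` C) (Suc (r x)) k v * ?W (r ` D) (Suc k) (r y) v')"
    unfolding sum_chains_split
  proof (intro sum.cong refl)
    fix z C D
    assume z: "z \<in> {z \<in> between x y. r z = k}" and CD: "C \<in> chains x z" "D \<in> chains z y"
    have "?W (r ` insert z (C \<union> D)) (Suc (r x)) k v = ?W (r ` C) (Suc (r x)) k v"
      using rank_image_join(1)[OF _ CD] z by (intro arg_cong[of _ _ prod_list] map_cong)
        (auto dest!: set_zip_leftD)
    moreover have "?W (r ` insert z (C \<union> D)) (Suc k) (r y) v' = ?W (r ` D) (Suc k) (r y) v'"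
      using rank_image_join(2)[OF _ CD] z by (intro arg_cong[of _ _ prod_list] map_cong)
        (auto dest!: set_zip_leftD)
    ultimately show "?W (r ` insert z (C \<union> D)) (Suc (r x)) k v * ?W (r ` insert z (C \<union> D)) (Suc k) (r y) v' =
        ?W (r ` C) (Suc (r x)) k v * ?W (r ` D) (Suc k) (r y) v'"
      by simp
  qed
  also have "\<dots> = (\<Sum>z | z \<in> between x y \<and> r z = k.
      Poly_Mapping.lookup (ab_poly x z) v * Poly_Mapping.lookup (ab_poly z y) v')"
    using True by (intro sum.cong refl) (auto simp: lookup_ab_poly k_def sum_product)
  also have "\<dots> = (\<Sum>z\<in>between x y. Poly_Mapping.lookup (ab_poly x z) v * Poly_Mapping.lookup (ab_poly z y) v')"
  proof (intro sum.mono_neutral_left)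
    show "\<forall>z\<in>between x y - {z \<in> between x y. r z = k}.
        Poly_Mapping.lookup (ab_poly x z) v * Poly_Mapping.lookup (ab_poly z y) v' = 0"
      using between_rank by (auto simp: lookup_ab_poly k_def) fastforce+
  qed auto
  finally show ?thesis .
qed

end

section \<open>The coproduct on coefficients\<close>

lemma sum_list_eq_sum_count:
  "set xs \<subseteq> X \<Longrightarrow> finite X \<Longrightarrow> sum_list (map f xs) = (\<Sum>x\<in>X. int (count_list xs x) * f x)"
proof (induction xs)
  case (Cons a xs)
  then have "(\<Sum>x\<in>X. int (count_list (a # xs) x) * f x) =
      (\<Sum>x\<in>X. int (count_list xs x) * f x) + (\<Sum>x\<in>X. if x = a then f x else 0)"
    unfolding sum.distrib[symmetric] by (intro sum.cong) (auto simp: algebra_simps)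
  then show ?case using Cons by simp
qed simp

lemma cuts_length: "(p, q) \<in> set (cuts w) \<Longrightarrow> length p \<le> length w \<and> length q \<le> length w"
  by (induction w arbitrary: p q rule: cuts.induct) fastforce+

lemma butlast_replicate: "butlast (replicate n x) = replicate (n - 1) x"
  by (simp add: butlast_conv_take)

context euler_poset
begin

lemma keys_cd_poly:
  assumes "(x, y) \<in> P" "x \<noteq> y" "r y \<le> N"
  shows "Poly_Mapping.keys (cd_poly x y) \<subseteq> words N"
proof
  fix w assume "w \<in> Poly_Mapping.keys (cd_poly x y)"
  then have "r y = Suc (r x + cd_length w)"
    using coeff_length[OF assms(1,2)] by (simp add: coeff_def in_keys_iff)
  then show "w \<in> words N"
    using length_le_cd_length[of w] assms(3) by (simp add: words_def)
qed

lemma coeff_eq_0_not_in_words: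
  "(x, y) \<in> P \<Longrightarrow> x \<noteq> y \<Longrightarrow> r y \<le> N \<Longrightarrow> w \<notin> words N \<Longrightarrow> coeff x y w = 0"
  using keys_cd_poly[of x y N] by (auto simp: coeff_def in_keys_iff)

text \<open>After substitution in both tensor factors the two sides become two evaluations of the
  same sum, by \<open>lookup_ab_poly_split\<close> and by \<open>word_coeff_cuts\<close>.
  Independence of the substituted words is then applied once in each factor to the difference
  \<open>H\<close>.\<close>

lemma sum_coeff_split:
  assumes xy: "(x, y) \<in> P" "x \<noteq> y" and N: "r y \<le> N" and uv: "u \<in> words N" "v \<in> words N"
  shows "(\<Sum>z\<in>between x y. coeff x z u * coeff z y v) =
    (\<Sum>w\<in>words N. coeff x y w * int (count_list (cuts w) (u, v)))"
proof -
  define H where "H p q = (\<Sum>z\<in>between x y. coeff x z p * coeff z y q) -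
    (\<Sum>w\<in>words N. coeff x y w * int (count_list (cuts w) (p, q)))" for p q
  have zero: "(\<Sum>p\<in>words N. (\<Sum>q\<in>words N. H p q * word_coeff q \<beta>) * word_coeff p \<alpha>) = 0" for \<alpha> \<beta>
  proof -
    have up: "Poly_Mapping.lookup (ab_poly x z) \<alpha> * Poly_Mapping.lookup (ab_poly z y) \<beta> =
        (\<Sum>p\<in>words N. \<Sum>q\<in>words N. coeff x z p * coeff z y q * (word_coeff p \<alpha> * word_coeff q \<beta>))"
      if z: "z \<in> between x y" for z
    proof -
      have "(x, z) \<in> P" "x \<noteq> z" "(z, y) \<in> P" "z \<noteq> y" "r z \<le> N"
        using z between_rank[OF z] N by (auto simp: between_def)
      then show ?thesis
        using lookup_ab_poly_coeff[OF _ _ keys_cd_poly] N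
        by (simp add: sum_product algebra_simps)
    qed
    have cuts: "word_coeff w (\<alpha> @ La # \<beta>) + word_coeff w (\<alpha> @ Lb # \<beta>) =
        (\<Sum>p\<in>words N. \<Sum>q\<in>words N. int (count_list (cuts w) (p, q)) * (word_coeff p \<alpha> * word_coeff q \<beta>))"
      if "w \<in> words N" for w
    proof -
      have "set (cuts w) \<subseteq> words N \<times> words N"
        using that cuts_length[of _ _ w] by (fastforce simp: words_def)
      then show ?thesis
        unfolding word_coeff_cuts sum.cartesian_product
        by (subst sum_list_eq_sum_count) (auto simp: case_prod_beta)
    qed
    have "(\<Sum>z\<in>between x y. Poly_Mapping.lookup (ab_poly x z) \<alpha> * Poly_Mapping.lookup (ab_poly z y) \<beta>) =
        (\<Sum>w\<in>words N. coeff x y w * (word_coeff w (\<alpha> @ La # \<beta>) + word_coeff w (\<alpha> @ Lb # \<beta>)))"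
      unfolding lookup_ab_poly_split[symmetric] lookup_ab_poly_coeff[OF xy keys_cd_poly[OF xy N]]
      by (simp add: distrib_left sum.distrib)
    also have "\<dots> = (\<Sum>w\<in>words N. \<Sum>p\<in>words N. \<Sum>q\<in>words N.
        coeff x y w * int (count_list (cuts w) (p, q)) * (word_coeff p \<alpha> * word_coeff q \<beta>))"
      by (simp add: cuts sum_distrib_left mult.assoc)
    also have "\<dots> = (\<Sum>p\<in>words N. \<Sum>w\<in>words N. \<Sum>q\<in>words N.
        coeff x y w * int (count_list (cuts w) (p, q)) * (word_coeff p \<alpha> * word_coeff q \<beta>))"
      by (rule sum.swap)
    also have "\<dots> = (\<Sum>p\<in>words N. \<Sum>q\<in>words N. \<Sum>w\<in>words N.
        coeff x y w * int (count_list (cuts w) (p, q)) * (word_coeff p \<alpha> * word_coeff q \<beta>))"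
      by (intro sum.cong refl sum.swap)
    finally have 1: "(\<Sum>z\<in>between x y. Poly_Mapping.lookup (ab_poly x z) \<alpha> * Poly_Mapping.lookup (ab_poly z y) \<beta>) =
       (\<Sum>p\<in>words N. \<Sum>q\<in>words N. (\<Sum>w\<in>words N. coeff x y w * int (count_list (cuts w) (p, q))) *
          (word_coeff p \<alpha> * word_coeff q \<beta>))"
      by (simp only: sum_distrib_right)
    have "(\<Sum>z\<in>between x y. Poly_Mapping.lookup (ab_poly x z) \<alpha> * Poly_Mapping.lookup (ab_poly z y) \<beta>) =
        (\<Sum>z\<in>between x y. \<Sum>p\<in>words N. \<Sum>q\<in>words N.
          coeff x z p * coeff z y q * (word_coeff p \<alpha> * word_coeff q \<beta>))"
      by (intro sum.cong refl up)
    also have "\<dots> = (\<Sum>p\<in>words N. \<Sum>z\<in>between x y. \<Sum>q\<in>words N.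
          coeff x z p * coeff z y q * (word_coeff p \<alpha> * word_coeff q \<beta>))"
      by (rule sum.swap)
    also have "\<dots> = (\<Sum>p\<in>words N. \<Sum>q\<in>words N. \<Sum>z\<in>between x y.
          coeff x z p * coeff z y q * (word_coeff p \<alpha> * word_coeff q \<beta>))"
      by (intro sum.cong refl sum.swap)
    finally have 2: "(\<Sum>z\<in>between x y. Poly_Mapping.lookup (ab_poly x z) \<alpha> * Poly_Mapping.lookup (ab_poly z y) \<beta>) =
       (\<Sum>p\<in>words N. \<Sum>q\<in>words N. (\<Sum>z\<in>between x y. coeff x z p * coeff z y q) *
          (word_coeff p \<alpha> * word_coeff q \<beta>))"
      by (simp only: sum_distrib_right)
    have "(\<Sum>q\<in>words N. H p q * word_coeff q \<beta>) * word_coeff p \<alpha> =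
        (\<Sum>q\<in>words N. H p q * (word_coeff p \<alpha> * word_coeff q \<beta>))" for p
      by (simp add: sum_distrib_right sum_distrib_left mult_ac)
    then have "(\<Sum>p\<in>words N. (\<Sum>q\<in>words N. H p q * word_coeff q \<beta>) * word_coeff p \<alpha>) =
        (\<Sum>p\<in>words N. \<Sum>q\<in>words N. (\<Sum>z\<in>between x y. coeff x z p * coeff z y q) *
          (word_coeff p \<alpha> * word_coeff q \<beta>)) -
        (\<Sum>p\<in>words N. \<Sum>q\<in>words N. (\<Sum>w\<in>words N. coeff x y w * int (count_list (cuts w) (p, q))) *
          (word_coeff p \<alpha> * word_coeff q \<beta>))"
      by (simp only: H_def left_diff_distrib sum_subtractf)
    then show ?thesis
      unfolding 1[symmetric] 2[symmetric] by simp
  qed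
  have "(\<Sum>q\<in>words N. H u q * word_coeff q \<beta>) = 0" for \<beta>
    using word_coeff_independent[of 0 "\<lambda>p. \<Sum>q\<in>words N. H p q * word_coeff q \<beta>" N u] zero uv(1)
    by simp
  then have "H u v = 0"
    using word_coeff_independent[of 0 "H u" N v] uv(2) by simp
  then show ?thesis by (simp add: H_def)
qed

text \<open>The \<open>cd\<close>-index is a homomorphism of coalgebras; compare the coefficients of \<open>u \<otimes> v\<close>.\<close>

lemma coeff_coproduct:
  assumes xy: "(x, y) \<in> P" "x \<noteq> y"
  shows "(\<Sum>z\<in>between x y. coeff x z u * coeff z y v) = 2 * coeff x y (u @ Lc # v)
     + (if u \<noteq> [] \<and> last u = Lc then coeff x y (butlast u @ Ld # v) else 0)
     + (if v \<noteq> [] \<and> hd v = Lc then coeff x y (u @ Ld # tl v) else 0)"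
proof -
  define N where "N = r y + length u + length v"
  have N: "r y \<le> N" "u \<in> words N" "v \<in> words N" by (auto simp: N_def words_def)
  have single: "(\<Sum>w\<in>words N. coeff x y w * of_bool (w = t)) = coeff x y t" for t
    using coeff_eq_0_not_in_words[OF xy N(1), of t]
    by (cases "t \<in> words N") (simp_all add: of_bool_def if_distrib cong: if_cong)
  have "(\<Sum>z\<in>between x y. coeff x z u * coeff z y v) =
      2 * (\<Sum>w\<in>words N. coeff x y w * of_bool (w = u @ Lc # v))
      + of_bool (u \<noteq> [] \<and> last u = Lc) * (\<Sum>w\<in>words N. coeff x y w * of_bool (w = butlast u @ Ld # v))
      + of_bool (v \<noteq> [] \<and> hd v = Lc) * (\<Sum>w\<in>words N. coeff x y w * of_bool (w = u @ Ld # tl v))"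
    unfolding sum_coeff_split[OF xy N] count_list_cuts sum_distrib_left sum.distrib[symmetric]
    by (intro sum.cong refl) auto
  then show ?thesis
    unfolding single by simp
qed

section \<open>Coefficients of words with one or two letters d as face numbers\<close>

definition level :: "'a \<Rightarrow> 'a \<Rightarrow> nat \<Rightarrow> 'a set" where
  "level x y k = {z \<in> between x y. r z = k}"

lemma finite_level [simp]: "finite (level x y k)"
  by (simp add: level_def)

lemma coeff_Lc_power:
  assumes "(x, y) \<in> P" "x \<noteq> y"
  shows "coeff x y (replicate i Lc) = of_bool (r y = Suc (r x + i))"
  using coeff_replicate_Lc[OF assms] coeff_length[OF assms, of "replicate i Lc"] by auto

lemma sum_level_left:
  "(\<Sum>z\<in>between x y. coeff x z (replicate i Lc) * f z) = (\<Sum>z\<in>level x y (Suc (r x + i)). f z)"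
proof -
  have "(\<Sum>z\<in>between x y. coeff x z (replicate i Lc) * f z) =
      (\<Sum>z\<in>between x y. if r z = Suc (r x + i) then f z else 0)"
    by (intro sum.cong refl) (auto simp: between_def coeff_Lc_power)
  then show ?thesis
    by (simp add: sum.inter_filter level_def)
qed

text \<open>In the coproduct for two powers of c each product is 1 on the level and 0 elsewhere. So
  every level size is 2 plus the sum of two neighbouring coefficients of words c^i d c^j, and
  alternating sums of level sizes isolate a single one.\<close>

lemma card_level:
  assumes xy: "(x, y) \<in> P" and n: "r y = r x + i + j + 2"
  shows "int (card (level x y (Suc (r x + i)))) = 2
    + (if i = 0 then 0 else coeff x y (replicate (i - 1) Lc @ Ld # replicate j Lc))
    + (if j = 0 then 0 else coeff x y (replicate i Lc @ Ld # replicate (j - 1) Lc))"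
proof -
  have "x \<noteq> y" using n by auto
  have "(\<Sum>z\<in>between x y. coeff x z (replicate i Lc) * coeff z y (replicate j Lc)) =
      (\<Sum>z\<in>level x y (Suc (r x + i)). 1)"
    unfolding sum_level_left
    by (intro sum.cong refl) (use n in \<open>auto simp: level_def between_def coeff_Lc_power\<close>)
  moreover have "coeff x y (replicate i Lc @ Lc # replicate j Lc) = 1"
  proof -
    have "replicate i Lc @ Lc # replicate j Lc = replicate (i + Suc j) Lc"
      by (simp only: replicate_add replicate_Suc)
    then show ?thesis
      using coeff_replicate_Lc[OF xy \<open>x \<noteq> y\<close>, of "i + Suc j"] n by simp
  qed
  ultimately show ?thesis
    unfolding coeff_coproduct[OF xy \<open>x \<noteq> y\<close>]
    by (auto simp: butlast_replicate tl_replicate)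
qed

lemma card_level_2:
  "(x, y) \<in> P \<Longrightarrow> r y = r x + 2 \<Longrightarrow> card (level x y (Suc (r x))) = 2"
  using card_level[of x y 0 0] by simp

lemma coeff_d_c_power:
  "(x, y) \<in> P \<Longrightarrow> r y = r x + j + 3 \<Longrightarrow>
     coeff x y (Ld # replicate j Lc) = int (card (level x y (Suc (r x)))) - 2"
  using card_level[of x y 0 "Suc j"] by simp

lemma coeff_c_power_d:
  "(x, y) \<in> P \<Longrightarrow> r y = r x + i + 3 \<Longrightarrow>
     coeff x y (replicate i Lc @ [Ld]) = int (card (level x y (r y - 1))) - 2"
  using card_level[of x y "Suc i" 0] by simp

lemma coeff_cdc_power:
  "(x, y) \<in> P \<Longrightarrow> r y = r x + j + 4 \<Longrightarrow>
     coeff x y (Lc # Ld # replicate j Lc) =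
       int (card (level x y (Suc (Suc (r x))))) - int (card (level x y (Suc (r x))))"
  using card_level[of x y 0 "Suc (Suc j)"] card_level[of x y 1 "Suc j"]
  by (simp add: numeral_eq_Suc)

lemma coeff_c_power_dc:
  "(x, y) \<in> P \<Longrightarrow> r y = r x + i + 4 \<Longrightarrow>
     coeff x y (replicate i Lc @ [Ld, Lc]) =
       int (card (level x y (r y - 2))) - int (card (level x y (r y - 1)))"
  using card_level[of x y "Suc (Suc i)" 0] card_level[of x y "Suc i" 1]
  by (simp add: numeral_eq_Suc)

lemma coeff_ccdcc:
  "(x, y) \<in> P \<Longrightarrow> r y = r x + 7 \<Longrightarrow>
     coeff x y [Lc, Lc, Ld, Lc, Lc] = int (card (level x y (r x + 3)))
       - int (card (level x y (r x + 2))) + int (card (level x y (r x + 1))) - 2"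
  using card_level[of x y 0 5] card_level[of x y 1 4] card_level[of x y 2 3]
  by (simp add: numeral_eq_Suc)

text \<open>In the coproduct with empty left factor the sum runs over the atoms \<open>a\<close>,
  each contributing the number of coatoms above it minus 2. The other terms are the wanted
  coefficient and twice that of c^(m+2) d, which is the number of coatoms minus 2.\<close>

lemma coeff_d_c_power_d:
  assumes xy: "(x, y) \<in> P" and n: "r y = r x + m + 5"
  shows "coeff x y (Ld # replicate m Lc @ [Ld]) =
    int (card {(a, z). a \<in> level x y (Suc (r x)) \<and> z \<in> level x y (r y - 1) \<and> (a, z) \<in> P})
    - 2 * int (card (level x y (Suc (r x)))) - 2 * int (card (level x y (r y - 1))) + 4"
proof -
  have "x \<noteq> y" using n by auto
  let ?A = "level x y (Suc (r x))" and ?Z = "level x y (r y - 1)"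
  have eq: "{(a, z). a \<in> ?A \<and> z \<in> ?Z \<and> (a, z) \<in> P} = Sigma ?A (\<lambda>a. level a y (r y - 1))"
  proof -
    have "z \<in> ?Z \<and> (a, z) \<in> P \<longleftrightarrow> z \<in> level a y (r y - 1)" if "a \<in> ?A" for a z
      using that n P_trans[of x a z] rank_less[of x a] unfolding level_def between_def by auto
    then show ?thesis by blast
  qed
  have "coeff a y (replicate (Suc m) Lc @ [Ld]) = int (card (level a y (r y - 1))) - 2" if "a \<in> ?A" for a
    using that n by (intro coeff_c_power_d) (auto simp: level_def between_def)
  then have "(\<Sum>a\<in>between x y. coeff x a [] * coeff a y (replicate (Suc m) Lc @ [Ld])) =
      (\<Sum>a\<in>?A. int (card (level a y (r y - 1))) - 2)"
    using sum_level_left[where x = x and y = y and i = 0] by simp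
  also have "\<dots> = int (card {(a, z). a \<in> ?A \<and> z \<in> ?Z \<and> (a, z) \<in> P}) - 2 * int (card ?A)"
    unfolding eq by (simp add: sum_subtractf)
  finally show ?thesis
    using coeff_coproduct[OF xy \<open>x \<noteq> y\<close>, of "[]" "replicate (Suc m) Lc @ [Ld]"]
      coeff_c_power_d[OF xy, of "m + 2"] n
    by (simp add: numeral_eq_Suc)
qed

section \<open>Nonnegative coefficients\<close>

lemma ex_rank:
  assumes "(x, y) \<in> P" "r x \<le> k" "k \<le> r y"
  shows "\<exists>z. (x, z) \<in> P \<and> (z, y) \<in> P \<and> r z = k"
  using assms
proof (induction "r y - r x" arbitrary: x y rule: less_induct)
  case less
  consider "k = r x" | "k = r y" | "r x < k" "k < r y"
    using less.prems by linarith
  then show ?case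
  proof cases
    case 3
    then obtain z where z: "(x, z) \<in> P" "(z, y) \<in> P" "r x < r z" "r z < r y"
      using rank_gap[OF less.prems(1)] by auto
    have "\<exists>w. (z, w) \<in> P \<and> (w, y) \<in> P \<and> r w = k" if "r z \<le> k"
      using less.hyps[of y z] less.prems z that by auto
    moreover have "\<exists>w. (x, w) \<in> P \<and> (w, z) \<in> P \<and> r w = k" if "k \<le> r z"
      using less.hyps[of z x] less.prems z that by auto
    ultimately show ?thesis
      using z P_trans nle_le by metis
  qed (use less.prems(1) P_refl[OF FieldI1] P_refl[OF FieldI2] in blast)+
qed

lemma level_lower: "z \<in> between x y \<Longrightarrow> level x z k \<subseteq> level x y k"
  using between_lower by (auto simp: level_def)

lemma level_upper: "z \<in> between x y \<Longrightarrow> level z y k \<subseteq> level x y k"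
  using between_upper by (auto simp: level_def)

text \<open>Two atoms lie already below any single element of rank \<open>r x + 2\<close>, by
  \<open>card_level_2\<close>.\<close>

lemma atoms_ge_2:
  assumes "(x, y) \<in> P" "r x + 2 \<le> r y"
  shows "2 \<le> card (level x y (Suc (r x)))"
proof -
  obtain z where z: "(x, z) \<in> P" "(z, y) \<in> P" "r z = r x + 2"
    using ex_rank[OF assms(1), of "r x + 2"] assms(2) by auto
  show ?thesis
  proof (cases "z = y")
    case True
    then show ?thesis using card_level_2 z by auto
  next
    case False
    then have "z \<in> between x y" using z by (auto simp: between_def)
    then show ?thesis
      using card_mono[OF finite_level level_lower] card_level_2[OF z(1,3)] by metis
  qed
qed

lemma coatoms_ge_2:
  assumes "(x, y) \<in> P" "r x + 2 \<le> r y"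
  shows "2 \<le> card (level x y (r y - 1))"
proof -
  have "r x \<le> r y - 2" using assms(2) by linarith
  then obtain z where z: "(x, z) \<in> P" "(z, y) \<in> P" "r z = r y - 2"
    using ex_rank[OF assms(1), of "r y - 2"] by auto
  have eq: "card (level z y (r y - 1)) = 2"
    using card_level_2[OF z(2)] z(3) assms(2) by (auto simp: Suc_diff_Suc numeral_eq_Suc)
  show ?thesis
  proof (cases "z = x")
    case True
    then show ?thesis using eq by auto
  next
    case False
    then have "z \<in> between x y" using z assms(2) by (auto simp: between_def)
    then show ?thesis
      using card_mono[OF finite_level level_upper] eq by metis
  qed
qed

lemma sum_card_swap:
  assumes "finite A" "finite B"
  shows "(\<Sum>a\<in>A. card {b\<in>B. R a b}) = (\<Sum>b\<in>B. card {a\<in>A. R a b})"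
  using sum.swap_restrict[OF assms, of "\<lambda>_ _. 1::nat" R] by simp

text \<open>Double counting of incidences between the two levels: each upper element lies above
  exactly two atoms, each atom below at least two upper elements.\<close>

lemma rank_2_ge_atoms:
  assumes xy: "(x, y) \<in> P" and n: "r x + 3 \<le> r y"
  shows "card (level x y (Suc (r x))) \<le> card (level x y (Suc (Suc (r x))))"
proof -
  let ?A = "level x y (Suc (r x))" and ?B = "level x y (Suc (Suc (r x)))"
  have "card {b\<in>?B. (a, b) \<in> P} \<ge> 2" if a: "a \<in> ?A" for a
  proof -
    have "{b\<in>?B. (a, b) \<in> P} = level a y (Suc (r a))"
      using a P_trans[of x a] rank_less unfolding level_def between_def by auto
    then show ?thesis
      using atoms_ge_2[of a y] a n by (simp add: level_def between_def)
  qed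
  then have "(\<Sum>a\<in>?A. 2) \<le> (\<Sum>a\<in>?A. card {b\<in>?B. (a, b) \<in> P})"
    by (intro sum_mono) auto
  also have "\<dots> = (\<Sum>b\<in>?B. card {a\<in>?A. (a, b) \<in> P})"
    by (rule sum_card_swap) auto
  also have "\<dots> = (\<Sum>b\<in>?B. 2)"
  proof (rule sum.cong)
    fix b assume b: "b \<in> ?B"
    have "{a\<in>?A. (a, b) \<in> P} = level x b (Suc (r x))"
      using b P_trans[of _ b y] P_antisym[of b y] rank_less unfolding level_def between_def by auto
    then show "card {a\<in>?A. (a, b) \<in> P} = 2"
      using card_level_2[of x b] b by (simp add: level_def between_def)
  qed simp
  finally show ?thesis by simp
qed

lemma corank_2_ge_coatoms:
  assumes xy: "(x, y) \<in> P" and n: "r x + 3 \<le> r y"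
  shows "card (level x y (r y - 1)) \<le> card (level x y (r y - 2))"
proof -
  let ?A = "level x y (r y - 1)" and ?B = "level x y (r y - 2)"
  have "card {b\<in>?B. (b, a) \<in> P} \<ge> 2" if a: "a \<in> ?A" for a
  proof -
    have "{b\<in>?B. (b, a) \<in> P} = level x a (r a - 1)"
      using a n P_trans[of _ a y] rank_less unfolding level_def between_def by auto
    then show ?thesis
      using coatoms_ge_2[of x a] a n by (simp add: level_def between_def)
  qed
  then have "(\<Sum>a\<in>?A. 2) \<le> (\<Sum>a\<in>?A. card {b\<in>?B. (b, a) \<in> P})"
    by (intro sum_mono) auto
  also have "\<dots> = (\<Sum>b\<in>?B. card {a\<in>?A. (b, a) \<in> P})"
    by (rule sum_card_swap) auto
  also have "\<dots> = (\<Sum>b\<in>?B. 2)"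
  proof (rule sum.cong)
    fix b assume b: "b \<in> ?B"
    then have "{a\<in>?A. (b, a) \<in> P} = level b y (Suc (r b))"
      using n P_trans[of x b] rank_less unfolding level_def between_def by auto
    then show "card {a\<in>?A. (b, a) \<in> P} = 2"
      using card_level_2[of b y] b n by (simp add: level_def between_def)
  qed simp
  finally show ?thesis by simp
qed

text \<open>By the level formulas the four cases say that there are at least two atoms or coatoms,
  or compare the two lowest or the two highest levels. A word of the wrong length has coefficient
  0.\<close>

lemma coeff_one_d_nonneg:
  assumes xy: "(x, y) \<in> P" "x \<noteq> y" and ij: "min i j \<le> 1"
  shows "coeff x y (replicate i Lc @ Ld # replicate j Lc) \<ge> 0"
proof (cases "r y = r x + i + j + 3")
  case False
  then show ?thesis
    using coeff_length[OF xy, of "replicate i Lc @ Ld # replicate j Lc"] by fastforce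
next
  case True
  consider "i = 0" | "j = 0" | "i = 1" | "j = 1"
    using ij by linarith
  then show ?thesis
  proof cases
    case 1
    then show ?thesis
      using coeff_d_c_power[OF xy(1)] atoms_ge_2[OF xy(1)] True by simp
  next
    case 2
    then show ?thesis
      using coeff_c_power_d[OF xy(1)] coatoms_ge_2[OF xy(1)] True by simp
  next
    case 3
    then show ?thesis
      using coeff_cdc_power[OF xy(1)] rank_2_ge_atoms[OF xy(1)] True by simp
  next
    case 4
    then show ?thesis
      using coeff_c_power_dc[OF xy(1)] corank_2_ge_coatoms[OF xy(1)] True by simp
  qed
qed

text \<open>Cutting the alternating word at the first single \<open>c\<close> leaves words with a \<open>d\<close> on both
  sides of the cut, so that the other two terms of the coproduct vanish.\<close>

lemma coeff_alternating_nonneg: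
  assumes "(x, y) \<in> P" "x \<noteq> y" "k > 0 \<or> min i j \<le> 1"
  shows "coeff x y (replicate i Lc @ Ld # concat (replicate k [Lc, Ld]) @ replicate j Lc) \<ge> 0"
  using assms
proof (induction k arbitrary: x y i)
  case 0
  then show ?case using coeff_one_d_nonneg by simp
next
  case (Suc k)
  let ?u = "replicate i Lc @ [Ld]"
  let ?v = "Ld # concat (replicate k [Lc, Ld]) @ replicate j Lc"
  have "0 \<le> (\<Sum>z\<in>between x y. coeff x z ?u * coeff z y ?v)"
  proof (intro sum_nonneg mult_nonneg_nonneg)
    fix z assume "z \<in> between x y"
    then show "0 \<le> coeff x z ?u" "0 \<le> coeff z y ?v"
      using coeff_one_d_nonneg[of x z i 0] Suc.IH[of z y 0] by (auto simp: between_def)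
  qed
  then show ?case
    using coeff_coproduct[OF Suc.prems(1,2), of ?u ?v] by simp
qed

end

section \<open>The rank function\<close>

lemma Chains_insert:
  "insert x C \<in> Chains P \<longleftrightarrow> C \<in> Chains P \<and> (x, x) \<in> P \<and> (\<forall>u\<in>C. (x, u) \<in> P \<or> (u, x) \<in> P)"
  unfolding Chains_def by blast

lemma Chains_subset: "C \<in> Chains P \<Longrightarrow> D \<subseteq> C \<Longrightarrow> D \<in> Chains P"
  unfolding Chains_def by blast

lemma Chains_Field: "C \<in> Chains P \<Longrightarrow> C \<subseteq> Field P"
  unfolding Chains_def Field_def by blast

lemma pmin_eq: "Partial_order P \<Longrightarrow> is_min P x \<Longrightarrow> pmin P = x"
  unfolding pmin_def is_min_def
  by (rule the_equality) (auto simp: partial_order_on_def antisym_def)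

lemma pmax_eq: "Partial_order P \<Longrightarrow> is_max P x \<Longrightarrow> pmax P = x"
  unfolding pmax_def is_max_def
  by (rule the_equality) (auto simp: partial_order_on_def antisym_def)

lemma ex_max_on:
  fixes f :: "'b \<Rightarrow> nat"
  assumes "finite S" "S \<noteq> {}"
  shows "\<exists>x\<in>S. \<forall>y\<in>S. f y \<le> f x"
proof -
  have "Max (f ` S) \<in> f ` S" using assms by (intro Max_in) auto
  then obtain x where "x \<in> S" "f x = Max (f ` S)" by auto
  then show ?thesis using assms(1) by (intro bexI[of _ x]) auto
qed

lemma ex_min_on:
  fixes f :: "'b \<Rightarrow> nat"
  assumes "finite S" "S \<noteq> {}"
  shows "\<exists>x\<in>S. \<forall>y\<in>S. f x \<le> f y"
proof -
  have "Min (f ` S) \<in> f ` S" using assms by (intro Min_in) auto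
  then obtain x where "x \<in> S" "f x = Min (f ` S)" by auto
  then show ?thesis using assms(1) by (intro bexI[of _ x]) auto
qed

locale finite_poset =
  fixes P :: "'a rel"
  assumes finite_Field: "finite (Field P)" and partial_order: "Partial_order P"
begin

lemma P_refl: "x \<in> Field P \<Longrightarrow> (x, x) \<in> P"
  using partial_order by (auto simp: partial_order_on_def preorder_on_def refl_on_def)

lemma P_trans: "(x, y) \<in> P \<Longrightarrow> (y, z) \<in> P \<Longrightarrow> (x, z) \<in> P"
  using partial_order by (meson partial_order_on_def preorder_on_def transD)

lemma P_antisym: "(x, y) \<in> P \<Longrightarrow> (y, x) \<in> P \<Longrightarrow> x = y"
  using partial_order by (meson partial_order_on_def antisymD)

lemma finite_chain: "C \<in> Chains P \<Longrightarrow> finite C"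
  using Chains_Field finite_Field finite_subset by metis

lemma finite_Chains: "finite (Chains P)"
  by (rule finite_subset[of _ "Pow (Field P)"]) (use finite_Field Chains_Field in auto)

lemma empty_Chains: "{} \<in> Chains P"
  by (simp add: Chains_def)

lemma finite_chains_below: "finite {C \<in> Chains P. C \<subseteq> A}"
  using finite_Chains by simp

lemma rank_ge: "C \<in> Chains P \<Longrightarrow> C \<subseteq> underS P x \<Longrightarrow> card C \<le> rank P x"
  unfolding rank_def by (rule Max_ge) (use finite_chains_below in auto)

lemma rank_attained: "\<exists>C\<in>Chains P. C \<subseteq> underS P x \<and> card C = rank P x"
proof -
  have "rank P x \<in> card ` {C \<in> Chains P. C \<subseteq> underS P x}"
    unfolding rank_def by (rule Max_in) (use finite_chains_below empty_Chains in auto)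
  then show ?thesis by auto
qed

lemma rank_strict_mono:
  assumes "(x, y) \<in> P" "x \<noteq> y"
  shows "rank P x < rank P y"
proof -
  obtain C where C: "C \<in> Chains P" "C \<subseteq> underS P x" "card C = rank P x"
    using rank_attained by blast
  have "insert x C \<in> Chains P"
    using C P_refl[OF FieldI1[OF assms(1)]] unfolding Chains_insert underS_def by blast
  moreover have "insert x C \<subseteq> underS P y"
    using C assms P_trans P_antisym unfolding underS_def by blast
  moreover have "card (insert x C) = Suc (rank P x)"
    using C finite_chain by (subst card_insert_disjoint) (auto simp: underS_def)
  ultimately show ?thesis
    using rank_ge[of "insert x C" y] by simp
qed

text \<open>With nothing of intermediate rank, \<open>y\<close> would cover \<open>x\<close>. A
  longest chain below \<open>y\<close>, and one below \<open>x\<close> together with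
  \<open>x\<close>, then continue from \<open>y\<close> upwards by the same chain to maximal chains.
  By gradedness these have equal size, so the ranks differ by 1.\<close>

lemma rank_gap_of_graded:
  assumes gr: "graded P" and xy: "(x, y) \<in> P" "rank P x + 1 < rank P y"
  shows "\<exists>z. (x, z) \<in> P \<and> (z, y) \<in> P \<and> rank P x < rank P z \<and> rank P z < rank P y"
proof (rule ccontr)
  assume no: "\<nexists>z. (x, z) \<in> P \<and> (z, y) \<in> P \<and> rank P x < rank P z \<and> rank P z < rank P y"
  have gap: "z = x \<or> z = y" if "(x, z) \<in> P" "(z, y) \<in> P" for z
    using no that rank_strict_mono[of x z] rank_strict_mono[of z y] by blast
  have "x \<noteq> y" using xy by auto
  obtain C where C: "C \<in> Chains P" "C \<subseteq> underS P x" "card C = rank P x"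
    using rank_attained by blast
  obtain C' where C': "C' \<in> Chains P" "C' \<subseteq> underS P y" "card C' = rank P y"
    using rank_attained by blast
  \<comment> \<open>Both maximal chains share their part in \<open>U\<close>; taken of largest size,
    it cannot be extended there.\<close>
  define U where "U = {z. (y, z) \<in> P \<and> z \<noteq> y}"
  have "{D \<in> Chains P. D \<subseteq> U} \<noteq> {}" using empty_Chains by blast
  from ex_max_on[OF finite_chains_below this, of card]
  obtain D where D: "D \<in> Chains P" "D \<subseteq> U"
    and Dmax: "\<And>E. E \<in> Chains P \<Longrightarrow> E \<subseteq> U \<Longrightarrow> card E \<le> card D"
    by auto
  have ins: "B \<union> insert y D \<in> Chains P" if "B \<in> Chains P" "\<forall>b\<in>B. (b, y) \<in> P" for B
    using that D P_refl[OF FieldI2[OF xy(1)]] P_trans unfolding Chains_def U_def by blast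
  have D_no: "E = D" if "E \<in> Chains P" "D \<subseteq> E" "E \<subseteq> U" for E
    using card_seteq[OF finite_chain[OF that(1)] that(2) Dmax[OF that(1,3)]] by simp
  have "C' \<union> insert y D \<in> max_chains P"
    unfolding max_chains_def
  proof (intro CollectI conjI ballI impI)
    show C'D: "C' \<union> insert y D \<in> Chains P"
      using C' by (intro ins) (auto simp: underS_def)
    fix E assume E: "E \<in> Chains P" "C' \<union> insert y D \<subseteq> E"
    have "E \<inter> underS P y \<in> Chains P"
      by (rule Chains_subset[OF E(1)]) simp
    moreover from this have "card (E \<inter> underS P y) \<le> card C'"
      using rank_ge[of "E \<inter> underS P y" y] C'(3) by simp
    moreover have "C' \<subseteq> E \<inter> underS P y" using C' E by blast
    ultimately have 1: "E \<inter> underS P y = C'"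
      using card_seteq[of "E \<inter> underS P y" C'] finite_chain by simp
    have 2: "E \<inter> U = D"
      using D_no[OF Chains_subset[OF E(1), of "E \<inter> U"]] E(2) D(2) by blast
    have "u \<in> underS P y \<or> u = y \<or> u \<in> U" if "u \<in> E" for u
      using that E unfolding Chains_def underS_def U_def by blast
    then show "C' \<union> insert y D = E" using 1 2 E by blast
  qed
  moreover have "insert x C \<union> insert y D \<in> max_chains P"
    unfolding max_chains_def
  proof (intro CollectI conjI ballI impI)
    have "insert x C \<in> Chains P"
      using C P_refl[OF FieldI1[OF xy(1)]] unfolding Chains_insert underS_def by blast
    then show "insert x C \<union> insert y D \<in> Chains P"
      by (intro ins) (use C xy P_trans in \<open>auto simp: underS_def\<close>)
    fix E assume E: "E \<in> Chains P" "insert x C \<union> insert y D \<subseteq> E"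
    have "E \<inter> underS P x \<in> Chains P"
      by (rule Chains_subset[OF E(1)]) simp
    moreover from this have "card (E \<inter> underS P x) \<le> card C"
      using rank_ge[of "E \<inter> underS P x" x] C(3) by simp
    moreover have "C \<subseteq> E \<inter> underS P x" using C E by blast
    ultimately have 1: "E \<inter> underS P x = C"
      using card_seteq[of "E \<inter> underS P x" C] finite_chain by simp
    have 2: "E \<inter> U = D"
      using D_no[OF Chains_subset[OF E(1), of "E \<inter> U"]] E(2) D(2) by blast
    have "u \<in> underS P x \<or> u = x \<or> u = y \<or> u \<in> U" if "u \<in> E" for u
    proof -
      have "(u, x) \<in> P \<or> (x, u) \<in> P" "(u, y) \<in> P \<or> (y, u) \<in> P"
        using that E unfolding Chains_def by blast+
      then show ?thesis
        using gap[of u] unfolding underS_def U_def by blast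
    qed
    then show "insert x C \<union> insert y D = E" using 1 2 E by blast
  qed
  ultimately have "card (C' \<union> insert y D) = card (insert x C \<union> insert y D)"
    using gr unfolding graded_def by blast
  moreover have "C' \<inter> insert y D = {}"
    using C'(2) D(2) P_antisym[of _ y] unfolding underS_def U_def by blast
  moreover have "insert x C \<inter> insert y D = {}"
  proof -
    have "(z, x) \<in> P" if "z \<in> insert x C" for z
      using that C(2) P_refl[OF FieldI1[OF xy(1)]] unfolding underS_def by blast
    moreover have "(y, z) \<in> P" if "z \<in> insert y D" for z
      using that D(2) P_refl[OF FieldI2[OF xy(1)]] unfolding U_def by blast
    moreover have "(y, x) \<notin> P"
      using P_antisym[OF xy(1)] \<open>x \<noteq> y\<close> by blast
    ultimately show ?thesis
      using P_trans by blast
  qed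
  moreover have "y \<notin> D" "x \<notin> C"
    using C(2) D(2) unfolding underS_def U_def by blast+
  moreover have "finite C" "finite C'" "finite D"
    using C C' D finite_chain by auto
  ultimately have "rank P y = Suc (rank P x)"
    using C(3) C'(3) by (simp add: card_Un_disjoint)
  then show False using xy(2) by simp
qed

end

lemma eulerian_finite_poset: "eulerian P \<Longrightarrow> finite_poset P"
  by (simp add: eulerian_def finite_poset_def)

lemma eulerian_euler_poset:
  assumes "eulerian P"
  shows "euler_poset P (rank P)"
proof -
  interpret finite_poset P using eulerian_finite_poset[OF assms] .
  show ?thesis
  proof
    show "finite (Field P)" "Partial_order P"
      using finite_Field partial_order by auto
    show "rank P x < rank P y" if "(x, y) \<in> P" "x \<noteq> y" for x y
      using rank_strict_mono that by blast
    show "\<exists>z. (x, z) \<in> P \<and> (z, y) \<in> P \<and> rank P x < rank P z \<and> rank P z < rank P y"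
      if "(x, y) \<in> P" "rank P x + 1 < rank P y" for x y
      using rank_gap_of_graded assms that by (simp add: eulerian_def)
    show "(\<Sum>z\<in>interval P x y. (-1) ^ rank P z) = (0::int)" if "(x, y) \<in> P" "x \<noteq> y" for x y
    proof -
      have fin: "finite (interval P x y)"
        by (rule finite_subset[OF _ finite_Field]) (auto simp: interval_def FieldI1)
      have "(\<Sum>z\<in>interval P x y. (-1::int) ^ rank P z) =
          (\<Sum>z\<in>interval P x y. of_bool (even (rank P z)) - of_bool (odd (rank P z)))"
        by (intro sum.cong) auto
      also have "\<dots> = int (card {z \<in> interval P x y. even (rank P z)}) -
          int (card {z \<in> interval P x y. odd (rank P z)})"
        using fin by (simp add: sum_subtractf Int_def)
      finally show ?thesis
        using assms that by (simp add: eulerian_def)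
    qed
  qed
qed

lemma rank_pmin:
  assumes "Partial_order P" "is_min P x"
  shows "rank P x = 0"
proof -
  have "{C \<in> Chains P. C \<subseteq> underS P x} = {{}}"
    using assms unfolding is_min_def underS_def Chains_def partial_order_on_def antisym_def Field_def
    by blast
  then show ?thesis by (simp add: rank_def)
qed

text \<open>Strict monotonicity of \<open>r\<close> bounds the size of chains below
  \<open>x\<close>, and \<open>ex_rank\<close> supplies a chain through all smaller ranks.
  Constructed posets can thus be handled with an explicit rank function.\<close>

lemma (in euler_poset) rank_eq:
  assumes m: "is_min P m" "r m = 0" and x: "x \<in> Field P"
  shows "rank P x = r x"
proof -
  have fin: "finite {C \<in> Chains P. C \<subseteq> underS P x}"
    by (rule finite_subset[of _ "Pow (Field P)"]) (use finite_Field Chains_Field in auto)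
  have inj: "inj_on r C" if "C \<in> Chains P" for C
    using that rank_less unfolding inj_on_def Chains_def by fastforce
  have "card C \<le> r x" if "C \<in> Chains P" "C \<subseteq> underS P x" for C
  proof -
    have "r ` C \<subseteq> {..<r x}"
      using that rank_less by (auto simp: underS_def)
    then show ?thesis
      using card_mono[of "{..<r x}" "r ` C"] card_image[OF inj[OF that(1)]] by simp
  qed
  moreover have "\<exists>C\<in>Chains P. C \<subseteq> underS P x \<and> card C = r x"
    using x
  proof (induction "r x" arbitrary: x)
    case 0
    then show ?case by (intro bexI[of _ "{}"]) (auto simp: Chains_def)
  next
    case (Suc k)
    have "(m, x) \<in> P" using m(1) Suc.prems by (auto simp: is_min_def)
    then obtain z where z: "(z, x) \<in> P" "r z = k"
      using ex_rank[of m x k] m(2) Suc.hyps(2) by auto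
    have "z \<in> Field P" using z by (auto simp: FieldI1)
    then obtain C where C: "C \<in> Chains P" "C \<subseteq> underS P z" "card C = k"
      using Suc.hyps(1)[of z] z(2) by blast
    have "insert z C \<in> Chains P"
      using C P_refl[OF \<open>z \<in> Field P\<close>] unfolding Chains_insert underS_def by blast
    moreover have "z \<noteq> x" using z Suc.hyps(2) by auto
    then have "insert z C \<subseteq> underS P x"
      using C z P_trans P_antisym unfolding underS_def by blast
    moreover have "card (insert z C) = Suc k"
      using C finite_subset[OF Chains_Field finite_Field]
      by (subst card_insert_disjoint) (auto simp: underS_def)
    ultimately show ?case using Suc.hyps(2) by metis
  qed
  ultimately have "Max (card ` {C \<in> Chains P. C \<subseteq> underS P x}) = r x"
    using fin by (intro Max_eqI) (auto intro: rev_image_eqI)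
  then show ?thesis by (simp add: rank_def)
qed

text \<open>A maximal chain meets every rank. Otherwise \<open>rank_gap\<close> inserts an element
  between the neighbours \<open>u\<close> and \<open>v\<close> of a missed rank, and that element is
  comparable with the whole chain.\<close>

lemma (in euler_poset) max_chain_ranks:
  assumes m: "is_min P m" "r m = 0" and t: "is_max P t" and C: "C \<in> max_chains P"
  shows "card C = Suc (r t)"
proof -
  have CC: "C \<in> Chains P" and max: "\<And>D. D \<in> Chains P \<Longrightarrow> C \<subseteq> D \<Longrightarrow> C = D"
    using C by (auto simp: max_chains_def)
  have field: "C \<subseteq> Field P" using Chains_Field CC .
  have ins: "z \<in> C" if "z \<in> Field P" "\<forall>u\<in>C. (z, u) \<in> P \<or> (u, z) \<in> P" for z
    using max[of "insert z C"] CC that P_refl unfolding Chains_insert by blast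
  have mC: "m \<in> C" and tC: "t \<in> C"
    using ins[of m] ins[of t] m t field by (auto simp: is_min_def is_max_def)
  have finC: "finite C" using field finite_Field finite_subset by blast
  have lt: "(u, v) \<in> P" if "u \<in> C" "v \<in> C" "r u < r v" for u v
    using that CC rank_less[of v u] unfolding Chains_def by fastforce
  have "k \<in> r ` C" if k: "k \<le> r t" for k
  proof (rule ccontr)
    assume no: "k \<notin> r ` C"
    have "r m < k" "k < r t"
      using mC tC m(2) no k by (metis gr0I imageI, metis imageI le_neq_implies_less)
    then have "{u\<in>C. r u < k} \<noteq> {}" "{u\<in>C. k < r u} \<noteq> {}"
      using mC tC by auto
    then obtain u v where u: "u \<in> C" "r u < k" "\<And>w. w \<in> C \<Longrightarrow> r w < k \<Longrightarrow> r w \<le> r u"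
      and v: "v \<in> C" "k < r v" "\<And>w. w \<in> C \<Longrightarrow> k < r w \<Longrightarrow> r v \<le> r w"
      using ex_max_on[of "{u\<in>C. r u < k}" r] ex_min_on[of "{u\<in>C. k < r u}" r] finC by auto
    have uv: "(u, v) \<in> P" using lt u v by auto
    then obtain z where z: "(u, z) \<in> P" "(z, v) \<in> P" "r u < r z" "r z < r v"
      using rank_gap[OF uv] u(2) v(2) by auto
    have "z \<in> C"
    proof (rule ins)
      show "z \<in> Field P" using z by (auto simp: FieldI1)
      show "\<forall>w\<in>C. (z, w) \<in> P \<or> (w, z) \<in> P"
      proof
        fix w assume w: "w \<in> C"
        have "r w < k \<or> k < r w" using no w by fastforce
        then show "(z, w) \<in> P \<or> (w, z) \<in> P"
        proof
          assume "r w < k"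
          then have "w = u \<or> (w, u) \<in> P"
            using u w CC rank_less[of u w] unfolding Chains_def by fastforce
          then show ?thesis using z P_trans[of w u z] by blast
        next
          assume "k < r w"
          then have "w = v \<or> (v, w) \<in> P"
            using v w CC rank_less[of w v] unfolding Chains_def by fastforce
          then show ?thesis using z P_trans[of z v w] by blast
        qed
      qed
    qed
    moreover from this have "r z < k \<or> k < r z"
      using no by fastforce
    ultimately show False
      using u(3)[of z] v(3)[of z] z by auto
  qed
  moreover have "r u \<le> r t" if "u \<in> C" for u
    using that field t rank_less[of u t] by (cases "u = t") (auto simp: is_max_def intro: less_imp_le)
  ultimately have "r ` C = {..r t}" by auto
  moreover have "inj_on r C"
    using CC rank_less unfolding inj_on_def Chains_def by fastforce
  ultimately show ?thesis
    using card_image by fastforce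
qed

lemma (in euler_poset) eulerian:
  assumes m: "is_min P m" "r m = 0" and t: "is_max P t"
  shows "eulerian P" "poset_rank P = r t" "pmin P = m" "pmax P = t"
proof -
  show p: "pmin P = m" "pmax P = t"
    using pmin_eq[OF partial_order m(1)] pmax_eq[OF partial_order t] by simp_all
  show "poset_rank P = r t"
    using rank_eq[OF m] t p by (simp add: poset_rank_def is_max_def)
  have "card {z \<in> interval P x y. even (rank P z)} = card {z \<in> interval P x y. odd (rank P z)}"
    if "(x, y) \<in> P" "x \<noteq> y" for x y
  proof -
    have sub: "interval P x y \<subseteq> Field P"
      by (auto simp: interval_def FieldI1)
    then have fin: "finite (interval P x y)"
      using finite_Field finite_subset by blast
    have "(\<Sum>z\<in>interval P x y. (-1::int) ^ r z) =
        (\<Sum>z\<in>interval P x y. of_bool (even (rank P z)) - of_bool (odd (rank P z)))"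
      by (intro sum.cong) (use sub rank_eq[OF m] in auto)
    also have "\<dots> = int (card {z \<in> interval P x y. even (rank P z)}) -
        int (card {z \<in> interval P x y. odd (rank P z)})"
      using fin by (simp add: sum_subtractf Int_def)
    finally show ?thesis
      using euler[OF that] by simp
  qed
  then show "eulerian P"
    using finite_Field partial_order m t max_chain_ranks[OF m t]
    by (auto simp: eulerian_def graded_def)
qed

section \<open>The cd-index of an Eulerian poset\<close>

lemma ab_monomial_Suc:
  "ab_monomial (Suc n) S = ab_monomial n S * (if Suc n \<in> S then ncvar Lb else ncvar La)"
  by (simp add: ab_monomial_def)

lemma ab_monomial_insert: "n < k \<Longrightarrow> ab_monomial n (insert k S) = ab_monomial n S"
  unfolding ab_monomial_def by (intro arg_cong[of _ _ prod_list] map_cong) auto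

lemma sum_Pow_insert:
  assumes "finite A" "x \<notin> A"
  shows "(\<Sum>S\<in>Pow (insert x A). f S) = (\<Sum>S\<in>Pow A. f S) + (\<Sum>S\<in>Pow A. f (insert x S))"
proof -
  have "(\<Sum>S\<in>Pow A \<union> insert x ` Pow A. f S) = (\<Sum>S\<in>Pow A. f S) + (\<Sum>S\<in>insert x ` Pow A. f S)"
    by (rule sum.union_disjoint) (use assms in auto)
  moreover have "(\<Sum>S\<in>insert x ` Pow A. f S) = (\<Sum>S\<in>Pow A. f (insert x S))"
    by (subst sum.reindex) (use assms in \<open>auto simp: inj_on_def\<close>)
  ultimately show ?thesis by (simp add: Pow_insert)
qed

text \<open>Ranks in \<open>T\<close> are forced into \<open>S\<close>; taking
  \<open>- var_b\<close> from a factor outside \<open>T\<close> adds its rank to \<open>S\<close>,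
  so the sign counts \<open>S - T\<close>. This is the passage from f to h in
  \<open>flag_h\<close>.\<close>

lemma prod_list_ab_expand:
  "prod_list (map (\<lambda>i. if i \<in> T then var_b else var_a - var_b) [1..<n + 1]) =
     (\<Sum>S\<in>Pow {1..n}. if T \<inter> {1..n} \<subseteq> S then of_int ((-1) ^ card (S - T)) * ab_monomial n S else 0)"
proof (induction n)
  case 0
  then show ?case by (simp add: ab_monomial_def)
next
  case (Suc n)
  define F where "F S = (if T \<inter> {1..n} \<subseteq> S then of_int ((-1) ^ card (S - T)) * ab_monomial n S else 0)" for S
  define G where "G S = (if T \<inter> {1..Suc n} \<subseteq> S then of_int ((-1) ^ card (S - T)) * ab_monomial (Suc n) S else 0)" for S
  have atLeastAtMost_Suc: "{1..Suc n} = insert (Suc n) {1..n}" by auto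
  have G: "G S + G (insert (Suc n) S) = F S * (if Suc n \<in> T then var_b else var_a - var_b)"
    if S: "S \<in> Pow {1..n}" for S
  proof -
    have fin: "finite S" using S finite_subset by auto
    have notin: "Suc n \<notin> S" using S by auto
    have ins: "G (insert (Suc n) S) = F S * (if Suc n \<in> T then var_b else - var_b)"
    proof -
      have "T \<inter> {1..Suc n} \<subseteq> insert (Suc n) S \<longleftrightarrow> T \<inter> {1..n} \<subseteq> S"
        unfolding atLeastAtMost_Suc by auto
      moreover have "insert (Suc n) S - T = (if Suc n \<in> T then S - T else insert (Suc n) (S - T))"
        by auto
      ultimately show ?thesis
        using fin notin by (auto simp: G_def F_def ab_monomial_Suc ab_monomial_insert mult.assoc)
    qed
    have "T \<inter> {1..Suc n} \<subseteq> S \<longleftrightarrow> Suc n \<notin> T \<and> T \<inter> {1..n} \<subseteq> S"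
      using notin unfolding atLeastAtMost_Suc by auto
    then have "G S = F S * (if Suc n \<in> T then 0 else var_a)"
      using notin by (simp add: G_def F_def ab_monomial_Suc mult.assoc)
    then show ?thesis
      using ins by (auto simp: right_diff_distrib)
  qed
  have "(\<Sum>S\<in>Pow {1..Suc n}. G S) = (\<Sum>S\<in>Pow {1..n}. G S + G (insert (Suc n) S))"
    unfolding atLeastAtMost_Suc by (subst sum_Pow_insert) (auto simp: sum.distrib)
  also have "\<dots> = (\<Sum>S\<in>Pow {1..n}. F S) * (if Suc n \<in> T then var_b else var_a - var_b)"
    unfolding sum_distrib_right by (intro sum.cong G refl)
  also have "(\<Sum>S\<in>Pow {1..n}. F S) =
      prod_list (map (\<lambda>i. if i \<in> T then var_b else var_a - var_b) [1..<n + 1])"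
    unfolding F_def Suc.IH ..
  finally have "(\<Sum>S\<in>Pow {1..Suc n}. G S) =
      prod_list (map (\<lambda>i. if i \<in> T then var_b else var_a - var_b) [1..<Suc n + 1])"
    by simp
  then show ?case
    unfolding G_def by (rule sym)
qed

text \<open>Interchanging the sums over \<open>T\<close> and \<open>S\<close> returns from h-numbers
  to f-numbers, which count chains and so match \<open>chain_poly\<close>.\<close>

lemma ab_index_flag_f:
  assumes "poset_rank P = Suc n"
  shows "ab_index P = (\<Sum>T\<in>Pow {1..n}. of_int (int (flag_f P T)) *
    prod_list (map (\<lambda>i. if i \<in> T then var_b else var_a - var_b) [1..<n + 1]))"
proof -
  let ?c = "\<lambda>S T. of_int ((-1) ^ card (S - T)) :: ab ncpoly"
  let ?f = "\<lambda>T. of_int (int (flag_f P T)) :: ab ncpoly"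
  have "ab_index P = (\<Sum>S\<in>Pow {1..n}. \<Sum>T\<in>{T\<in>Pow {1..n}. T \<subseteq> S}. ?f T * (?c S T * ab_monomial n S))"
    unfolding ab_index_def assms Let_def diff_Suc_1
  proof (rule sum.cong)
    fix S assume "S \<in> Pow {1..n}"
    then have "{T\<in>Pow {1..n}. T \<subseteq> S} = Pow S" by auto
    moreover have "of_int (flag_h P S) * ab_monomial n S =
        (\<Sum>T\<in>Pow S. ?f T * (?c S T * ab_monomial n S))"
      unfolding flag_h_def of_int_sum sum_distrib_right
    proof (intro sum.cong refl)
      fix T
      show "of_int ((-1) ^ card (S - T) * int (flag_f P T)) * ab_monomial n S =
          ?f T * (?c S T * ab_monomial n S)"
        by (metis mult.assoc mult.commute of_int_mult)
    qed
    ultimately show "of_int (flag_h P S) * ab_monomial n S =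
        (\<Sum>T\<in>{T\<in>Pow {1..n}. T \<subseteq> S}. ?f T * (?c S T * ab_monomial n S))"
      by simp
  qed simp
  also have "\<dots> = (\<Sum>T\<in>Pow {1..n}. \<Sum>S\<in>{S\<in>Pow {1..n}. T \<subseteq> S}. ?f T * (?c S T * ab_monomial n S))"
    by (rule sum.swap_restrict) auto
  also have "\<dots> = (\<Sum>T\<in>Pow {1..n}. ?f T *
      (\<Sum>S\<in>Pow {1..n}. if T \<inter> {1..n} \<subseteq> S then ?c S T * ab_monomial n S else 0))"
  proof (rule sum.cong)
    fix T assume "T \<in> Pow {1..n}"
    then have "T \<inter> {1..n} = T" by auto
    then show "(\<Sum>S\<in>{S\<in>Pow {1..n}. T \<subseteq> S}. ?f T * (?c S T * ab_monomial n S)) =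
        ?f T * (\<Sum>S\<in>Pow {1..n}. if T \<inter> {1..n} \<subseteq> S then ?c S T * ab_monomial n S else 0)"
      by (simp only: sum_distrib_left[symmetric]) (subst sum.inter_filter, simp_all)
  qed simp
  finally show ?thesis
    unfolding prod_list_ab_expand .
qed

context
  fixes P :: "'a rel" and n :: nat
  assumes P: "P \<in> eulerian_posets (n + 1)"
begin

interpretation euler_poset P "rank P"
  using P by (auto simp: eulerian_posets_def intro: eulerian_euler_poset)

lemma eulerian_bounds:
  shows "is_min P (pmin P)" "is_max P (pmax P)" "rank P (pmin P) = 0" "rank P (pmax P) = Suc n"
    "(pmin P, pmax P) \<in> P" "pmin P \<noteq> pmax P"
proof -
  obtain m t where mt: "is_min P m" "is_max P t"
    using P by (auto simp: eulerian_posets_def eulerian_def)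
  then show b: "is_min P (pmin P)" "is_max P (pmax P)"
    using pmin_eq[OF partial_order mt(1)] pmax_eq[OF partial_order mt(2)] by simp_all
  show r: "rank P (pmin P) = 0" "rank P (pmax P) = Suc n"
    using rank_pmin[OF partial_order b(1)] P by (auto simp: eulerian_posets_def poset_rank_def)
  show "(pmin P, pmax P) \<in> P"
    using b by (auto simp: is_min_def is_max_def)
  show "pmin P \<noteq> pmax P" using r by auto
qed

lemma ab_index_eq_ab_poly: "ab_index P = ab_poly (pmin P) (pmax P)"
proof -
  let ?M = "\<lambda>T. prod_list (map (\<lambda>i. if i \<in> T then var_b else var_a - var_b) [1..<n + 1])"
  let ?C = "chains (pmin P) (pmax P)"
  have between: "between (pmin P) (pmax P) = Field P - {pmin P, pmax P}"
    using eulerian_bounds by (auto simp: between_def is_min_def is_max_def FieldI1)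
  have pr: "poset_rank P = Suc n"
    using P by (simp add: eulerian_posets_def)
  have img: "rank P ` C \<in> Pow {1..n}" if "C \<in> ?C" for C
    using chains_rank[OF that] eulerian_bounds(3,4) by fastforce
  have "ab_index P = (\<Sum>T\<in>Pow {1..n}. \<Sum>C\<in>{C\<in>?C. rank P ` C = T}. ?M (rank P ` C))"
    unfolding ab_index_flag_f[OF pr]
  proof (intro sum.cong refl)
    fix T
    have "flag_f P T = card {C\<in>?C. rank P ` C = T}"
      by (simp add: flag_f_def chains_def between conj_assoc)
    then show "of_int (int (flag_f P T)) * ?M T = (\<Sum>C\<in>{C\<in>?C. rank P ` C = T}. ?M (rank P ` C))"
      by simp
  qed
  also have "\<dots> = (\<Sum>C\<in>?C. ?M (rank P ` C))"
    by (rule sum.group) (use img in auto)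
  finally show ?thesis
    by (simp add: chain_poly_def eulerian_bounds(3,4))
qed

lemma cd_coeff_eq_coeff: "cd_coeff w P = coeff (pmin P) (pmax P) w"
  by (simp add: cd_coeff_def cd_index_def coeff_def cd_poly_def ab_index_eq_ab_poly)

lemma cd_coeff_unique: "ab_index P = ncsubst cd_to_ab F \<Longrightarrow> cd_coeff w P = Poly_Mapping.lookup F w"
  unfolding cd_coeff_def cd_index_def using ncsubst_inj
  by (metis (mono_tags, lifting) the_equality)

lemma ab_index_eq_cd_index:
  "ab_index P = ncsubst cd_to_ab (cd_index P)" "homogeneous n (cd_index P)"
proof -
  have "cd_index P = cd_poly (pmin P) (pmax P)"
    by (simp add: cd_index_def cd_poly_def ab_index_eq_ab_poly)
  then show "ab_index P = ncsubst cd_to_ab (cd_index P)" "homogeneous n (cd_index P)"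
    using ab_poly_eq[of "pmin P" "pmax P"] homogeneous_cd_poly[of "pmin P" "pmax P"] eulerian_bounds
    by (simp_all add: ab_index_eq_ab_poly)
qed

lemma cd_coeff_c_power: "cd_coeff (replicate n Lc) P = 1"
  using coeff_replicate_Lc eulerian_bounds by (simp add: cd_coeff_eq_coeff)

lemma cd_coeff_alternating_nonneg:
  "k > 0 \<or> min i j \<le> 1 \<Longrightarrow>
     cd_coeff (replicate i Lc @ Ld # concat (replicate k [Lc, Ld]) @ replicate j Lc) P \<ge> 0"
  using coeff_alternating_nonneg eulerian_bounds by (simp add: cd_coeff_eq_coeff)

lemma level_bounds: "level (pmin P) (pmax P) k = {z \<in> Field P. rank P z = k}" if "0 < k" "k \<le> n"
  using that eulerian_bounds by (auto simp: level_def between_def is_min_def is_max_def FieldI1)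

lemma cd_coeff_dc_power:
  assumes "n = j + 2"
  shows "cd_coeff (Ld # replicate j Lc) P = int (card {z\<in>Field P. rank P z = 1}) - 2"
  using coeff_d_c_power[of "pmin P" "pmax P" j] eulerian_bounds level_bounds[of 1] assms
  by (simp add: cd_coeff_eq_coeff)

lemma cd_coeff_ccdcc:
  assumes "n = 6"
  shows "cd_coeff [Lc, Lc, Ld, Lc, Lc] P = int (card {z\<in>Field P. rank P z = 3})
    - int (card {z\<in>Field P. rank P z = 2}) + int (card {z\<in>Field P. rank P z = 1}) - 2"
  using coeff_ccdcc[of "pmin P" "pmax P"] eulerian_bounds level_bounds[of 1] level_bounds[of 2]
    level_bounds[of 3] assms
  by (simp add: cd_coeff_eq_coeff flip: numeral_2_eq_2)

lemma cd_coeff_dc_power_d: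
  assumes "n = m + 4"
  shows "cd_coeff (Ld # replicate m Lc @ [Ld]) P =
    int (card {(a, z)\<in>P. rank P a = 1 \<and> rank P z = n})
    - 2 * int (card {z\<in>Field P. rank P z = 1}) - 2 * int (card {z\<in>Field P. rank P z = n}) + 4"
proof -
  have "{(a, z). a \<in> level (pmin P) (pmax P) 1 \<and> z \<in> level (pmin P) (pmax P) n \<and> (a, z) \<in> P} =
      {(a, z)\<in>P. rank P a = 1 \<and> rank P z = n}"
    using assms level_bounds[of 1] level_bounds[of n] by (auto simp: FieldI1 FieldI2)
  then show ?thesis
    using coeff_d_c_power_d[of "pmin P" "pmax P" m] eulerian_bounds level_bounds[of 1]
      level_bounds[of n] assms
    by (simp add: cd_coeff_eq_coeff add.commute[of 4 m])
qed

end

section \<open>Eulerian complexes\<close>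

abbreviation sg :: "nat \<Rightarrow> int" where "sg k \<equiv> (-1) ^ k"

text \<open>The poset without its bounds. The rank of the missing maximum is \<open>n + 1\<close>; apart from the
  interval between the bounds, all intervals of the bounded poset are Eulerian.\<close>

locale euler_complex =
  fixes n :: nat and P :: "'a rel" and r :: "'a \<Rightarrow> nat"
  assumes finite_Field: "finite (Field P)"
    and partial_order: "Partial_order P"
    and nonempty: "0 < n \<Longrightarrow> P \<noteq> {}"
    and rank_pos: "x \<in> Field P \<Longrightarrow> 0 < r x"
    and rank_le: "x \<in> Field P \<Longrightarrow> r x \<le> n"
    and rank_less: "(x, y) \<in> P \<Longrightarrow> x \<noteq> y \<Longrightarrow> r x < r y"
    and gap: "(x, y) \<in> P \<Longrightarrow> r x + 1 < r y \<Longrightarrow> \<exists>z. (x, z) \<in> P \<and> (z, y) \<in> P \<and> r x < r z \<and> r z < r y"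
    and gap_below: "y \<in> Field P \<Longrightarrow> 1 < r y \<Longrightarrow> \<exists>z. (z, y) \<in> P \<and> r z < r y"
    and gap_above: "x \<in> Field P \<Longrightarrow> r x < n \<Longrightarrow> \<exists>z. (x, z) \<in> P \<and> r x < r z"
    and euler_interval: "(x, y) \<in> P \<Longrightarrow> x \<noteq> y \<Longrightarrow> (\<Sum>z\<in>interval P x y. sg (r z)) = 0"
    and euler_below: "y \<in> Field P \<Longrightarrow> (\<Sum>z\<in>P\<inverse> `` {y}. sg (r z)) = -1"
    and euler_above: "x \<in> Field P \<Longrightarrow> (\<Sum>z\<in>P `` {x}. sg (r z)) = sg n"
begin

lemma P_refl: "x \<in> Field P \<Longrightarrow> (x, x) \<in> P"
  using partial_order by (auto simp: partial_order_on_def preorder_on_def refl_on_def)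

lemma P_trans: "(x, y) \<in> P \<Longrightarrow> (y, z) \<in> P \<Longrightarrow> (x, z) \<in> P"
  using partial_order by (meson partial_order_on_def preorder_on_def transD)

lemma P_antisym: "(x, y) \<in> P \<Longrightarrow> (y, x) \<in> P \<Longrightarrow> x = y"
  using partial_order by (meson partial_order_on_def antisymD)

lemma FieldD: "(x, y) \<in> P \<Longrightarrow> x \<in> Field P" "(x, y) \<in> P \<Longrightarrow> y \<in> Field P"
  by (auto simp: FieldI1 FieldI2)

lemma finite_P: "finite P"
  by (rule finite_subset[of _ "Field P \<times> Field P"]) (use FieldD finite_Field in auto)

lemma interval_subset: "interval P x y \<subseteq> Field P" "P `` {x} \<subseteq> Field P" "P\<inverse> `` {x} \<subseteq> Field P"
  using FieldD by (auto simp: interval_def)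

lemma finite_interval [simp]: "finite (interval P x y)" "finite (P `` {x})" "finite (P\<inverse> `` {x})"
  using interval_subset finite_Field finite_subset by metis+

lemma rank_mono: "(x, y) \<in> P \<Longrightarrow> r x \<le> r y"
  using rank_less[of x y] by (cases "x = y") auto

lemma rank_eq_imp_eq: "(x, y) \<in> P \<Longrightarrow> r x = r y \<Longrightarrow> x = y"
  using rank_less[of x y] by auto

end

lemma Partial_orderI:
  assumes "\<And>x y. (x, y) \<in> P \<Longrightarrow> (x, x) \<in> P \<and> (y, y) \<in> P"
    "\<And>x y z. (x, y) \<in> P \<Longrightarrow> (y, z) \<in> P \<Longrightarrow> (x, z) \<in> P"
    "\<And>x y. (x, y) \<in> P \<Longrightarrow> (y, x) \<in> P \<Longrightarrow> x = y"
  shows "Partial_order P"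
proof -
  have "(x, x) \<in> P" if "x \<in> Field P" for x
    using that assms(1) by (auto simp: Field_def)
  moreover have "P \<subseteq> Field P \<times> Field P"
    by (auto simp: FieldI1 FieldI2)
  moreover have "trans P" "antisym P"
    using assms(2,3) by (blast intro: transI, blast intro: antisymI)
  ultimately show ?thesis
    by (simp add: partial_order_on_def preorder_on_def refl_on_def)
qed

text \<open>Ranks exceed dimensions by one, so this is minus the Euler characteristic. Between
  adjoined bounds of ranks 0 and n + 1 the Eulerian condition says that it equals
  \<open>sg n - 1\<close>. The locale \<open>euler_complex\<close> leaves it free so that disjoint
  unions, on which it adds, stay in the locale.\<close>

definition euler_number :: "'a rel \<Rightarrow> ('a \<Rightarrow> nat) \<Rightarrow> int" where
  "euler_number P r = (\<Sum>x\<in>Field P. sg (r x))"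

definition num_rank :: "'a rel \<Rightarrow> ('a \<Rightarrow> nat) \<Rightarrow> nat \<Rightarrow> nat" where
  "num_rank P r k = card {x\<in>Field P. r x = k}"

definition num_pairs :: "'a rel \<Rightarrow> ('a \<Rightarrow> nat) \<Rightarrow> nat \<Rightarrow> nat \<Rightarrow> nat" where
  "num_pairs P r j k = card {(x, y)\<in>P. r x = j \<and> r y = k}"

text \<open>The ab-index of the poset with bounds adjoined (\<open>ab_index_bounded\<close>),
  computed from the proper elements alone.\<close>

definition flag_poly :: "nat \<Rightarrow> 'a rel \<Rightarrow> ('a \<Rightarrow> nat) \<Rightarrow> ab ncpoly" where
  "flag_poly n P r =
     (\<Sum>C\<in>Chains P. prod_list (map (\<lambda>i. if i \<in> r ` C then var_b else var_a - var_b) [1..<n + 1]))"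

subsection \<open>Relabelling\<close>

context euler_complex
begin

context
  fixes f :: "'a \<Rightarrow> 'b" and q :: "'b \<Rightarrow> nat"
  assumes inj: "inj_on f (Field P)" and q: "\<And>x. x \<in> Field P \<Longrightarrow> q (f x) = r x"
begin

abbreviation (input) "P' \<equiv> map_prod f f ` P"

lemma relabel_obtain:
  assumes "(u, v) \<in> P'" obtains x y where "u = f x" "v = f y" "(x, y) \<in> P" "x \<in> Field P" "y \<in> Field P"
  using assms FieldD by auto

lemma Field_relabel: "Field P' = f ` Field P"
  unfolding Field_def by force

lemma relabel_up:
  assumes x: "x \<in> Field P"
  shows "(f x, v) \<in> P' \<longleftrightarrow> (\<exists>y. v = f y \<and> (x, y) \<in> P)"
proof
  assume "(f x, v) \<in> P'"
  then obtain x' y where *: "f x = f x'" "v = f y" "(x', y) \<in> P" by auto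
  then have "x = x'" using inj_onD[OF inj *(1) x FieldD(1)] by simp
  with * show "\<exists>y. v = f y \<and> (x, y) \<in> P" by blast
qed auto

lemma relabel_down:
  assumes y: "y \<in> Field P"
  shows "(u, f y) \<in> P' \<longleftrightarrow> (\<exists>x. u = f x \<and> (x, y) \<in> P)"
proof
  assume "(u, f y) \<in> P'"
  then obtain x y' where *: "f y = f y'" "u = f x" "(x, y') \<in> P" by auto
  then have "y = y'" using inj_onD[OF inj *(1) y FieldD(2)] by simp
  with * show "\<exists>x. u = f x \<and> (x, y) \<in> P" by blast
qed auto

lemma relabel_iff:
  assumes "x \<in> Field P" and y: "y \<in> Field P"
  shows "(f x, f y) \<in> P' \<longleftrightarrow> (x, y) \<in> P"
  unfolding relabel_up[OF assms(1)]
proof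
  assume "\<exists>y'. f y = f y' \<and> (x, y') \<in> P"
  then obtain y' where *: "f y = f y'" "(x, y') \<in> P" by blast
  then have "y = y'" using inj_onD[OF inj *(1) y FieldD(2)] by simp
  with * show "(x, y) \<in> P" by blast
qed blast

lemma relabel_interval:
  assumes x: "x \<in> Field P"
  shows "y \<in> Field P \<Longrightarrow> interval P' (f x) (f y) = f ` interval P x y"
    "P' `` {f x} = f ` (P `` {x})" "P'\<inverse> `` {f x} = f ` (P\<inverse> `` {x})"
proof -
  show "P' `` {f x} = f ` (P `` {x})"
    by (intro set_eqI) (simp only: Image_singleton_iff relabel_up[OF x], blast)
  show "P'\<inverse> `` {f x} = f ` (P\<inverse> `` {x})"
    by (intro set_eqI) (simp only: Image_singleton_iff converse_iff relabel_down[OF x], blast)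
  assume y: "y \<in> Field P"
  show "interval P' (f x) (f y) = f ` interval P x y"
  proof (intro set_eqI iffI)
    fix w assume "w \<in> interval P' (f x) (f y)"
    then have w: "(f x, w) \<in> P'" "(w, f y) \<in> P'"
      by (simp_all only: interval_def mem_Collect_eq)
    from w(1)[unfolded relabel_up[OF x]] obtain z where z: "w = f z" "(x, z) \<in> P"
      by blast
    then have "(z, y) \<in> P"
      using w(2) relabel_iff[OF FieldD(2)[OF z(2)] y] by simp
    then show "w \<in> f ` interval P x y"
      using z by (auto simp: interval_def)
  next
    fix w assume "w \<in> f ` interval P x y"
    then show "w \<in> interval P' (f x) (f y)"
      unfolding interval_def by auto
  qed
qed

lemma sum_relabel: "A \<subseteq> Field P \<Longrightarrow> (\<Sum>z\<in>f ` A. h (q z)) = (\<Sum>z\<in>A. h (r z))"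
  by (subst sum.reindex[OF inj_on_subset[OF inj]], assumption, rule sum.cong) (simp_all add: q subset_iff)

text \<open>Transport along an injection puts copies disjointly into a sum type, brings results back
  to \<open>nat\<close>, and finally places the poset inside the prescribed infinite type.\<close>

lemma relabel_complex: "euler_complex n P' q"
proof
  show "finite (Field P')" using finite_Field by (simp add: Field_relabel)
  show "Partial_order P'"
  proof (rule Partial_orderI)
    fix u v assume "(u, v) \<in> P'"
    then obtain x y where xy: "u = f x" "v = f y" "(x, y) \<in> P" "x \<in> Field P" "y \<in> Field P"
      by (rule relabel_obtain)
    then show "(u, u) \<in> P' \<and> (v, v) \<in> P'"
      using relabel_iff P_refl by simp
    show "u = v" if "(v, u) \<in> P'"
      using that xy P_antisym[of x y] relabel_iff by simp
    show "(u, w) \<in> P'" if vw: "(v, w) \<in> P'" for w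
    proof -
      obtain z where z: "w = f z" "(y, z) \<in> P"
        using vw[unfolded xy(2) relabel_up[OF xy(5)]] by blast
      then show ?thesis
        using xy(1) P_trans[OF xy(3) z(2)] by (simp add: rev_image_eqI)
    qed
  qed
  show "0 < n \<Longrightarrow> P' \<noteq> {}" using nonempty by auto
  show "0 < q x" "q x \<le> n" if "x \<in> Field P'" for x
    using that rank_pos rank_le q by (auto simp: Field_relabel)
  show "q u < q v" if "(u, v) \<in> P'" "u \<noteq> v" for u v
    using that(1)
  proof (rule relabel_obtain)
    fix x y assume "u = f x" "v = f y" "(x, y) \<in> P" "x \<in> Field P" "y \<in> Field P"
    then show ?thesis using that(2) rank_less[of x y] by (auto simp: q)
  qed
  show "\<exists>w. (u, w) \<in> P' \<and> (w, v) \<in> P' \<and> q u < q w \<and> q w < q v" if uv: "(u, v) \<in> P'" "q u + 1 < q v" for u v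
    using uv(1)
  proof (rule relabel_obtain)
    fix x y assume *: "u = f x" "v = f y" "(x, y) \<in> P" "x \<in> Field P" "y \<in> Field P"
    then obtain z where "(x, z) \<in> P" "(z, y) \<in> P" "r x < r z" "r z < r y"
      using gap[of x y] uv(2) by (auto simp: q)
    then show ?thesis
      using * FieldD[of x z] by (intro exI[of _ "f z"]) (auto simp: q)
  qed
  show "\<exists>w. (w, v) \<in> P' \<and> q w < q v" if v: "v \<in> Field P'" "1 < q v" for v
  proof -
    obtain y where y: "v = f y" "y \<in> Field P" using v(1) by (auto simp: Field_relabel)
    then obtain z where "(z, y) \<in> P" "r z < r y"
      using gap_below[of y] v(2) by (auto simp: q)
    then show ?thesis
      using y FieldD[of z y] by (intro exI[of _ "f z"]) (auto simp: q)
  qed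
  show "\<exists>w. (v, w) \<in> P' \<and> q v < q w" if v: "v \<in> Field P'" "q v < n" for v
  proof -
    obtain y where y: "v = f y" "y \<in> Field P" using v(1) by (auto simp: Field_relabel)
    then obtain z where "(y, z) \<in> P" "r y < r z"
      using gap_above[of y] v(2) by (auto simp: q)
    then show ?thesis
      using y FieldD[of y z] by (intro exI[of _ "f z"]) (auto simp: q)
  qed
  show "(\<Sum>w\<in>interval P' u v. sg (q w)) = 0" if "(u, v) \<in> P'" "u \<noteq> v" for u v
    using that(1)
  proof (rule relabel_obtain)
    fix x y assume "u = f x" "v = f y" "(x, y) \<in> P" "x \<in> Field P" "y \<in> Field P"
    then show ?thesis
      using that(2) euler_interval[of x y] sum_relabel[OF interval_subset(1), of sg]
      by (simp add: relabel_interval) blast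
  qed
  show "(\<Sum>w\<in>P'\<inverse> `` {v}. sg (q w)) = - 1" if "v \<in> Field P'" for v
    using that euler_below sum_relabel[OF interval_subset(3), of sg]
    by (auto simp: relabel_interval Field_relabel)
  show "(\<Sum>w\<in>P' `` {v}. sg (q w)) = sg n" if "v \<in> Field P'" for v
    using that euler_above sum_relabel[OF interval_subset(2), of sg]
    by (auto simp: relabel_interval Field_relabel)
qed

lemma relabel_euler_number: "euler_number P' q = euler_number P r"
  unfolding euler_number_def Field_relabel by (rule sum_relabel) simp

lemma relabel_num_rank: "num_rank P' q k = num_rank P r k"
proof -
  have "{x\<in>f ` Field P. q x = k} = f ` {x\<in>Field P. r x = k}" using q by auto
  then show ?thesis
    unfolding num_rank_def Field_relabel using inj by (simp add: card_image inj_on_def)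
qed

lemma relabel_num_pairs: "num_pairs P' q j k = num_pairs P r j k"
proof -
  have "{(x, y)\<in>P'. q x = j \<and> q y = k} = map_prod f f ` {(x, y)\<in>P. r x = j \<and> r y = k}"
    using q FieldD by force
  moreover have "inj_on (map_prod f f) {(x, y)\<in>P. r x = j \<and> r y = k}"
    using inj FieldD unfolding inj_on_def by auto
  ultimately show ?thesis
    unfolding num_pairs_def by (simp add: card_image)
qed

lemma relabel_flag_poly: "flag_poly m P' q = flag_poly m P r"
proof -
  have "Chains P' = (\<lambda>C. f ` C) ` Chains P"
  proof (intro set_eqI iffI)
    fix D assume D: "D \<in> Chains P'"
    define C where "C = {x\<in>Field P. f x \<in> D}"
    have "D = f ` C"
      using Chains_Field[OF D] by (auto simp: C_def Field_relabel)
    moreover have "C \<in> Chains P"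
      unfolding Chains_def
    proof (intro CollectI ballI)
      fix a b assume "a \<in> C" "b \<in> C"
      then have "(f a, f b) \<in> P' \<or> (f b, f a) \<in> P'" "a \<in> Field P" "b \<in> Field P"
        using D unfolding Chains_def C_def by blast+
      then show "(a, b) \<in> P \<or> (b, a) \<in> P"
        using relabel_iff by simp
    qed
    ultimately show "D \<in> (\<lambda>C. f ` C) ` Chains P" by blast
  qed (auto simp: Chains_def)
  moreover have "inj_on (\<lambda>C. f ` C) (Chains P)"
    by (rule inj_onI) (use inj_on_image_eq_iff[OF inj Chains_Field Chains_Field] in blast)
  moreover have "q ` f ` C = r ` C" if "C \<in> Chains P" for C
    using q Chains_Field[OF that] by force
  ultimately show ?thesis
    unfolding flag_poly_def by (simp add: sum.reindex)
qed

end

end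

subsection \<open>Disjoint unions and ordinal sums\<close>

context
  fixes n :: nat and P Q :: "'a rel" and r :: "'a \<Rightarrow> nat"
  assumes P: "euler_complex n P r" and Q: "euler_complex n Q r"
    and disjoint: "Field P \<inter> Field Q = {}"
begin

interpretation P: euler_complex n P r by (rule P)
interpretation Q: euler_complex n Q r by (rule Q)

lemma Field_union: "Field (P \<union> Q) = Field P \<union> Field Q"
  by (auto simp: Field_def)

lemma not_both: "(x, y) \<in> P \<Longrightarrow> x \<notin> Field Q \<and> y \<notin> Field Q" "(x, y) \<in> Q \<Longrightarrow> x \<notin> Field P \<and> y \<notin> Field P"
  using disjoint P.FieldD Q.FieldD by blast+

lemma union_iff:
  "x \<in> Field P \<or> y \<in> Field P \<Longrightarrow> (x, y) \<in> P \<union> Q \<longleftrightarrow> (x, y) \<in> P"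
  "x \<in> Field Q \<or> y \<in> Field Q \<Longrightarrow> (x, y) \<in> P \<union> Q \<longleftrightarrow> (x, y) \<in> Q"
  using not_both by blast+

lemma union_interval:
  "(x, y) \<in> P \<Longrightarrow> interval (P \<union> Q) x y = interval P x y"
  "(x, y) \<in> Q \<Longrightarrow> interval (P \<union> Q) x y = interval Q x y"
  using union_iff[of x] union_iff[of _ y] P.FieldD[of x y] Q.FieldD[of x y]
  unfolding interval_def by presburger+

lemma union_Image:
  "x \<in> Field P \<Longrightarrow> (P \<union> Q) `` {x} = P `` {x}"
  "x \<in> Field Q \<Longrightarrow> (P \<union> Q) `` {x} = Q `` {x}"
  "x \<in> Field P \<Longrightarrow> (P \<union> Q)\<inverse> `` {x} = P\<inverse> `` {x}"
  "x \<in> Field Q \<Longrightarrow> (P \<union> Q)\<inverse> `` {x} = Q\<inverse> `` {x}"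
  using not_both by blast+

text \<open>Each condition concerns an interval, an upper set or a lower set, and all of these lie
  in one component.\<close>

lemma union_complex: "euler_complex n (P \<union> Q) r"
proof
  show "finite (Field (P \<union> Q))" using P.finite_Field Q.finite_Field by (simp add: Field_union)
  show "Partial_order (P \<union> Q)"
  proof (rule Partial_orderI)
    fix x y assume xy: "(x, y) \<in> P \<union> Q"
    then show "(x, x) \<in> P \<union> Q \<and> (y, y) \<in> P \<union> Q"
      using P.P_refl Q.P_refl P.FieldD Q.FieldD by blast
    show "x = y" if "(y, x) \<in> P \<union> Q"
      using that xy P.P_antisym Q.P_antisym P.FieldD Q.FieldD not_both by blast
    show "(x, z) \<in> P \<union> Q" if "(y, z) \<in> P \<union> Q" for z
      using that xy P.P_trans[of x y z] Q.P_trans[of x y z] P.FieldD Q.FieldD not_both by blast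
  qed
  show "\<exists>z. (x, z) \<in> P \<union> Q \<and> (z, y) \<in> P \<union> Q \<and> r x < r z \<and> r z < r y"
    if "(x, y) \<in> P \<union> Q" "r x + 1 < r y" for x y
    using that P.gap[of x y] Q.gap[of x y] by blast
  show "\<exists>z. (z, y) \<in> P \<union> Q \<and> r z < r y" if "y \<in> Field (P \<union> Q)" "1 < r y" for y
    using that P.gap_below[of y] Q.gap_below[of y] unfolding Field_union by blast
  show "\<exists>z. (x, z) \<in> P \<union> Q \<and> r x < r z" if "x \<in> Field (P \<union> Q)" "r x < n" for x
    using that P.gap_above[of x] Q.gap_above[of x] unfolding Field_union by blast
qed (use P.nonempty P.rank_pos Q.rank_pos P.rank_le Q.rank_le P.rank_less Q.rank_less
      P.euler_interval Q.euler_interval P.euler_below Q.euler_below P.euler_above Q.euler_above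
      in \<open>auto simp: Field_union union_interval union_Image simp del: converse_Un Un_Image\<close>)

lemma union_euler_number: "euler_number (P \<union> Q) r = euler_number P r + euler_number Q r"
  unfolding euler_number_def Field_union
  by (rule sum.union_disjoint) (use P.finite_Field Q.finite_Field disjoint in auto)

lemma union_num_rank: "num_rank (P \<union> Q) r k = num_rank P r k + num_rank Q r k"
proof -
  have "{x\<in>Field (P \<union> Q). r x = k} = {x\<in>Field P. r x = k} \<union> {x\<in>Field Q. r x = k}"
    unfolding Field_union by auto
  then show ?thesis
    unfolding num_rank_def using P.finite_Field Q.finite_Field disjoint
    by (simp add: card_Un_disjoint disjoint_iff)
qed

lemma union_num_pairs: "num_pairs (P \<union> Q) r j k = num_pairs P r j k + num_pairs Q r j k"
proof -
  have "{(x, y)\<in>P \<union> Q. r x = j \<and> r y = k} =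
      {(x, y)\<in>P. r x = j \<and> r y = k} \<union> {(x, y)\<in>Q. r x = j \<and> r y = k}" by auto
  moreover have "{(x, y)\<in>P. r x = j \<and> r y = k} \<inter> {(x, y)\<in>Q. r x = j \<and> r y = k} = {}"
    using P.FieldD Q.FieldD disjoint by blast
  moreover have "finite {(x, y)\<in>P. r x = j \<and> r y = k}" "finite {(x, y)\<in>Q. r x = j \<and> r y = k}"
    by (auto intro: finite_subset[OF _ P.finite_P] finite_subset[OF _ Q.finite_P])
  ultimately show ?thesis
    unfolding num_pairs_def by (simp add: card_Un_disjoint)
qed

end

lemma map_shift_upt: "map (\<lambda>i. i + m) [a..<b] = [a + m..<b + m]"
  by (induction b) auto

context
  fixes m k :: nat and P Q :: "'a rel" and r q :: "'a \<Rightarrow> nat"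
  assumes P: "euler_complex m P r" and Q: "euler_complex k Q q"
    and disjoint: "Field P \<inter> Field Q = {}"
    and shift_all: "\<forall>y\<in>Field Q. r y = m + q y"
    and eP: "euler_number P r = sg m - 1" and eQ: "euler_number Q q = sg k - 1"
begin

interpretation P: euler_complex m P r by (rule P)
interpretation Q: euler_complex k Q q by (rule Q)

lemma shift: "y \<in> Field Q \<Longrightarrow> r y = m + q y"
  using shift_all by blast

definition osum :: "'a rel" where
  "osum = P \<union> Q \<union> Field P \<times> Field Q"

lemma Field_osum: "Field osum = Field P \<union> Field Q"
  by (auto simp: osum_def Field_def)

lemma osum_iff:
  "y \<in> Field P \<Longrightarrow> (x, y) \<in> osum \<longleftrightarrow> (x, y) \<in> P"
  "x \<in> Field Q \<Longrightarrow> (x, y) \<in> osum \<longleftrightarrow> (x, y) \<in> Q"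
  "x \<in> Field P \<Longrightarrow> y \<in> Field Q \<Longrightarrow> (x, y) \<in> osum"
  using disjoint P.FieldD Q.FieldD by (auto simp: osum_def)

lemma osum_cases:
  assumes "(x, y) \<in> osum"
  obtains "(x, y) \<in> P" "x \<in> Field P" "y \<in> Field P" | "(x, y) \<in> Q" "x \<in> Field Q" "y \<in> Field Q"
    | "x \<in> Field P" "y \<in> Field Q"
  using assms P.FieldD Q.FieldD by (auto simp: osum_def)

lemma osum_sets:
  "x \<in> Field P \<Longrightarrow> y \<in> Field P \<Longrightarrow> interval osum x y = interval P x y"
  "x \<in> Field Q \<Longrightarrow> y \<in> Field Q \<Longrightarrow> interval osum x y = interval Q x y"
  "x \<in> Field P \<Longrightarrow> y \<in> Field Q \<Longrightarrow> interval osum x y = P `` {x} \<union> Q\<inverse> `` {y}"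
  "x \<in> Field P \<Longrightarrow> osum `` {x} = P `` {x} \<union> Field Q"
  "x \<in> Field Q \<Longrightarrow> osum `` {x} = Q `` {x}"
  "x \<in> Field P \<Longrightarrow> osum\<inverse> `` {x} = P\<inverse> `` {x}"
  "x \<in> Field Q \<Longrightarrow> osum\<inverse> `` {x} = Field P \<union> Q\<inverse> `` {x}"
  using disjoint[unfolded disjoint_iff] P.FieldD Q.FieldD by (auto simp: osum_def interval_def)

lemma sum_sg_shift: "A \<subseteq> Field Q \<Longrightarrow> (\<Sum>z\<in>A. sg (r z)) = sg m * (\<Sum>z\<in>A. sg (q z))"
  unfolding sum_distrib_left by (intro sum.cong) (auto simp: shift power_add)

lemma sum_sg_union:
  assumes "A \<subseteq> Field P" "B \<subseteq> Field Q"
  shows "(\<Sum>z\<in>A \<union> B. sg (r z)) = (\<Sum>z\<in>A. sg (r z)) + sg m * (\<Sum>z\<in>B. sg (q z))"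
proof -
  have "finite A" "finite B" "A \<inter> B = {}"
    using assms disjoint P.finite_Field Q.finite_Field finite_subset by blast+
  then show ?thesis
    by (simp add: sum.union_disjoint sum_sg_shift[OF assms(2)])
qed

text \<open>In an interval from \<open>P\<close> to \<open>Q\<close> the upper set in
  \<open>P\<close> sums to \<open>sg m\<close> and the lower set in \<open>Q\<close> to
  \<open>- sg m\<close>. Below an element of \<open>Q\<close> all of \<open>P\<close> adds
  \<open>sg m - 1\<close>, and above an element of \<open>P\<close> all of \<open>Q\<close> adds
  \<open>sg m * (sg k - 1)\<close>; here the prescribed Euler numbers are used.\<close>

lemma osum_complex: "euler_complex (m + k) osum r"
proof
  show "finite (Field osum)" using P.finite_Field Q.finite_Field by (simp add: Field_osum)
  show "Partial_order osum"
  proof (rule Partial_orderI)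
    fix x y assume xy: "(x, y) \<in> osum"
    then show "(x, x) \<in> osum \<and> (y, y) \<in> osum"
      by (elim osum_cases) (auto simp: osum_def intro: P.P_refl Q.P_refl)
    show "x = y" if "(y, x) \<in> osum"
      using xy
    proof (cases rule: osum_cases)
      case 1
      then show ?thesis using that P.P_antisym[of x y] by (simp add: osum_iff)
    next
      case 2
      then show ?thesis using that Q.P_antisym[of x y] by (simp add: osum_iff)
    next
      case 3
      then show ?thesis using that P.FieldD[of y x] disjoint by (auto simp: osum_iff)
    qed
    show "(x, z) \<in> osum" if yz: "(y, z) \<in> osum" for z
      using xy
    proof (cases rule: osum_cases)
      case 1
      show ?thesis using yz
        by (cases rule: osum_cases) (use 1 disjoint P.P_trans[of x y z] in \<open>auto simp: osum_iff\<close>)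
    next
      case 2
      show ?thesis using yz
        by (cases rule: osum_cases) (use 2 disjoint Q.P_trans[of x y z] in \<open>auto simp: osum_iff\<close>)
    next
      case 3
      show ?thesis using yz
        by (cases rule: osum_cases) (use 3 disjoint in \<open>auto simp: osum_iff\<close>)
    qed
  qed
  show "osum \<noteq> {}" if "0 < m + k"
    using that P.nonempty Q.nonempty by (auto simp: osum_def)
  show "0 < r x" "r x \<le> m + k" if "x \<in> Field osum" for x
    using that P.rank_pos[of x] P.rank_le[of x] Q.rank_pos[of x] Q.rank_le[of x]
    by (auto simp: Field_osum shift)
  show "r x < r y" if "(x, y) \<in> osum" "x \<noteq> y" for x y
    using that(1)
    by (cases rule: osum_cases)
       (use that P.rank_less[of x y] Q.rank_less[of x y] P.rank_le[of x] Q.rank_pos[of y] in \<open>auto simp: shift\<close>)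
  show below: "\<exists>z. (z, y) \<in> osum \<and> r z < r y" if y: "y \<in> Field osum" "1 < r y" for y
  proof (cases "y \<in> Field P")
    case True
    then show ?thesis using P.gap_below[of y] y by (auto simp: osum_def)
  next
    case False
    then have yQ: "y \<in> Field Q" using y by (simp add: Field_osum)
    show ?thesis
    proof (cases "1 < q y")
      case True
      then obtain z where "(z, y) \<in> Q" "q z < q y"
        using Q.gap_below[of y] yQ by auto
      then show ?thesis
        using Q.FieldD[of z y] by (intro exI[of _ z]) (auto simp: osum_def shift)
    next
      case False
      then have "0 < m" using y yQ Q.rank_pos[of y] by (auto simp: shift)
      then obtain z where "z \<in> Field P" using P.nonempty by (auto simp: Field_def)
      then show ?thesis
        using P.rank_le[of z] yQ Q.rank_pos[of y] by (intro exI[of _ z]) (auto simp: osum_def shift)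
    qed
  qed
  show above: "\<exists>z. (x, z) \<in> osum \<and> r x < r z" if x: "x \<in> Field osum" "r x < m + k" for x
  proof (cases "x \<in> Field Q")
    case True
    then have "q x < k" using x by (simp add: shift)
    then obtain z where "(x, z) \<in> Q" "q x < q z"
      using Q.gap_above[of x] True by auto
    then show ?thesis
      using Q.FieldD[of x z] by (intro exI[of _ z]) (auto simp: osum_def shift)
  next
    case False
    then have xP: "x \<in> Field P" using x by (simp add: Field_osum)
    show ?thesis
    proof (cases "r x < m")
      case True
      then show ?thesis using P.gap_above[of x] xP by (auto simp: osum_def)
    next
      case False
      then have "0 < k" using x by simp
      then obtain z where "z \<in> Field Q" using Q.nonempty by (auto simp: Field_def)
      then show ?thesis
        using P.rank_le[of x] xP Q.rank_pos[of z] by (intro exI[of _ z]) (auto simp: osum_def shift)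
    qed
  qed
  show "\<exists>z. (x, z) \<in> osum \<and> (z, y) \<in> osum \<and> r x < r z \<and> r z < r y"
    if xy: "(x, y) \<in> osum" "r x + 1 < r y" for x y
    using xy(1)
  proof (cases rule: osum_cases)
    case 1
    then show ?thesis using P.gap[of x y] xy(2) by (auto simp: osum_def)
  next
    case 2
    then obtain z where "(x, z) \<in> Q" "(z, y) \<in> Q" "q x < q z" "q z < q y"
      using Q.gap[of x y] xy(2) by (auto simp: shift)
    then show ?thesis
      using Q.FieldD[of x z] Q.FieldD[of z y] by (intro exI[of _ z]) (auto simp: osum_def shift)
  next
    case 3
    show ?thesis
    proof (cases "r x < m")
      case True
      then obtain z where z: "(x, z) \<in> P" "r x < r z" using P.gap_above[of x] 3 by auto
      then have "z \<in> Field P" "r z \<le> m" using P.FieldD P.rank_le by blast+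
      then show ?thesis
        using z 3 Q.rank_pos[of y] by (intro exI[of _ z]) (auto simp: osum_def shift)
    next
      case False
      then have "r x = m" "1 < q y"
        using 3 P.rank_le[of x] xy(2) by (auto simp: shift)
      then obtain z where z: "(z, y) \<in> Q" "q z < q y" using Q.gap_below[of y] 3 by auto
      then have "z \<in> Field Q" "0 < q z" using Q.FieldD Q.rank_pos by blast+
      then show ?thesis
        using z 3 \<open>r x = m\<close> by (intro exI[of _ z]) (auto simp: osum_def shift)
    qed
  qed
  show "(\<Sum>z\<in>interval osum x y. sg (r z)) = 0" if xy: "(x, y) \<in> osum" "x \<noteq> y" for x y
    using xy(1)
  proof (cases rule: osum_cases)
    case 1
    then show ?thesis using P.euler_interval xy(2) by (simp add: osum_sets)
  next
    case 2
    then show ?thesis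
      using Q.euler_interval xy(2) sum_sg_shift[OF Q.interval_subset(1)] by (simp add: osum_sets)
  next
    case 3
    then show ?thesis
      using sum_sg_union[OF P.interval_subset(2) Q.interval_subset(3)] P.euler_above Q.euler_below
      by (simp add: osum_sets)
  qed
  show "(\<Sum>z\<in>osum\<inverse> `` {y}. sg (r z)) = - 1" if "y \<in> Field osum" for y
  proof (cases "y \<in> Field P")
    case True
    then show ?thesis using P.euler_below by (simp only: osum_sets)
  next
    case False
    then have "y \<in> Field Q" using that by (simp add: Field_osum)
    then show ?thesis
      using sum_sg_union[OF subset_refl Q.interval_subset(3)] Q.euler_below eP
      by (simp only: osum_sets) (simp add: euler_number_def)
  qed
  show "(\<Sum>z\<in>osum `` {x}. sg (r z)) = sg (m + k)" if "x \<in> Field osum" for x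
  proof (cases "x \<in> Field Q")
    case True
    then show ?thesis
      using Q.euler_above sum_sg_shift[OF Q.interval_subset(2)] by (simp add: osum_sets power_add)
  next
    case False
    then have "x \<in> Field P" using that by (simp add: Field_osum)
    moreover have "(\<Sum>x\<in>Field Q. sg (q x)) = sg k - 1"
      using eQ by (simp only: euler_number_def)
    ultimately show ?thesis
      using sum_sg_union[OF P.interval_subset(2) subset_refl] P.euler_above
      by (simp add: osum_sets power_add right_diff_distrib)
  qed
qed

lemma osum_euler_number: "euler_number osum r = sg (m + k) - 1"
proof -
  have "(\<Sum>x\<in>Field P. sg (r x)) = sg m - 1" "(\<Sum>x\<in>Field Q. sg (q x)) = sg k - 1"
    using eP eQ by (simp_all only: euler_number_def)
  then show ?thesis
    by (simp add: euler_number_def Field_osum sum_sg_union power_add right_diff_distrib)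
qed

lemma osum_num_rank_bot: "0 < j \<Longrightarrow> j \<le> m \<Longrightarrow> num_rank osum r j = num_rank P r j"
proof -
  assume "0 < j" "j \<le> m"
  then have "{x\<in>Field osum. r x = j} = {x\<in>Field P. r x = j}"
    using Q.rank_pos by (fastforce simp: Field_osum shift)
  then show ?thesis by (simp add: num_rank_def)
qed

lemma osum_num_rank_top: "0 < j \<Longrightarrow> num_rank osum r (m + j) = num_rank Q q j"
proof -
  assume "0 < j"
  then have "{x\<in>Field osum. r x = m + j} = {x\<in>Field Q. q x = j}"
    using P.rank_le by (fastforce simp: Field_osum shift)
  then show ?thesis by (simp add: num_rank_def)
qed

lemma osum_num_pairs:
  assumes "0 < m" "0 < k"
  shows "num_pairs osum r 1 (m + k) = num_rank P r 1 * num_rank Q q k"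
proof -
  have "{(x, y)\<in>osum. r x = 1 \<and> r y = m + k} = {x\<in>Field P. r x = 1} \<times> {y\<in>Field Q. q y = k}"
  proof (intro set_eqI iffI; clarify)
    fix x y assume xy: "(x, y) \<in> osum" "r x = 1" "r y = m + k"
    have "x \<notin> Field Q" using xy(2) assms Q.rank_pos[of x] by (auto simp: shift)
    moreover have "y \<notin> Field P" using xy(3) assms P.rank_le[of y] by auto
    ultimately show "x \<in> {x\<in>Field P. r x = 1} \<and> y \<in> {y\<in>Field Q. q y = k}"
      using xy by (elim osum_cases) (auto simp: shift)
  qed (auto simp: osum_iff shift)
  then show ?thesis
    by (simp add: num_pairs_def num_rank_def card_cartesian_product)
qed

lemma Chains_osum: "bij_betw (\<lambda>(C, D). C \<union> D) (Chains P \<times> Chains Q) (Chains osum)"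
proof (rule bij_betw_byWitness[where f' = "\<lambda>E. (E \<inter> Field P, E \<inter> Field Q)"])
  show "\<forall>p\<in>Chains P \<times> Chains Q.
      ((case p of (C, D) \<Rightarrow> C \<union> D) \<inter> Field P, (case p of (C, D) \<Rightarrow> C \<union> D) \<inter> Field Q) = p"
    using disjoint Chains_Field by fastforce
  show "\<forall>E\<in>Chains osum. (case (E \<inter> Field P, E \<inter> Field Q) of (C, D) \<Rightarrow> C \<union> D) = E"
    using Chains_Field Field_osum by fastforce
  show "(\<lambda>(C, D). C \<union> D) ` (Chains P \<times> Chains Q) \<subseteq> Chains osum"
  proof clarify
    fix C D assume "C \<in> Chains P" "D \<in> Chains Q"
    then show "C \<union> D \<in> Chains osum"
      using Chains_Field[of C P] Chains_Field[of D Q] unfolding Chains_def osum_def by blast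
  qed
  show "(\<lambda>E. (E \<inter> Field P, E \<inter> Field Q)) ` Chains osum \<subseteq> Chains P \<times> Chains Q"
    using osum_iff(1,2) unfolding Chains_def by blast
qed

text \<open>A chain is a pair of chains, and its word splits after position \<open>m\<close>. So
  ab-indices multiply, and cd-indices with them.\<close>

lemma osum_flag_poly: "flag_poly (m + k) osum r = flag_poly m P r * flag_poly k Q q"
proof -
  let ?W = "\<lambda>n A. prod_list (map (\<lambda>i. if i \<in> A then var_b else var_a - var_b) [1..<n + 1])"
  have W: "?W (m + k) (r ` (C \<union> D)) = ?W m (r ` C) * ?W k (q ` D)"
    if C: "C \<in> Chains P" and D: "D \<in> Chains Q" for C D
  proof -
    have "[1..<m + k + 1] = [1..<m + 1] @ map (\<lambda>i. i + m) [1..<k + 1]"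
      unfolding map_shift_upt using upt_add_eq_append[of 1 "m + 1" k] by (simp add: add_ac)
    moreover have "map (\<lambda>i. if i \<in> r ` (C \<union> D) then var_b else var_a - var_b) [1..<m + 1] =
        map (\<lambda>i. if i \<in> r ` C then var_b else var_a - var_b) [1..<m + 1]"
    proof (intro map_cong refl)
      fix i assume "i \<in> set [1..<m + 1]"
      then have "i \<le> m" by auto
      then have "i \<in> r ` (C \<union> D) \<longleftrightarrow> i \<in> r ` C"
        using Chains_Field[OF D] Q.rank_pos shift by fastforce
      then show "(if i \<in> r ` (C \<union> D) then var_b else var_a - var_b) =
          (if i \<in> r ` C then var_b else var_a - var_b)" by (simp only:)
    qed
    moreover have "map (\<lambda>i. if i \<in> r ` (C \<union> D) then var_b else var_a - var_b) (map (\<lambda>i. i + m) [1..<k + 1]) =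
        map (\<lambda>i. if i \<in> q ` D then var_b else var_a - var_b) [1..<k + 1]"
      unfolding map_map o_def
    proof (intro map_cong refl)
      fix i assume "i \<in> set [1..<k + 1]"
      then have "1 \<le> i" by auto
      then have "i + m \<notin> r ` C" using Chains_Field[OF C] P.rank_le by fastforce
      moreover have rD: "r ` D = (\<lambda>j. j + m) ` q ` D"
        using Chains_Field[OF D] shift by (force simp: image_image add.commute)
      have "i + m \<in> r ` D \<longleftrightarrow> i \<in> q ` D" unfolding rD by auto
      ultimately have "i + m \<in> r ` (C \<union> D) \<longleftrightarrow> i \<in> q ` D" by (simp only: image_Un Un_iff simp_thms)
      then show "(if i + m \<in> r ` (C \<union> D) then var_b else var_a - var_b) =
          (if i \<in> q ` D then var_b else var_a - var_b)" by (simp only:)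
    qed
    ultimately show ?thesis by (simp only: map_append prod_list.append)
  qed
  have "flag_poly (m + k) osum r = (\<Sum>(C, D)\<in>Chains P \<times> Chains Q. ?W (m + k) (r ` (C \<union> D)))"
    unfolding flag_poly_def sum.reindex_bij_betw[OF Chains_osum, symmetric] by (simp add: case_prod_beta)
  also have "\<dots> = (\<Sum>(C, D)\<in>Chains P \<times> Chains Q. ?W m (r ` C) * ?W k (q ` D))"
    by (intro sum.cong refl) (use W in auto)
  finally show ?thesis
    by (simp add: flag_poly_def sum_product sum.cartesian_product)
qed

end

subsection \<open>Products collapsed at the top\<close>

text \<open>The product of \<open>A\<close> with the elements of \<open>L\<close> of rank below \<open>k\<close>, together with the elements
  \<open>(None, z)\<close> for the maximal \<open>z\<close> of \<open>L\<close>, above which \<open>A\<close> has been contracted to a point.\<close>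

context
  fixes m k :: nat and A :: "'a rel" and L :: "'b rel" and a :: "'a \<Rightarrow> nat" and l :: "'b \<Rightarrow> nat"
  assumes A: "euler_complex m A a" and L: "euler_complex k L l"
    and m: "1 \<le> m" and k: "2 \<le> k"
    and sgn: "sg (m + k - 1) = - 1 - euler_number A a * (1 + sg k)"
begin

interpretation A: euler_complex m A a by (rule A)
interpretation L: euler_complex k L l by (rule L)

definition cprod :: "('a option \<times> 'b) rel" where
  "cprod = {((Some p, x), (Some q, y)) |p q x y. (p, q) \<in> A \<and> (x, y) \<in> L \<and> l y < k}
    \<union> {((Some p, x), (None, z)) |p x z. p \<in> Field A \<and> (x, z) \<in> L \<and> l x < k \<and> l z = k}
    \<union> {((None, z), (None, z)) |z. z \<in> Field L \<and> l z = k}"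

text \<open>Dimensions add in a product and ranks exceed them by one, whence the \<open>- 1\<close>.
  A contracted element keeps the rank that a product of top elements would have.\<close>

definition crank :: "'a option \<times> 'b \<Rightarrow> nat" where
  "crank = (\<lambda>(u, x). case u of Some p \<Rightarrow> a p + l x - 1 | None \<Rightarrow> m + k - 1)"

lemma cprod_iff [simp]:
  "((Some p, x), (Some q, y)) \<in> cprod \<longleftrightarrow> (p, q) \<in> A \<and> (x, y) \<in> L \<and> l y < k"
  "((Some p, x), (None, z)) \<in> cprod \<longleftrightarrow> p \<in> Field A \<and> (x, z) \<in> L \<and> l x < k \<and> l z = k"
  "((None, z), (Some p, x)) \<notin> cprod"
  "((None, z), (None, z')) \<in> cprod \<longleftrightarrow> z' = z \<and> z \<in> Field L \<and> l z = k"
  by (auto simp: cprod_def)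

lemma crank_simps [simp]: "crank (Some p, x) = a p + l x - 1" "crank (None, x) = m + k - 1"
  by (simp_all add: crank_def)

lemma Field_cprod:
  "Field cprod = map_prod Some id ` (Field A \<times> {x\<in>Field L. l x < k}) \<union> Pair None ` {z\<in>Field L. l z = k}"
proof (intro set_eqI)
  fix t :: "'a option \<times> 'b"
  obtain u x where t: "t = (u, x)" by (cases t)
  show "t \<in> Field cprod \<longleftrightarrow> t \<in> map_prod Some id ` (Field A \<times> {x\<in>Field L. l x < k}) \<union> Pair None ` {z\<in>Field L. l z = k}"
  proof (cases u)
    case None
    have "t \<in> Field cprod \<longleftrightarrow> x \<in> Field L \<and> l x = k"
    proof
      assume "t \<in> Field cprod"
      then obtain w where "(t, w) \<in> cprod \<or> (w, t) \<in> cprod" by (auto simp: Field_def)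
      then show "x \<in> Field L \<and> l x = k"
        unfolding t None using L.FieldD by (cases w; cases "fst w") auto
    next
      assume "x \<in> Field L \<and> l x = k"
      then have "(t, t) \<in> cprod" unfolding t None by simp
      then show "t \<in> Field cprod" by (rule FieldI1)
    qed
    then show ?thesis unfolding t None by auto
  next
    case (Some p)
    have "t \<in> Field cprod \<longleftrightarrow> p \<in> Field A \<and> x \<in> Field L \<and> l x < k"
    proof
      assume "t \<in> Field cprod"
      then obtain w where "(t, w) \<in> cprod \<or> (w, t) \<in> cprod" by (auto simp: Field_def)
      then show "p \<in> Field A \<and> x \<in> Field L \<and> l x < k"
        unfolding t Some using A.FieldD L.FieldD
        by (cases w; cases "fst w") (auto intro: le_less_trans[OF L.rank_mono])
    next
      assume "p \<in> Field A \<and> x \<in> Field L \<and> l x < k"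
      then have "(t, t) \<in> cprod" unfolding t Some using A.P_refl L.P_refl by simp
      then show "t \<in> Field cprod" by (rule FieldI1)
    qed
    then show ?thesis unfolding t Some by force
  qed
qed

lemma Field_cprod_iff [simp]:
  "(Some p, x) \<in> Field cprod \<longleftrightarrow> p \<in> Field A \<and> x \<in> Field L \<and> l x < k"
  "(None, z) \<in> Field cprod \<longleftrightarrow> z \<in> Field L \<and> l z = k"
  unfolding Field_cprod by force+

lemma sg_crank: "p \<in> Field A \<Longrightarrow> x \<in> Field L \<Longrightarrow> sg (crank (Some p, x)) = - (sg (a p) * sg (l x))"
  using A.rank_pos[of p] L.rank_pos[of x] by (auto simp: minus_one_power_iff)

lemma sum_sg_cprod:
  assumes "X \<subseteq> Field A" "Y \<subseteq> Field L" "Z \<subseteq> Field L"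
  shows "(\<Sum>t\<in>map_prod Some id ` (X \<times> Y) \<union> Pair None ` Z. sg (crank t)) =
    - ((\<Sum>p\<in>X. sg (a p)) * (\<Sum>x\<in>Y. sg (l x))) + int (card Z) * sg (m + k - 1)"
proof -
  have fin: "finite X" "finite Y" "finite Z"
    using assms A.finite_Field L.finite_Field finite_subset by blast+
  have inj: "inj_on (map_prod Some id) (X \<times> Y)" "inj_on (Pair None) Z"
    by (auto simp: inj_on_def)
  have "(\<Sum>t\<in>map_prod Some id ` (X \<times> Y). sg (crank t)) = (\<Sum>(p, x)\<in>X \<times> Y. - (sg (a p) * sg (l x)))"
    unfolding sum.reindex[OF inj(1)]
    by (intro sum.cong refl)
       (auto simp del: crank_simps simp: sg_crank[OF subsetD[OF assms(1)] subsetD[OF assms(2)]])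
  also have "\<dots> = - ((\<Sum>p\<in>X. sg (a p)) * (\<Sum>x\<in>Y. sg (l x)))"
    by (simp add: sum_product sum.cartesian_product sum_negf case_prod_beta)
  finally have 1: "(\<Sum>t\<in>map_prod Some id ` (X \<times> Y). sg (crank t)) =
    - ((\<Sum>p\<in>X. sg (a p)) * (\<Sum>x\<in>Y. sg (l x)))" .
  have "(\<Sum>t\<in>Pair None ` Z. sg (crank t)) = int (card Z) * sg (m + k - 1)"
    unfolding sum.reindex[OF inj(2)] by simp
  moreover have "map_prod Some id ` (X \<times> Y) \<inter> Pair None ` Z = {}" by auto
  ultimately show ?thesis
    using 1 fin by (simp add: sum.union_disjoint del: crank_simps)
qed

lemma L_top: "(x, z) \<in> L \<Longrightarrow> l z = k \<Longrightarrow> interval L x z \<inter> {y. l y < k} = interval L x z - {z}"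
  "z \<in> Field L \<Longrightarrow> l z = k \<Longrightarrow> L\<inverse> `` {z} \<inter> {y. l y < k} = L\<inverse> `` {z} - {z}"
  using L.rank_eq_imp_eq L.rank_mono L.FieldD L.P_refl
  by (auto simp: interval_def less_le)

text \<open>Every set is brought into the shape required by \<open>sum_sg_cprod\<close>, a product
  together with a set of contracted elements, even where one part is empty.\<close>

lemma cprod_sets:
  "l y < k \<Longrightarrow> interval cprod (Some p, x) (Some q, y) =
     map_prod Some id ` (interval A p q \<times> interval L x y) \<union> Pair None ` {}"
  "p \<in> Field A \<Longrightarrow> (x, z) \<in> L \<Longrightarrow> l x < k \<Longrightarrow> l z = k \<Longrightarrow>
     interval cprod (Some p, x) (None, z) =
     map_prod Some id ` (A `` {p} \<times> (interval L x z \<inter> {y. l y < k})) \<union> Pair None ` {z}"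
  "l y < k \<Longrightarrow> cprod\<inverse> `` {(Some q, y)} = map_prod Some id ` (A\<inverse> `` {q} \<times> L\<inverse> `` {y}) \<union> Pair None ` {}"
  "z \<in> Field L \<Longrightarrow> l z = k \<Longrightarrow> cprod\<inverse> `` {(None, z)} =
     map_prod Some id ` (Field A \<times> (L\<inverse> `` {z} \<inter> {y. l y < k})) \<union> Pair None ` {z}"
  "p \<in> Field A \<Longrightarrow> l x < k \<Longrightarrow> cprod `` {(Some p, x)} =
     map_prod Some id ` (A `` {p} \<times> (L `` {x} \<inter> {y. l y < k})) \<union> Pair None ` {z\<in>L `` {x}. l z = k}"
  "z \<in> Field L \<Longrightarrow> l z = k \<Longrightarrow> cprod `` {(None, z)} = map_prod Some id ` ({} \<times> {}) \<union> Pair None ` {z}"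
proof -
  have ext: "S = T" if "\<And>p x. (Some p, x) \<in> S \<longleftrightarrow> (Some p, x) \<in> T" "\<And>x. (None, x) \<in> S \<longleftrightarrow> (None, x) \<in> T"
    for S T :: "('a option \<times> 'b) set"
    using that by (intro set_eqI) (metis not_None_eq prod.exhaust)
  have mem: "(Some p, x) \<in> map_prod Some id ` (X \<times> Y) \<union> Pair None ` Z \<longleftrightarrow> p \<in> X \<and> x \<in> Y"
    "(None, x) \<in> map_prod Some id ` (X \<times> Y) \<union> Pair None ` Z \<longleftrightarrow> x \<in> Z"
    for p x and X :: "'a set" and Y Z :: "'b set" by force+
  note FD = A.FieldD L.FieldD
  show "interval cprod (Some p, x) (Some q, y) =
     map_prod Some id ` (interval A p q \<times> interval L x y) \<union> Pair None ` {}" if "l y < k"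
    by (rule ext; unfold mem) (use that L.rank_mono in \<open>auto simp: interval_def intro: le_less_trans\<close>)
  show "interval cprod (Some p, x) (None, z) =
     map_prod Some id ` (A `` {p} \<times> (interval L x z \<inter> {y. l y < k})) \<union> Pair None ` {z}"
    if "p \<in> Field A" "(x, z) \<in> L" "l x < k" "l z = k"
    by (rule ext; unfold mem) (use that FD in \<open>auto simp: interval_def\<close>)
  show "cprod\<inverse> `` {(Some q, y)} = map_prod Some id ` (A\<inverse> `` {q} \<times> L\<inverse> `` {y}) \<union> Pair None ` {}" if "l y < k"
    by (rule ext; unfold mem) (use that in auto)
  show "cprod\<inverse> `` {(None, z)} =
     map_prod Some id ` (Field A \<times> (L\<inverse> `` {z} \<inter> {y. l y < k})) \<union> Pair None ` {z}" if "z \<in> Field L" "l z = k"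
    by (rule ext; unfold mem) (use that in auto)
  show "cprod `` {(Some p, x)} =
     map_prod Some id ` (A `` {p} \<times> (L `` {x} \<inter> {y. l y < k})) \<union> Pair None ` {z\<in>L `` {x}. l z = k}"
    if "p \<in> Field A" "l x < k"
    by (rule ext; unfold mem) (use that in auto)
  show "cprod `` {(None, z)} = map_prod Some id ` ({} \<times> {}) \<union> Pair None ` {z}" if "z \<in> Field L" "l z = k"
    by (rule ext; unfold mem) (use that in auto)
qed

lemma sum_L_top:
  "(x, z) \<in> L \<Longrightarrow> x \<noteq> z \<Longrightarrow> l z = k \<Longrightarrow> (\<Sum>y\<in>interval L x z \<inter> {y. l y < k}. sg (l y)) = - sg k"
  "z \<in> Field L \<Longrightarrow> l z = k \<Longrightarrow> (\<Sum>y\<in>L\<inverse> `` {z} \<inter> {y. l y < k}. sg (l y)) = - 1 - sg k"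
  "x \<in> Field L \<Longrightarrow> (\<Sum>y\<in>L `` {x} \<inter> {y. l y < k}. sg (l y)) =
     sg k - int (card {z\<in>L `` {x}. l z = k}) * sg k"
  "(\<Sum>y\<in>Field L \<inter> {y. l y < k}. sg (l y)) = euler_number L l - int (num_rank L l k) * sg k"
proof -
  have split: "(\<Sum>y\<in>S \<inter> {y. l y < k}. sg (l y)) = (\<Sum>y\<in>S. sg (l y)) - int (card {z\<in>S. l z = k}) * sg k"
    if S: "S \<subseteq> Field L" for S
  proof -
    have fin: "finite S" using S L.finite_Field finite_subset by blast
    have "S = (S \<inter> {y. l y < k}) \<union> {z\<in>S. l z = k}"
      using S L.rank_le by (auto simp: le_less)
    then have "(\<Sum>y\<in>S. sg (l y)) = (\<Sum>y\<in>(S \<inter> {y. l y < k}) \<union> {z\<in>S. l z = k}. sg (l y))" by simp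
    also have "\<dots> = (\<Sum>y\<in>S \<inter> {y. l y < k}. sg (l y)) + (\<Sum>y\<in>{z\<in>S. l z = k}. sg (l y))"
      by (rule sum.union_disjoint) (use fin in auto)
    finally show ?thesis by simp
  qed
  show "(\<Sum>y\<in>L `` {x} \<inter> {y. l y < k}. sg (l y)) = sg k - int (card {z\<in>L `` {x}. l z = k}) * sg k"
    if "x \<in> Field L"
    using split[OF L.interval_subset(2)] L.euler_above[OF that] by simp
  show "(\<Sum>y\<in>Field L \<inter> {y. l y < k}. sg (l y)) = euler_number L l - int (num_rank L l k) * sg k"
    using split[OF subset_refl] by (simp add: euler_number_def num_rank_def)
  show "(\<Sum>y\<in>interval L x z \<inter> {y. l y < k}. sg (l y)) = - sg k" if "(x, z) \<in> L" "x \<noteq> z" "l z = k"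
  proof -
    have "z \<in> interval L x z"
      using that L.P_refl[OF L.FieldD(2)[OF that(1)]] by (simp add: interval_def)
    then show ?thesis
      using that L.euler_interval[OF that(1,2)] by (simp add: L_top sum_diff1)
  qed
  show "(\<Sum>y\<in>L\<inverse> `` {z} \<inter> {y. l y < k}. sg (l y)) = - 1 - sg k" if "z \<in> Field L" "l z = k"
    using that L.euler_below[OF that(1)] L.P_refl[OF that(1)]
    by (simp add: L_top sum_diff1)
qed

lemma sg_top: "sg (m + k - 1) = - (sg m * sg k)"
  using m by (auto simp: minus_one_power_iff)

lemma option_pair_cases:
  obtains p x where "t = (Some p, x)" | z where "t = (None, z)"
  by (cases t; cases "fst t") auto

text \<open>Below \<open>(None, z)\<close> lie the product of \<open>Field A\<close> with the proper
  lower part of \<open>z\<close> and the point itself; the assumption on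
  \<open>sg (m + k - 1)\<close> is exactly the Euler condition there. Above
  \<open>(Some p, x)\<close> each maximal \<open>z\<close> contributes
  \<open>sg m * sg k + sg (m + k - 1) = 0\<close>, so their number cancels.\<close>

lemma cprod_complex: "euler_complex (m + k - 1) cprod crank"
proof
  show "finite (Field cprod)"
    using A.finite_Field L.finite_Field by (simp add: Field_cprod)
  show "Partial_order cprod"
  proof (rule Partial_orderI)
    fix s t assume st: "(s, t) \<in> cprod"
    then show "(s, s) \<in> cprod \<and> (t, t) \<in> cprod"
      by (cases s rule: option_pair_cases; cases t rule: option_pair_cases)
         (simp_all, (blast intro: A.P_refl L.P_refl A.FieldD L.FieldD le_less_trans[OF L.rank_mono])+)
    show "s = t" if "(t, s) \<in> cprod"
      using st that
      by (cases s rule: option_pair_cases; cases t rule: option_pair_cases)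
         (simp_all, blast intro: A.P_antisym L.P_antisym)
    show "(s, u) \<in> cprod" if "(t, u) \<in> cprod" for u
      using st that
      by (cases s rule: option_pair_cases; cases t rule: option_pair_cases;
          cases u rule: option_pair_cases)
         (simp_all, (blast intro: A.P_trans L.P_trans A.FieldD L.FieldD le_less_trans[OF L.rank_mono])+)
  qed
  obtain p0 where p0: "p0 \<in> Field A" using A.nonempty m by (auto simp: Field_def)
  show "cprod \<noteq> {}"
  proof -
    obtain x where x: "x \<in> Field L" using L.nonempty k by (auto simp: Field_def)
    have "(if l x < k then (Some p0, x) else (None, x)) \<in> Field cprod"
      using x p0 L.rank_le[of x] by auto
    then show ?thesis by (auto simp: Field_def)
  qed
  show "0 < crank t" "crank t \<le> m + k - 1" if "t \<in> Field cprod" for t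
    using that m k A.rank_pos A.rank_le L.rank_pos
    by (cases t rule: option_pair_cases; fastforce)+
  show "crank s < crank t" if "(s, t) \<in> cprod" "s \<noteq> t" for s t
  proof (cases s rule: option_pair_cases)
    case (1 p x)
    show ?thesis
    proof (cases t rule: option_pair_cases)
      case t: (1 q y)
      then have *: "(p, q) \<in> A" "(x, y) \<in> L" "p \<noteq> q \<or> x \<noteq> y" using that 1 by auto
      then show ?thesis
        using A.rank_mono[of p q] L.rank_mono[of x y] A.rank_less[of p q] L.rank_less[of x y]
          A.rank_pos[of p] A.FieldD[of p q] 1 t by (cases "p = q") auto
    next
      case (2 z)
      then show ?thesis
        using 1 that A.rank_le[of p] A.rank_pos[of p] by auto
    qed
  next
    case (2 z)
    then show ?thesis using that by (cases t rule: option_pair_cases) auto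
  qed
  show "\<exists>w. (s, w) \<in> cprod \<and> (w, t) \<in> cprod \<and> crank s < crank w \<and> crank w < crank t"
    if st: "(s, t) \<in> cprod" "crank s + 1 < crank t" for s t
  proof (cases s rule: option_pair_cases)
    case s: (1 p x)
    show ?thesis
    proof (cases t rule: option_pair_cases)
      case t: (1 q y)
      then have *: "(p, q) \<in> A" "(x, y) \<in> L" "l y < k" using st s by auto
      note F = A.FieldD[OF *(1)] L.FieldD[OF *(2)]
      have pos: "0 < a p" "0 < a q" "0 < l x" "0 < l y" "l x < k" "a p \<le> a q" "l x \<le> l y"
        using A.rank_pos L.rank_pos F *(3) L.rank_mono[OF *(2)] A.rank_mono[OF *(1)] by auto
      show ?thesis
      proof (cases "p = q")
        case True
        then have "a p = a q" by simp
        then have "l x + 1 < l y" using st(2) pos unfolding s t crank_simps by linarith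
        then obtain z where "(x, z) \<in> L" "(z, y) \<in> L" "l x < l z" "l z < l y"
          using L.gap[OF *(2)] by auto
        then show ?thesis
          using s t True A.P_refl F pos *(3) by (intro exI[of _ "(Some p, z)"]) auto
      next
        case False
        show ?thesis
        proof (cases "x = y")
          case True
          then have "l x = l y" by simp
          then have "a p + 1 < a q" using st(2) pos unfolding s t crank_simps by linarith
          then obtain r where "(p, r) \<in> A" "(r, q) \<in> A" "a p < a r" "a r < a q"
            using A.gap[OF *(1)] by auto
          then show ?thesis
            using s t \<open>x = y\<close> L.P_refl F pos by (intro exI[of _ "(Some r, x)"]) auto
        next
          case xy: False
          \<comment> \<open>When both coordinates increase, raising only the first gives an
            intermediate element.\<close>
          have "a p < a q" "l x < l y"
            using A.rank_less[OF *(1) False] L.rank_less[OF *(2) xy] by auto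
          then show ?thesis
            using s t * A.P_refl L.P_refl F pos by (intro exI[of _ "(Some q, x)"]) auto
        qed
      qed
    next
      case t: (2 z)
      then have *: "p \<in> Field A" "(x, z) \<in> L" "l x < k" "l z = k" using st s by auto
      note F = L.FieldD[OF *(2)]
      have pos: "0 < a p" "0 < l x" using A.rank_pos L.rank_pos F * by auto
      show ?thesis
      proof (cases "a p < m")
        case True
        then obtain q where "(p, q) \<in> A" "a p < a q" using A.gap_above[OF *(1)] by auto
        then show ?thesis
          using s t * pos A.FieldD[of p q] A.rank_le[of q] L.P_refl[OF F(1)]
          by (intro exI[of _ "(Some q, x)"]) auto
      next
        case False
        then have "a p = m" using A.rank_le[OF *(1)] by simp
        then have "l x + 1 < l z" using st(2) pos *(4) unfolding s t crank_simps by linarith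
        then obtain y where "(x, y) \<in> L" "(y, z) \<in> L" "l x < l y" "l y < l z"
          using L.gap[OF *(2)] by auto
        then show ?thesis
          using s t * pos \<open>a p = m\<close> A.P_refl[OF *(1)] by (intro exI[of _ "(Some p, y)"]) auto
      qed
    qed
  next
    case (2 z)
    then show ?thesis using st by (cases t rule: option_pair_cases) auto
  qed
  show "\<exists>w. (w, t) \<in> cprod \<and> crank w < crank t" if t: "t \<in> Field cprod" "1 < crank t" for t
  proof (cases t rule: option_pair_cases)
    case (1 q y)
    then have *: "q \<in> Field A" "y \<in> Field L" "l y < k" using t by auto
    have pos: "0 < a q" "0 < l y" using * A.rank_pos L.rank_pos by auto
    show ?thesis
    proof (cases "1 < a q")
      case True
      then obtain p where "(p, q) \<in> A" "a p < a q" using A.gap_below[OF *(1)] by auto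
      then show ?thesis
        using 1 * pos L.P_refl by (intro exI[of _ "(Some p, y)"]) auto
    next
      case False
      then have "1 < l y" using t 1 pos by auto
      then obtain x where "(x, y) \<in> L" "l x < l y" using L.gap_below[OF *(2)] by auto
      then show ?thesis
        using 1 * pos A.P_refl by (intro exI[of _ "(Some q, x)"]) auto
    qed
  next
    case (2 z)
    then have *: "z \<in> Field L" "l z = k" using t by auto
    then obtain y where "(y, z) \<in> L" "l y < k" using L.gap_below[of z] k by auto
    then show ?thesis
      using 2 * p0 A.rank_le[OF p0] A.rank_pos[OF p0] by (intro exI[of _ "(Some p0, y)"]) auto
  qed
  show "\<exists>w. (t, w) \<in> cprod \<and> crank t < crank w" if t: "t \<in> Field cprod" "crank t < m + k - 1" for t
  proof (cases t rule: option_pair_cases)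
    case (1 p x)
    then have *: "p \<in> Field A" "x \<in> Field L" "l x < k" using t by auto
    have pos: "0 < a p" "0 < l x" using * A.rank_pos L.rank_pos by auto
    obtain y where y: "(x, y) \<in> L" "l x < l y" using L.gap_above[OF *(2)] * by auto
    show ?thesis
    proof (cases "l y = k")
      case True
      then show ?thesis
        using 1 * y pos A.rank_le[OF *(1)] by (intro exI[of _ "(None, y)"]) auto
    next
      case False
      then have "l y < k" using L.rank_le[OF L.FieldD(2)[OF y(1)]] by simp
      then show ?thesis
        using 1 * y pos A.P_refl by (intro exI[of _ "(Some p, y)"]) auto
    qed
  qed (use t in simp)
  show "(\<Sum>w\<in>interval cprod s t. sg (crank w)) = 0" if st: "(s, t) \<in> cprod" "s \<noteq> t" for s t
  proof (cases s rule: option_pair_cases)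
    case s: (1 p x)
    show ?thesis
    proof (cases t rule: option_pair_cases)
      case t: (1 q y)
      then have *: "(p, q) \<in> A" "(x, y) \<in> L" "l y < k" "p \<noteq> q \<or> x \<noteq> y" using st s by auto
      then have "(\<Sum>p\<in>interval A p q. sg (a p)) * (\<Sum>x\<in>interval L x y. sg (l x)) = 0"
        using A.euler_interval[of p q] L.euler_interval[of x y] by auto
      then show ?thesis
        unfolding s t cprod_sets(1)[OF *(3)]
        by (subst sum_sg_cprod) (use A.interval_subset L.interval_subset in auto)
    next
      case t: (2 z)
      then have *: "p \<in> Field A" "(x, z) \<in> L" "l x < k" "l z = k" using st s by auto
      have "x \<noteq> z" using * by auto
      then show ?thesis
        unfolding s t cprod_sets(2)[OF *]
        by (subst sum_sg_cprod)
           (use * A.interval_subset(2) A.euler_above sum_L_top(1) L.FieldD sg_top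
            in \<open>auto dest: subsetD[OF L.interval_subset(1)]\<close>)
    qed
  next
    case (2 z)
    then show ?thesis using st by (cases t rule: option_pair_cases) auto
  qed
  show "(\<Sum>w\<in>cprod\<inverse> `` {t}. sg (crank w)) = - 1" if t: "t \<in> Field cprod" for t
  proof (cases t rule: option_pair_cases)
    case (1 q y)
    then have *: "q \<in> Field A" "y \<in> Field L" "l y < k" using t by auto
    then show ?thesis
      unfolding 1 cprod_sets(3)[OF *(3)]
      by (subst sum_sg_cprod)
         (use A.interval_subset(3) L.interval_subset(3) A.euler_below L.euler_below in auto)
  next
    case (2 z)
    then have *: "z \<in> Field L" "l z = k" using t by auto
    then have sum: "(\<Sum>w\<in>cprod\<inverse> `` {t}. sg (crank w)) =
        - (euler_number A a * (- 1 - sg k)) + int (card {z}) * sg (m + k - 1)"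
      unfolding 2 cprod_sets(4)[OF *] euler_number_def sum_L_top(2)[OF *, symmetric]
      by (intro sum_sg_cprod) (auto dest: L.FieldD)
    show ?thesis
      unfolding sum sgn by (simp add: algebra_simps)
  qed
  show "(\<Sum>w\<in>cprod `` {t}. sg (crank w)) = sg (m + k - 1)" if t: "t \<in> Field cprod" for t
  proof (cases t rule: option_pair_cases)
    case (1 p x)
    then have *: "p \<in> Field A" "x \<in> Field L" "l x < k" using t by auto
    let ?c = "card {z\<in>L `` {x}. l z = k}"
    have sum: "(\<Sum>w\<in>cprod `` {t}. sg (crank w)) =
        - (sg m * (sg k - int ?c * sg k)) + int ?c * sg (m + k - 1)"
      unfolding 1 cprod_sets(5)[OF *(1,3)] A.euler_above[OF *(1), symmetric]
        sum_L_top(3)[OF *(2), symmetric]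
      by (intro sum_sg_cprod) (auto dest: L.FieldD A.FieldD)
    show ?thesis
      unfolding sum sg_top by (simp add: algebra_simps)
  next
    case (2 z)
    then have *: "z \<in> Field L" "l z = k" using t by auto
    then show ?thesis
      unfolding 2 cprod_sets(6)[OF *] by (subst sum_sg_cprod) auto
  qed
qed

lemma cprod_euler_number:
  "euler_number cprod crank =
     - (euler_number A a * (euler_number L l - int (num_rank L l k) * sg k))
     + int (num_rank L l k) * sg (m + k - 1)"
proof -
  have "{x\<in>Field L. l x < k} = Field L \<inter> {y. l y < k}" by auto
  then show ?thesis
    unfolding euler_number_def[of cprod] Field_cprod
    by (subst sum_sg_cprod) (auto simp: sum_L_top(4) num_rank_def euler_number_def[of A])
qed

lemma cprod_num_rank_1: "num_rank cprod crank 1 = num_rank A a 1 * num_rank L l 1"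
proof -
  have "{t\<in>Field cprod. crank t = 1} = map_prod Some id ` ({p\<in>Field A. a p = 1} \<times> {x\<in>Field L. l x = 1})"
  proof (intro set_eqI)
    fix t
    show "t \<in> {t\<in>Field cprod. crank t = 1} \<longleftrightarrow>
        t \<in> map_prod Some id ` ({p\<in>Field A. a p = 1} \<times> {x\<in>Field L. l x = 1})"
    proof (cases t rule: option_pair_cases)
      case (1 p x)
      have "p \<in> Field A \<Longrightarrow> x \<in> Field L \<Longrightarrow> a p + l x - 1 = 1 \<longleftrightarrow> a p = 1 \<and> l x = 1"
        using A.rank_pos[of p] L.rank_pos[of x] by auto
      then show ?thesis using 1 k by force
    qed (use m k in auto)
  qed
  moreover have "inj_on (map_prod Some id) ({p\<in>Field A. a p = 1} \<times> {x\<in>Field L. l x = 1})"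
    by (auto simp: inj_on_def)
  ultimately show ?thesis
    by (simp add: num_rank_def card_image card_cartesian_product)
qed

lemma crank_eq_top: "t \<in> Field cprod \<Longrightarrow> crank t = m + k - 1 \<longleftrightarrow> fst t = None"
  using A.rank_le A.rank_pos m by (cases t rule: option_pair_cases) fastforce+

lemma cprod_num_rank_top: "num_rank cprod crank (m + k - 1) = num_rank L l k"
proof -
  have "{t\<in>Field cprod. crank t = m + k - 1} = Pair None ` {z\<in>Field L. l z = k}"
  proof (intro set_eqI)
    fix t
    show "t \<in> {t\<in>Field cprod. crank t = m + k - 1} \<longleftrightarrow> t \<in> Pair None ` {z\<in>Field L. l z = k}"
      using crank_eq_top[of t] by (cases t rule: option_pair_cases) auto
  qed
  then show ?thesis
    by (simp add: num_rank_def card_image inj_on_def)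
qed

text \<open>The first coordinate is arbitrary below a contracted element, so each incidence of
  \<open>L\<close> appears once for every vertex of \<open>A\<close>. Incidences are multiplied
  while the number of top elements remains that of \<open>L\<close>.\<close>

lemma cprod_num_pairs: "num_pairs cprod crank 1 (m + k - 1) = num_rank A a 1 * num_pairs L l 1 k"
proof -
  let ?f = "\<lambda>(p :: 'a, x :: 'b, z :: 'b). ((Some p, x), (None :: 'a option, z))"
  have "{(s, t)\<in>cprod. crank s = 1 \<and> crank t = m + k - 1} =
      ?f ` ({p\<in>Field A. a p = 1} \<times> {(x, z)\<in>L. l x = 1 \<and> l z = k})"
  proof (intro set_eqI iffI)
    fix st assume "st \<in> {(s, t)\<in>cprod. crank s = 1 \<and> crank t = m + k - 1}"
    then obtain s t where st: "st = (s, t)" "(s, t) \<in> cprod" "crank s = 1" "crank t = m + k - 1" by auto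
    have F: "s \<in> Field cprod" "t \<in> Field cprod" using st by (auto simp: FieldI1 FieldI2)
    obtain z where z: "t = (None, z)" using crank_eq_top[OF F(2)] st by (cases t) auto
    show "st \<in> ?f ` ({p\<in>Field A. a p = 1} \<times> {(x, z)\<in>L. l x = 1 \<and> l z = k})"
    proof (cases s rule: option_pair_cases)
      case (1 p x)
      then have "a p = 1 \<and> l x = 1" "p \<in> Field A" "(x, z) \<in> L" "l z = k"
        using st z F A.rank_pos[of p] L.rank_pos[of x] by auto
      then show ?thesis using st 1 z by force
    qed (use st m k in auto)
  next
    fix st assume "st \<in> ?f ` ({p\<in>Field A. a p = 1} \<times> {(x, z)\<in>L. l x = 1 \<and> l z = k})"
    then obtain p x z where st: "st = ((Some p, x), (None, z))" "p \<in> Field A" "a p = 1"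
      "(x, z) \<in> L" "l x = 1" "l z = k" by auto
    show "st \<in> {(s, t)\<in>cprod. crank s = 1 \<and> crank t = m + k - 1}"
      using st(2-6) k by (simp add: st(1))
  qed
  moreover have "inj_on ?f ({p\<in>Field A. a p = 1} \<times> {(x, z)\<in>L. l x = 1 \<and> l z = k})"
    by (auto simp: inj_on_def)
  ultimately show ?thesis
    by (simp add: num_pairs_def num_rank_def card_image card_cartesian_product)
qed

end

subsection \<open>Adjoining the bounds\<close>

context
  fixes n :: nat and P :: "'a rel" and r :: "'a \<Rightarrow> nat" and u t :: 'a
  assumes P: "euler_complex n P r" and fresh: "u \<notin> Field P" "t \<notin> Field P" "u \<noteq> t"
    and e: "euler_number P r = sg n - 1"
begin

interpretation P: euler_complex n P r by (rule P)

definition bounded :: "'a rel" where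
  "bounded = P \<union> {u} \<times> insert u (insert t (Field P)) \<union> insert t (Field P) \<times> {t}"

definition brank :: "'a \<Rightarrow> nat" where
  "brank = r(u := 0, t := Suc n)"

lemma brank_simps [simp]: "brank u = 0" "brank t = Suc n" "x \<in> Field P \<Longrightarrow> brank x = r x"
  using fresh by (auto simp: brank_def)

lemma Field_bounded: "Field bounded = insert u (insert t (Field P))"
  by (auto simp: bounded_def Field_def)

lemma bounded_iff [simp]:
  "(u, y) \<in> bounded \<longleftrightarrow> y = u \<or> y = t \<or> y \<in> Field P"
  "(x, t) \<in> bounded \<longleftrightarrow> x = u \<or> x = t \<or> x \<in> Field P"
  "(x, u) \<in> bounded \<longleftrightarrow> x = u" "(t, y) \<in> bounded \<longleftrightarrow> y = t"
  "x \<in> Field P \<Longrightarrow> y \<in> Field P \<Longrightarrow> (x, y) \<in> bounded \<longleftrightarrow> (x, y) \<in> P"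
  using fresh P.FieldD by (auto simp: bounded_def)

lemma bounded_FieldD: "(x, y) \<in> bounded \<Longrightarrow> x \<in> Field bounded \<and> y \<in> Field bounded"
  by (auto intro: FieldI1 FieldI2)

lemma bounded_interval:
  "x \<in> Field P \<Longrightarrow> y \<in> Field P \<Longrightarrow> interval bounded x y = interval P x y"
  "y \<in> Field P \<Longrightarrow> interval bounded u y = insert u (P\<inverse> `` {y})"
  "x \<in> Field P \<Longrightarrow> interval bounded x t = insert t (P `` {x})"
  "interval bounded u t = insert u (insert t (Field P))"
  using fresh P.FieldD by (auto simp: bounded_def interval_def)

lemma sum_brank: "A \<subseteq> Field P \<Longrightarrow> (\<Sum>z\<in>A. sg (brank z)) = (\<Sum>z\<in>A. sg (r z))"
  by (intro sum.cong) auto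

lemma bounded_interval_sums:
  "y \<in> Field P \<Longrightarrow> (\<Sum>z\<in>interval bounded u y. sg (brank z)) = 0"
  "x \<in> Field P \<Longrightarrow> (\<Sum>z\<in>interval bounded x t. sg (brank z)) = 0"
  "(\<Sum>z\<in>interval bounded u t. sg (brank z)) = 0"
proof -
  have notin: "u \<notin> P\<inverse> `` {y}" "t \<notin> P `` {y}" for y
    using fresh P.FieldD by auto
  show "(\<Sum>z\<in>interval bounded u y. sg (brank z)) = 0" if "y \<in> Field P"
    using that notin sum_brank[OF P.interval_subset(3)] P.euler_below
    by (simp add: bounded_interval del: converse_iff Image_singleton_iff)
  show "(\<Sum>z\<in>interval bounded x t. sg (brank z)) = 0" if "x \<in> Field P"
    using that notin sum_brank[OF P.interval_subset(2)] P.euler_above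
    by (simp add: bounded_interval del: Image_singleton_iff)
  show "(\<Sum>z\<in>interval bounded u t. sg (brank z)) = 0"
    using fresh sum_brank[OF subset_refl] e P.finite_Field
    by (simp add: bounded_interval euler_number_def)
qed

lemma bounded_euler_poset: "euler_poset bounded brank"
proof
  show "finite (Field bounded)" using P.finite_Field by (simp add: Field_bounded)
  show "Partial_order bounded"
  proof (rule Partial_orderI)
    fix x y assume xy: "(x, y) \<in> bounded"
    note F = bounded_FieldD[OF xy]
    show "(x, x) \<in> bounded \<and> (y, y) \<in> bounded"
      using F P.P_refl by (auto simp: Field_bounded)
    show "x = y" if "(y, x) \<in> bounded"
      using xy that F P.P_antisym[of x y] fresh by (auto simp: Field_bounded)
    show "(x, z) \<in> bounded" if yz: "(y, z) \<in> bounded" for z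
      using xy yz F bounded_FieldD[OF yz] P.P_trans[of x y z] fresh by (auto simp: Field_bounded)
  qed
  show "brank x < brank y" if xy: "(x, y) \<in> bounded" "x \<noteq> y" for x y
    using xy bounded_FieldD[OF xy(1)] P.rank_less[of x y] P.rank_pos[of y] P.rank_le[of x] fresh
    by (auto simp: Field_bounded)
  show "\<exists>z. (x, z) \<in> bounded \<and> (z, y) \<in> bounded \<and> brank x < brank z \<and> brank z < brank y"
    if xy: "(x, y) \<in> bounded" "brank x + 1 < brank y" for x y
  proof -
    have "x \<in> Field bounded" "y \<in> Field bounded" using bounded_FieldD[OF xy(1)] by auto
    then consider "x \<in> Field P" "y \<in> Field P" | "x = u" "y \<in> Field P" | "x \<in> Field P" "y = t"
      | "x = u" "y = t"
      using xy fresh by (auto simp: Field_bounded)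
    then show ?thesis
    proof cases
      case 1
      then obtain z where "(x, z) \<in> P" "(z, y) \<in> P" "r x < r z" "r z < r y"
        using P.gap[of x y] xy by auto
      then show ?thesis using 1 P.FieldD[of x z] by (intro exI[of _ z]) auto
    next
      case 2
      then obtain z where "(z, y) \<in> P" "r z < r y"
        using P.gap_below[of y] xy by auto
      then show ?thesis using 2 P.FieldD[of z y] P.rank_pos[of z] by (intro exI[of _ z]) auto
    next
      case 3
      then obtain z where "(x, z) \<in> P" "r x < r z"
        using P.gap_above[of x] xy by auto
      then show ?thesis using 3 P.FieldD[of x z] P.rank_le[of z] by (intro exI[of _ z]) auto
    next
      case 4
      then obtain z where "z \<in> Field P" using P.nonempty xy by (auto simp: Field_def)
      then show ?thesis using 4 P.rank_pos[of z] P.rank_le[of z] by (intro exI[of _ z]) auto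
    qed
  qed
  show "(\<Sum>z\<in>interval bounded x y. (-1) ^ brank z) = (0::int)" if xy: "(x, y) \<in> bounded" "x \<noteq> y" for x y
  proof -
    have "x \<in> Field bounded" "y \<in> Field bounded" using bounded_FieldD[OF xy(1)] by auto
    then consider "x \<in> Field P" "y \<in> Field P" | "x = u" "y \<in> Field P" | "x \<in> Field P" "y = t"
      | "x = u" "y = t"
      using xy fresh by (auto simp: Field_bounded)
    then show ?thesis
    proof cases
      case 1
      then show ?thesis
        using xy P.euler_interval[of x y] sum_brank[OF P.interval_subset(1)] by (simp add: bounded_interval)
    qed (use bounded_interval_sums in auto)
  qed
qed

interpretation B: euler_poset bounded brank by (rule bounded_euler_poset)

lemma bounded_bounds: "is_min bounded u" "is_max bounded t"
  by (auto simp: is_min_def is_max_def Field_bounded)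

lemma bounded_eulerian: "bounded \<in> eulerian_posets (n + 1)"
  using B.eulerian(1,2)[OF bounded_bounds(1) _ bounded_bounds(2)] by (simp add: eulerian_posets_def)

lemma rank_bounded: "x \<in> Field P \<Longrightarrow> rank bounded x = r x"
  using B.rank_eq[OF bounded_bounds(1), of x] by (simp add: Field_bounded)

lemma rank_bounded_bounds: "rank bounded u = 0" "rank bounded t = Suc n"
  using B.rank_eq[OF bounded_bounds(1)] by (simp_all add: Field_bounded)

lemma ab_index_bounded: "ab_index bounded = flag_poly n P r"
proof -
  interpret R: euler_poset bounded "rank bounded"
    using bounded_eulerian by (auto simp: eulerian_posets_def intro: eulerian_euler_poset)
  have ut: "pmin bounded = u" "pmax bounded = t"
    using pmin_eq[OF B.partial_order] pmax_eq[OF B.partial_order] bounded_bounds by auto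
  have "R.between u t = Field P"
    using fresh by (auto simp: R.between_def)
  moreover have "C \<in> Chains bounded \<and> C \<subseteq> Field P \<longleftrightarrow> C \<in> Chains P" for C
  proof
    assume C: "C \<in> Chains P"
    then have "C \<subseteq> Field P" by (rule Chains_Field)
    moreover have "C \<in> Chains bounded" using C unfolding Chains_def bounded_def by blast
    ultimately show "C \<in> Chains bounded \<and> C \<subseteq> Field P" by blast
  next
    assume C: "C \<in> Chains bounded \<and> C \<subseteq> Field P"
    show "C \<in> Chains P"
      unfolding Chains_def
    proof (intro CollectI ballI)
      fix x y assume "x \<in> C" "y \<in> C"
      then have "(x, y) \<in> bounded \<or> (y, x) \<in> bounded" "x \<in> Field P" "y \<in> Field P"
        using C unfolding Chains_def by blast+
      then show "(x, y) \<in> P \<or> (y, x) \<in> P" by simp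
    qed
  qed
  ultimately have ch: "R.chains u t = Chains P"
    by (auto simp: R.chains_def)
  have "rank bounded ` C = r ` C" if "C \<in> Chains P" for C
    using Chains_Field[OF that] rank_bounded by (intro image_cong) auto
  then show ?thesis
    unfolding ab_index_eq_ab_poly[OF bounded_eulerian] ut R.chain_poly_def flag_poly_def ch
      rank_bounded_bounds
    by (intro sum.cong) simp_all
qed

lemma card_rank_bounded:
  assumes "0 < k" "k \<le> n"
  shows "card {z\<in>Field bounded. rank bounded z = k} = num_rank P r k"
proof -
  have "{z\<in>Field bounded. rank bounded z = k} = {z\<in>Field P. r z = k}"
    using assms rank_bounded rank_bounded_bounds by (auto simp: Field_bounded)
  then show ?thesis by (simp add: num_rank_def)
qed

lemma card_pairs_bounded:
  assumes "0 < n"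
  shows "card {(a, z)\<in>bounded. rank bounded a = 1 \<and> rank bounded z = n} = num_pairs P r 1 n"
proof -
  have "(a, z) \<in> bounded \<and> rank bounded a = 1 \<and> rank bounded z = n \<longleftrightarrow> (a, z) \<in> P \<and> r a = 1 \<and> r z = n"
    for a z
  proof
    assume *: "(a, z) \<in> bounded \<and> rank bounded a = 1 \<and> rank bounded z = n"
    then have "a \<in> Field bounded" "z \<in> Field bounded" "a \<noteq> u" "z \<noteq> t"
      using bounded_FieldD rank_bounded_bounds by auto
    moreover have "a \<noteq> t" using * assms rank_bounded_bounds \<open>z \<noteq> t\<close> by auto
    moreover have "z \<noteq> u" using * assms rank_bounded_bounds by auto
    ultimately show "(a, z) \<in> P \<and> r a = 1 \<and> r z = n"
      using * rank_bounded by (auto simp: Field_bounded)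
  next
    assume *: "(a, z) \<in> P \<and> r a = 1 \<and> r z = n"
    then show "(a, z) \<in> bounded \<and> rank bounded a = 1 \<and> rank bounded z = n"
      using P.FieldD[of a z] rank_bounded by (auto simp: bounded_def)
  qed
  then show ?thesis by (simp add: num_pairs_def)
qed

end

lemma ex_bounded_poset:
  fixes P :: "'b rel"
  assumes P: "euler_complex n P r" and e: "euler_number P r = sg n - 1"
  shows "\<exists>H :: ('a::infinite) rel \<in> eulerian_posets (n + 1). ab_index H = flag_poly n P r \<and>
    (\<forall>k. 0 < k \<and> k \<le> n \<longrightarrow> card {z\<in>Field H. rank H z = k} = num_rank P r k) \<and>
    (0 < n \<longrightarrow> card {(a, z)\<in>H. rank H a = 1 \<and> rank H z = n} = num_pairs P r 1 n)"
proof -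
  interpret P: euler_complex n P r by (rule P)
  obtain g :: "nat \<Rightarrow> 'a" where g: "inj g"
    using infinite_countable_subset[OF infinite_UNIV] by auto
  obtain h :: "'b \<Rightarrow> nat" where h: "inj_on h (Field P)"
    using finite_imp_inj_to_nat_seg[OF P.finite_Field] by blast
  \<comment> \<open>The shift by 2 keeps \<open>g 0\<close> and \<open>g 1\<close> free for the
    minimum and the maximum.\<close>
  define f where "f x = g (h x + 2)" for x
  have f: "inj_on f (Field P)"
    using g h by (auto simp: f_def inj_on_def)
  define q where "q y = r (inv_into (Field P) f y)" for y
  have q: "q (f x) = r x" if "x \<in> Field P" for x
    using inv_into_f_f[OF f that] by (simp add: q_def)
  let ?P = "map_prod f f ` P"
  note C = P.relabel_complex[OF f q]
  have fresh: "g 0 \<notin> Field ?P" "g 1 \<notin> Field ?P" "g 0 \<noteq> g 1"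
    using g by (auto simp: P.Field_relabel[OF f q] f_def inj_on_def)
  have e': "euler_number ?P q = sg n - 1"
    using e P.relabel_euler_number[OF f q] by simp
  show ?thesis
    using bounded_eulerian[OF C fresh e'] ab_index_bounded[OF C fresh e']
      card_rank_bounded[OF C fresh e'] card_pairs_bounded[OF C fresh e']
      P.relabel_flag_poly[OF f q] P.relabel_num_rank[OF f q] P.relabel_num_pairs[OF f q]
    by (intro bexI[of _ "bounded ?P (g 0) (g 1)"]) auto
qed

subsection \<open>Doubling\<close>

text \<open>Replacing every element by an antichain of two elements turns a half-Eulerian poset into
  an Eulerian one.\<close>

locale half_complex =
  fixes n :: nat and Q :: "'a rel" and r :: "'a \<Rightarrow> nat"
  assumes finite_Field: "finite (Field Q)"
    and partial_order: "Partial_order Q"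
    and nonempty: "Q \<noteq> {}"
    and rank_pos: "x \<in> Field Q \<Longrightarrow> 0 < r x"
    and rank_le: "x \<in> Field Q \<Longrightarrow> r x \<le> n"
    and rank_less: "(x, y) \<in> Q \<Longrightarrow> x \<noteq> y \<Longrightarrow> r x < r y"
    and gap: "(x, y) \<in> Q \<Longrightarrow> r x + 1 < r y \<Longrightarrow> \<exists>z. (x, z) \<in> Q \<and> (z, y) \<in> Q \<and> r x < r z \<and> r z < r y"
    and gap_below: "y \<in> Field Q \<Longrightarrow> 1 < r y \<Longrightarrow> \<exists>z. (z, y) \<in> Q \<and> r z < r y"
    and gap_above: "x \<in> Field Q \<Longrightarrow> r x < n \<Longrightarrow> \<exists>z. (x, z) \<in> Q \<and> r x < r z"
    and half_interval: "(x, y) \<in> Q \<Longrightarrow> x \<noteq> y \<Longrightarrow> 2 * (\<Sum>z\<in>interval Q x y. sg (r z)) = sg (r x) + sg (r y)"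
    and half_below: "y \<in> Field Q \<Longrightarrow> 2 * (\<Sum>z\<in>Q\<inverse> `` {y}. sg (r z)) = sg (r y) - 1"
    and half_above: "x \<in> Field Q \<Longrightarrow> 2 * (\<Sum>z\<in>Q `` {x}. sg (r z)) = sg n + sg (r x)"
begin

definition doubled :: "('a \<times> bool) rel" where
  "doubled = {((x, s), (y, t)) |x y s t. (x, y) \<in> Q \<and> (x = y \<longrightarrow> s = t)}"

lemma doubled_iff [simp]: "((x, s), (y, t)) \<in> doubled \<longleftrightarrow> (x, y) \<in> Q \<and> (x = y \<longrightarrow> s = t)"
  by (auto simp: doubled_def)

lemma Q_refl: "x \<in> Field Q \<Longrightarrow> (x, x) \<in> Q"
  using partial_order by (auto simp: partial_order_on_def preorder_on_def refl_on_def)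

lemma Q_trans: "(x, y) \<in> Q \<Longrightarrow> (y, z) \<in> Q \<Longrightarrow> (x, z) \<in> Q"
  using partial_order by (meson partial_order_on_def preorder_on_def transD)

lemma Q_antisym: "(x, y) \<in> Q \<Longrightarrow> (y, x) \<in> Q \<Longrightarrow> x = y"
  using partial_order by (meson partial_order_on_def antisymD)

lemma FieldD: "(x, y) \<in> Q \<Longrightarrow> x \<in> Field Q" "(x, y) \<in> Q \<Longrightarrow> y \<in> Field Q"
  by (auto simp: FieldI1 FieldI2)

lemma Field_doubled: "Field doubled = Field Q \<times> UNIV"
proof (intro set_eqI iffI)
  fix t assume "t \<in> Field doubled"
  then obtain u where "(t, u) \<in> doubled \<or> (u, t) \<in> doubled" by (auto simp: Field_def)
  then show "t \<in> Field Q \<times> UNIV"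
    by (cases t; cases u) (auto dest: FieldD)
next
  fix t :: "'a \<times> bool" assume "t \<in> Field Q \<times> UNIV"
  then have "(t, t) \<in> doubled" using Q_refl by (auto simp: mem_Times_iff) (metis doubled_iff prod.collapse)
  then show "t \<in> Field doubled" by (rule FieldI1)
qed

lemma sum_doubled: "(\<Sum>z\<in>A \<times> (UNIV :: bool set). sg (r (fst z))) = 2 * (\<Sum>z\<in>A. sg (r z))"
  using sum.cartesian_product[of "\<lambda>x (_ :: bool). sg (r x)" UNIV A]
  by (simp add: sum_distrib_left case_prod_beta)

lemma finite_sets: "finite (interval Q x y)" "finite (Q `` {x})" "finite (Q\<inverse> `` {x})"
  using FieldD by (auto intro: finite_subset[OF _ finite_Field] simp: interval_def)

text \<open>The twin of an endpoint is incomparable with it, and everything else appears twice. So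
  Eulerian sums are twice the old ones minus the signs of the twins, which is how the half-Eulerian
  conditions arise.\<close>

lemma doubled_interval:
  "x \<noteq> y \<Longrightarrow> interval doubled (x, s) (y, t) = interval Q x y \<times> UNIV - {(x, \<not> s), (y, \<not> t)}"
  "doubled `` {(x, s)} = Q `` {x} \<times> UNIV - {(x, \<not> s)}"
  "doubled\<inverse> `` {(y, t)} = Q\<inverse> `` {y} \<times> UNIV - {(y, \<not> t)}"
  by (auto simp: interval_def)

lemma doubled_complex: "euler_complex n doubled (r \<circ> fst)"
proof
  show "finite (Field doubled)" using finite_Field by (simp add: Field_doubled)
  show "Partial_order doubled"
  proof (rule Partial_orderI)
    fix a b assume ab: "(a, b) \<in> doubled"
    obtain x s y t where [simp]: "a = (x, s)" "b = (y, t)" by (cases a, cases b)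
    show "(a, a) \<in> doubled \<and> (b, b) \<in> doubled"
      using ab Q_refl FieldD[of x y] by simp
    show "a = b" if "(b, a) \<in> doubled"
      using ab that Q_antisym[of x y] by simp
    show "(a, c) \<in> doubled" if "(b, c) \<in> doubled" for c
      using ab that Q_trans[of x y "fst c"] Q_antisym[of x y] by (cases c) auto
  qed
  show "doubled \<noteq> {}" using nonempty by (auto simp: doubled_def)
  show "0 < (r \<circ> fst) a" "(r \<circ> fst) a \<le> n" if "a \<in> Field doubled" for a
    using that rank_pos rank_le by (auto simp: Field_doubled)
  show "(r \<circ> fst) a < (r \<circ> fst) b" if "(a, b) \<in> doubled" "a \<noteq> b" for a b
    using that rank_less by (cases a; cases b) auto
  show "\<exists>c. (a, c) \<in> doubled \<and> (c, b) \<in> doubled \<and> (r \<circ> fst) a < (r \<circ> fst) c \<and> (r \<circ> fst) c < (r \<circ> fst) b"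
    if ab: "(a, b) \<in> doubled" "(r \<circ> fst) a + 1 < (r \<circ> fst) b" for a b
  proof -
    obtain z where "(fst a, z) \<in> Q" "(z, fst b) \<in> Q" "r (fst a) < r z" "r z < r (fst b)"
      using gap[of "fst a" "fst b"] ab by (cases a; cases b) auto
    then show ?thesis by (intro exI[of _ "(z, True)"]) (cases a; cases b; auto)
  qed
  show "\<exists>c. (c, b) \<in> doubled \<and> (r \<circ> fst) c < (r \<circ> fst) b"
    if b: "b \<in> Field doubled" "1 < (r \<circ> fst) b" for b
  proof -
    obtain z where "(z, fst b) \<in> Q" "r z < r (fst b)"
      using gap_below[of "fst b"] b by (auto simp: Field_doubled)
    then show ?thesis by (intro exI[of _ "(z, True)"]) (cases b; auto)
  qed
  show "\<exists>c. (b, c) \<in> doubled \<and> (r \<circ> fst) b < (r \<circ> fst) c"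
    if b: "b \<in> Field doubled" "(r \<circ> fst) b < n" for b
  proof -
    obtain z where "(fst b, z) \<in> Q" "r (fst b) < r z"
      using gap_above[of "fst b"] b by (auto simp: Field_doubled)
    then show ?thesis by (intro exI[of _ "(z, True)"]) (cases b; auto)
  qed
  show "(\<Sum>c\<in>interval doubled a b. sg ((r \<circ> fst) c)) = 0" if ab: "(a, b) \<in> doubled" "a \<noteq> b" for a b
  proof -
    obtain x s y t where [simp]: "a = (x, s)" "b = (y, t)" by (cases a, cases b)
    have xy: "(x, y) \<in> Q" "x \<noteq> y" using ab by auto
    then have "x \<in> interval Q x y" "y \<in> interval Q x y"
      using Q_refl FieldD[of x y] by (auto simp: interval_def)
    then have "(\<Sum>c\<in>interval doubled a b. sg (r (fst c))) =
        2 * (\<Sum>z\<in>interval Q x y. sg (r z)) - (\<Sum>c\<in>{(x, \<not> s), (y, \<not> t)}. sg (r (fst c)))"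
      using xy(2) finite_sets(1)[of x y] by (simp add: doubled_interval sum_diff sum_doubled)
    then show ?thesis
      using half_interval[OF xy] xy by simp
  qed
  show "(\<Sum>c\<in>doubled\<inverse> `` {b}. sg ((r \<circ> fst) c)) = - 1" if b: "b \<in> Field doubled" for b
  proof -
    obtain y t where [simp]: "b = (y, t)" by (cases b)
    have y: "y \<in> Field Q" using b by (simp add: Field_doubled)
    have "(\<Sum>c\<in>doubled\<inverse> `` {b}. sg (r (fst c))) = 2 * (\<Sum>z\<in>Q\<inverse> `` {y}. sg (r z)) - sg (r y)"
      using finite_sets(3)[of y] Q_refl[OF y] by (simp add: doubled_interval sum_diff1 sum_doubled)
    then show ?thesis using half_below[OF y] by simp
  qed
  show "(\<Sum>c\<in>doubled `` {b}. sg ((r \<circ> fst) c)) = sg n" if b: "b \<in> Field doubled" for b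
  proof -
    obtain y t where [simp]: "b = (y, t)" by (cases b)
    have y: "y \<in> Field Q" using b by (simp add: Field_doubled)
    have "(\<Sum>c\<in>doubled `` {b}. sg (r (fst c))) = 2 * (\<Sum>z\<in>Q `` {y}. sg (r z)) - sg (r y)"
      using finite_sets(2)[of y] Q_refl[OF y] by (simp add: doubled_interval sum_diff1 sum_doubled)
    then show ?thesis using half_above[OF y] by simp
  qed
qed

lemma doubled_euler_number: "euler_number doubled (r \<circ> fst) = 2 * euler_number Q r"
  by (simp add: euler_number_def Field_doubled sum_doubled)

lemma doubled_num_rank: "num_rank doubled (r \<circ> fst) k = 2 * num_rank Q r k"
proof -
  have "{x\<in>Field doubled. (r \<circ> fst) x = k} = {x\<in>Field Q. r x = k} \<times> UNIV"
    by (auto simp: Field_doubled)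
  then show ?thesis by (simp add: num_rank_def card_cartesian_product)
qed

end

text \<open>The half-Eulerian poset of rank 7 obtained from the complete graph on four vertices. Its
  ranks 1 to 6 consist of the vertices \<open>(1, v, v)\<close>, the flags \<open>(2, v, w)\<close> of a vertex \<open>v\<close> in an
  edge \<open>vw\<close>, the edges \<open>(3, v, w)\<close>, and dual copies of the edges, flags and vertices. A lower
  element is below an upper one iff some edge is incident with both. There are fewer vertices and
  edges together than flags, \<open>4 + 6 < 12\<close>, which makes the coefficient of \<open>ccdcc\<close> negative.\<close>

definition k4_le :: "nat \<times> nat \<times> nat \<Rightarrow> nat \<times> nat \<times> nat \<Rightarrow> bool" where
  "k4_le = (\<lambda>(i, v, w) (j, v', w').
     if i = j then v = v' \<and> w = w'
     else i < j \<and> length (remdups [v, w, v', w']) \<le> 2 \<and>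
       (i = 1 \<and> j = 2 \<longrightarrow> v = v') \<and> (i = 5 \<and> j = 6 \<longrightarrow> v = v'))"

definition k4_elements :: "(nat \<times> nat \<times> nat) list" where
  "k4_elements = concat (map (\<lambda>v. concat (map (\<lambda>w.
     if v = w then [(1, v, v), (6, v, v)]
     else [(2, v, w), (5, v, w)] @ (if v < w then [(3, v, w), (4, v, w)] else [])) [0, 1, 2, 3])) [0, 1, 2, 3])"

text \<open>Given by cases instead of a power, to keep the checks by evaluation simple; see
  \<open>k4_sign_eq\<close>.\<close>

definition k4_sign :: "nat \<times> nat \<times> nat \<Rightarrow> int" where
  "k4_sign = (\<lambda>(i, v, w). if i = 1 \<or> i = 3 \<or> i = 5 then -1 else 1)"

definition k4_up :: "nat \<times> nat \<times> nat \<Rightarrow> (nat \<times> nat \<times> nat) list" where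
  "k4_up x = filter (k4_le x) k4_elements"

definition k4 :: "(nat \<times> nat \<times> nat) rel" where
  "k4 = {(x, y). x \<in> set k4_elements \<and> y \<in> set k4_elements \<and> k4_le x y}"

text \<open>This check and the next two evaluate what \<open>half_complex\<close> demands of the
  finite list. Comparable elements are enumerated through \<open>k4_up\<close> to keep the
  evaluation small.\<close>

lemma k4_single_check:
  "distinct k4_elements \<and> list_all (\<lambda>x. k4_le x x \<and> 0 < fst x \<and> fst x \<le> 6 \<and>
     2 * sum_list (map k4_sign (k4_up x)) = 1 + k4_sign x \<and>
     2 * sum_list (map k4_sign (filter (\<lambda>z. k4_le z x) k4_elements)) = k4_sign x - 1 \<and>
     (fst x < 6 \<longrightarrow> list_ex (\<lambda>z. fst x < fst z) (k4_up x)) \<and>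
     (1 < fst x \<longrightarrow> list_ex (\<lambda>z. k4_le z x \<and> fst z < fst x) k4_elements)) k4_elements"
  by code_simp

lemma k4_pair_check:
  "list_all (\<lambda>x. list_all (\<lambda>y. (fst x < fst y \<or> x = y) \<and>
     (x \<noteq> y \<longrightarrow> 2 * sum_list (map k4_sign (filter (\<lambda>z. k4_le z y) (k4_up x))) = k4_sign x + k4_sign y) \<and>
     (fst x + 1 < fst y \<longrightarrow> list_ex (\<lambda>z. k4_le z y \<and> fst x < fst z \<and> fst z < fst y) (k4_up x)))
     (k4_up x)) k4_elements"
  by code_simp

lemma k4_trans_check:
  "list_all (\<lambda>x. list_all (\<lambda>y. list_all (k4_le x) (k4_up y)) (k4_up x)) k4_elements"
  by code_simp

lemma k4_sign_eq: "x \<in> set k4_elements \<Longrightarrow> k4_sign x = sg (fst x)"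
proof -
  assume "x \<in> set k4_elements"
  then have "fst x \<in> {1, 2, 3, 4, 5, 6}"
    using k4_single_check by (fastforce simp: list_all_iff)
  then show ?thesis by (cases x) (auto simp: k4_sign_def)
qed

lemma sum_list_filter_eq:
  "(\<Sum>x\<in>{x\<in>set k4_elements. R x}. sg (fst x)) = sum_list (map k4_sign (filter R k4_elements))"
proof -
  have "(\<Sum>x\<in>{x\<in>set k4_elements. R x}. sg (fst x)) = (\<Sum>x\<in>set (filter R k4_elements). k4_sign x)"
    by (intro sum.cong) (auto simp: k4_sign_eq)
  also have "\<dots> = sum_list (map k4_sign (filter R k4_elements))"
    using k4_single_check by (intro sum_list_distinct_conv_sum_set[symmetric]) simp
  finally show ?thesis .
qed

lemma Field_k4: "Field k4 = set k4_elements"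
proof -
  have "(x, x) \<in> k4" if "x \<in> set k4_elements" for x
    using k4_single_check that by (auto simp: k4_def list_all_iff)
  then have "set k4_elements \<subseteq> Field k4"
    by (intro subsetI) (rule FieldI1)
  moreover have "Field k4 \<subseteq> set k4_elements"
    by (auto simp: Field_def k4_def)
  ultimately show ?thesis by (rule subset_antisym[rotated])
qed

lemma k4_half_complex: "half_complex 6 k4 fst"
proof -
  have Field: "Field k4 = set k4_elements" by (rule Field_k4)
  then have refl: "(x, x) \<in> k4" if "x \<in> set k4_elements" for x
    using k4_single_check that by (auto simp: k4_def list_all_iff)
  have up: "z \<in> set (k4_up x) \<longleftrightarrow> (x, z) \<in> k4" if "x \<in> set k4_elements" for x z
    using that by (auto simp: k4_up_def k4_def)
  note single = k4_single_check[unfolded list_all_iff, THEN conjunct2, rule_format]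
  note pair = k4_pair_check[unfolded list_all_iff, rule_format]
  have mono: "fst x < fst y \<or> x = y" if "(x, y) \<in> k4" for x y
    using pair[of x y] that up[of x y] by (auto simp: k4_def)
  show ?thesis
  proof
    show "finite (Field k4)" by (simp add: Field)
    show "Partial_order k4"
    proof (rule Partial_orderI)
      fix x y assume xy: "(x, y) \<in> k4"
      then show "(x, x) \<in> k4 \<and> (y, y) \<in> k4" using refl by (auto simp: k4_def)
      show "x = y" if "(y, x) \<in> k4" using mono[OF xy] mono[OF that] by auto
      show "(x, z) \<in> k4" if "(y, z) \<in> k4" for z
      proof -
        have *: "x \<in> set k4_elements" "y \<in> set k4_elements" "z \<in> set k4_elements"
          using xy that by (auto simp: k4_def)
        then have "y \<in> set (k4_up x)" "z \<in> set (k4_up y)"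
          using up xy that by auto
        then have "k4_le x z"
          using k4_trans_check[unfolded list_all_iff] *(1) by blast
        then show ?thesis using * by (simp add: k4_def)
      qed
    qed
    show "k4 \<noteq> {}" using refl[of "(1, 0, 0)"] by (auto simp: k4_elements_def)
    show "0 < fst x" "fst x \<le> 6" if "x \<in> Field k4" for x
      using single[of x] that by (auto simp: Field)
    show "fst x < fst y" if "(x, y) \<in> k4" "x \<noteq> y" for x y
      using mono that by blast
    show "\<exists>z. (x, z) \<in> k4 \<and> (z, y) \<in> k4 \<and> fst x < fst z \<and> fst z < fst y"
      if xy: "(x, y) \<in> k4" "fst x + 1 < fst y" for x y
    proof -
      have x: "x \<in> set k4_elements" "y \<in> set k4_elements" using xy by (auto simp: k4_def)
      have "list_ex (\<lambda>z. k4_le z y \<and> fst x < fst z \<and> fst z < fst y) (k4_up x)"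
        using pair[OF x(1), of y] up[OF x(1)] xy by blast
      then show ?thesis
        using x by (auto simp: list_ex_iff k4_up_def k4_def)
    qed
    show "\<exists>z. (z, y) \<in> k4 \<and> fst z < fst y" if y: "y \<in> Field k4" "1 < fst y" for y
    proof -
      have y': "y \<in> set k4_elements" using y by (simp add: Field)
      then obtain z where "z \<in> set k4_elements" "k4_le z y" "fst z < fst y"
        using single[of y] y(2) unfolding list_ex_iff by blast
      then show ?thesis using y' by (intro exI[of _ z]) (simp add: k4_def)
    qed
    show "\<exists>z. (x, z) \<in> k4 \<and> fst x < fst z" if x: "x \<in> Field k4" "fst x < 6" for x
    proof -
      have x': "x \<in> set k4_elements" using x by (simp add: Field)
      then obtain z where "z \<in> set (k4_up x)" "fst x < fst z"
        using single[of x] x(2) unfolding list_ex_iff by blast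
      then show ?thesis using up[OF x'] by blast
    qed
    note sign = k4_sign_eq[symmetric]
    show "2 * (\<Sum>z\<in>interval k4 x y. sg (fst z)) = sg (fst x) + sg (fst y)" if xy: "(x, y) \<in> k4" "x \<noteq> y" for x y
    proof -
      have x: "x \<in> set k4_elements" "y \<in> set k4_elements" using xy by (auto simp: k4_def)
      have "interval k4 x y = {z\<in>set k4_elements. k4_le z y \<and> k4_le x z}"
        using x by (auto simp: interval_def k4_def)
      then have "(\<Sum>z\<in>interval k4 x y. sg (fst z)) = sum_list (map k4_sign (filter (\<lambda>z. k4_le z y) (k4_up x)))"
        by (simp add: sum_list_filter_eq k4_up_def conj_commute)
      then show ?thesis
        using pair[OF x(1), of y] up[OF x(1)] xy sign x by simp
    qed
    show "2 * (\<Sum>z\<in>k4\<inverse> `` {y}. sg (fst z)) = sg (fst y) - 1" if y: "y \<in> Field k4" for y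
    proof -
      have "k4\<inverse> `` {y} = {z\<in>set k4_elements. k4_le z y}"
        using y unfolding Field by (auto simp: k4_def)
      then have "(\<Sum>z\<in>k4\<inverse> `` {y}. sg (fst z)) = sum_list (map k4_sign (filter (\<lambda>z. k4_le z y) k4_elements))"
        by (simp only: sum_list_filter_eq)
      then show ?thesis
        using single[of y] sign[of y] y by (simp only: Field)
    qed
    show "2 * (\<Sum>z\<in>k4 `` {x}. sg (fst z)) = sg 6 + sg (fst x)" if x: "x \<in> Field k4" for x
    proof -
      have "k4 `` {x} = {z\<in>set k4_elements. k4_le x z}"
        using x unfolding Field by (auto simp: k4_def)
      then have "(\<Sum>z\<in>k4 `` {x}. sg (fst z)) = sum_list (map k4_sign (k4_up x))"
        by (simp only: sum_list_filter_eq k4_up_def)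
      then show ?thesis
        using single[of x] sign[of x] x by (simp add: Field)
    qed
  qed
qed

lemma k4_num_rank: "num_rank k4 fst k = length (filter (\<lambda>x. fst x = k) k4_elements)"
proof -
  have "{x\<in>set k4_elements. fst x = k} = set (filter (\<lambda>x. fst x = k) k4_elements)" by auto
  moreover have "distinct (filter (\<lambda>x. fst x = k) k4_elements)"
    using k4_single_check[THEN conjunct1] by (rule distinct_filter)
  ultimately show ?thesis
    by (simp only: num_rank_def Field_k4 distinct_card)
qed

lemma k4_numbers:
  "euler_number k4 fst = 0" "num_rank k4 fst 1 = 4" "num_rank k4 fst 2 = 12" "num_rank k4 fst 3 = 6"
proof -
  show "euler_number k4 fst = 0"
    using sum_list_filter_eq[of "\<lambda>_. True"]
    by (simp add: euler_number_def Field_k4 k4_elements_def k4_sign_def)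
  show "num_rank k4 fst 1 = 4" "num_rank k4 fst 2 = 12" "num_rank k4 fst 3 = 6"
    by (simp_all add: k4_num_rank k4_elements_def)
qed

section \<open>Realizing coefficients\<close>

text \<open>The Euler number and the numbers of vertices, top elements and incidences between them
  can be followed through disjoint unions, ordinal sums and collapsed products, and the coefficient
  of d c^m d is affine in the last three. The type \<open>nat\<close> is fixed because the
  quantifier cannot range over types.\<close>

definition realizable :: "nat \<Rightarrow> int \<Rightarrow> nat \<Rightarrow> nat \<Rightarrow> nat \<Rightarrow> bool" where
  "realizable n e v z i \<longleftrightarrow> (\<exists>(P :: nat rel) r. euler_complex n P r \<and> euler_number P r = e \<and>
     num_rank P r 1 = v \<and> num_rank P r n = z \<and> num_pairs P r 1 n = i)"

lemma ex_nat_copy: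
  fixes P :: "'a::countable rel"
  assumes "euler_complex n P r"
  shows "\<exists>(S :: nat rel) s. euler_complex n S s \<and> euler_number S s = euler_number P r \<and>
    (\<forall>k. num_rank S s k = num_rank P r k) \<and> (\<forall>j k. num_pairs S s j k = num_pairs P r j k)"
proof -
  interpret P: euler_complex n P r by (rule assms)
  have inj: "inj_on (to_nat :: 'a \<Rightarrow> nat) (Field P)"
    using inj_on_subset[OF inj_to_nat] by blast
  have q: "(r \<circ> from_nat) (to_nat x) = r x" for x :: 'a by simp
  show ?thesis
    using P.relabel_complex[OF inj q] P.relabel_euler_number[OF inj q] P.relabel_num_rank[OF inj q]
      P.relabel_num_pairs[OF inj q]
    by blast
qed

lemma realizableI:
  fixes P :: "'a::countable rel"
  assumes "euler_complex n P r"
  shows "realizable n (euler_number P r) (num_rank P r 1) (num_rank P r n) (num_pairs P r 1 n)"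
  using ex_nat_copy[OF assms] unfolding realizable_def by metis

context
  fixes m k :: nat and P :: "'a rel" and Q :: "'b rel" and r :: "'a \<Rightarrow> nat" and q :: "'b \<Rightarrow> nat"
  assumes P: "euler_complex m P r" and Q: "euler_complex k Q q"
begin

interpretation P: euler_complex m P r by (rule P)
interpretation Q: euler_complex k Q q by (rule Q)

abbreviation (input) "left_copy \<equiv> map_prod Inl Inl ` P :: ('a + 'b) rel"
abbreviation (input) "right_copy \<equiv> map_prod Inr Inr ` Q :: ('a + 'b) rel"

lemma inj_copies: "inj_on (Inl :: 'a \<Rightarrow> 'a + 'b) (Field P)" "inj_on (Inr :: 'b \<Rightarrow> 'a + 'b) (Field Q)"
  by simp_all

lemma left_copy:
  assumes "\<And>x. x \<in> Field P \<Longrightarrow> s (Inl x) = r x"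
  shows "euler_complex m left_copy s" "euler_number left_copy s = euler_number P r"
    "num_rank left_copy s j = num_rank P r j" "num_pairs left_copy s i j = num_pairs P r i j"
    "flag_poly n left_copy s = flag_poly n P r"
  using P.relabel_complex[OF inj_copies(1), of s] P.relabel_euler_number[OF inj_copies(1), of s]
    P.relabel_num_rank[OF inj_copies(1), of s] P.relabel_num_pairs[OF inj_copies(1), of s]
    P.relabel_flag_poly[OF inj_copies(1), of s] assms
  by blast+

lemma right_copy:
  assumes "\<And>x. x \<in> Field Q \<Longrightarrow> s (Inr x) = q x"
  shows "euler_complex k right_copy s" "euler_number right_copy s = euler_number Q q"
    "num_rank right_copy s j = num_rank Q q j" "num_pairs right_copy s i j = num_pairs Q q i j"
    "flag_poly n right_copy s = flag_poly n Q q"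
  using Q.relabel_complex[OF inj_copies(2), of s] Q.relabel_euler_number[OF inj_copies(2), of s]
    Q.relabel_num_rank[OF inj_copies(2), of s] Q.relabel_num_pairs[OF inj_copies(2), of s]
    Q.relabel_flag_poly[OF inj_copies(2), of s] assms
  by blast+

lemma Field_copies:
  "Field left_copy = Inl ` Field P" "Field right_copy = Inr ` Field Q"
  by (force simp: Field_def)+

lemma disjoint_copies: "Field left_copy \<inter> Field right_copy = {}"
  unfolding Field_copies by auto

end

lemma ex_disjoint_union:
  assumes P: "euler_complex n (P :: nat rel) r" and Q: "euler_complex n (Q :: nat rel) q"
  shows "\<exists>(S :: (nat + nat) rel) s. euler_complex n S s \<and>
    euler_number S s = euler_number P r + euler_number Q q \<and>
    (\<forall>j. num_rank S s j = num_rank P r j + num_rank Q q j) \<and>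
    (\<forall>i j. num_pairs S s i j = num_pairs P r i j + num_pairs Q q i j)"
proof -
  define s where "s = case_sum r q"
  have "s (Inl x) = r x" "s (Inr y) = q y" for x y by (auto simp: s_def)
  note L = left_copy[OF P Q, where s = s, OF this(1)] and R = right_copy[OF P Q, where s = s, OF this(2)]
  note U = union_complex[OF L(1) R(1) disjoint_copies[OF P Q]]
    union_euler_number[OF L(1) R(1) disjoint_copies[OF P Q]]
    union_num_rank[OF L(1) R(1) disjoint_copies[OF P Q]]
    union_num_pairs[OF L(1) R(1) disjoint_copies[OF P Q]]
  show ?thesis
    using U L R by (intro exI[of _ "map_prod Inl Inl ` P \<union> map_prod Inr Inr ` Q"] exI[of _ s]) auto
qed

lemma realizable_union:
  assumes "realizable n e v z i" "realizable n e' v' z' i'"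
  shows "realizable n (e + e') (v + v') (z + z') (i + i')"
proof -
  obtain P Q :: "nat rel" and r q where P: "euler_complex n P r" "euler_number P r = e"
      "num_rank P r 1 = v" "num_rank P r n = z" "num_pairs P r 1 n = i"
    and Q: "euler_complex n Q q" "euler_number Q q = e'"
      "num_rank Q q 1 = v'" "num_rank Q q n = z'" "num_pairs Q q 1 n = i'"
    using assms unfolding realizable_def by blast
  obtain S :: "(nat + nat) rel" and s where S: "euler_complex n S s"
    "euler_number S s = euler_number P r + euler_number Q q"
    "\<And>j. num_rank S s j = num_rank P r j + num_rank Q q j"
    "\<And>i j. num_pairs S s i j = num_pairs P r i j + num_pairs Q q i j"
    using ex_disjoint_union[OF P(1) Q(1)] by blast
  show ?thesis
    using realizableI[OF S(1)] P Q by (simp add: S)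
qed

lemma realizable_multiple:
  "realizable n e v z i \<Longrightarrow> 0 < N \<Longrightarrow> realizable n (int N * e) (N * v) (N * z) (N * i)"
proof (induction N)
  case (Suc N)
  then show ?case
    using realizable_union[of n e v z i "int N * e" "N * v" "N * z" "N * i"]
    by (cases "N = 0") (auto simp: distrib_right)
qed simp

lemma ex_ordinal_sum:
  assumes P: "euler_complex m (P :: nat rel) r" "euler_number P r = sg m - 1"
    and Q: "euler_complex k (Q :: nat rel) q" "euler_number Q q = sg k - 1"
  shows "\<exists>(S :: nat rel) s. euler_complex (m + k) S s \<and> euler_number S s = sg (m + k) - 1 \<and>
    (\<forall>j. 0 < j \<and> j \<le> m \<longrightarrow> num_rank S s j = num_rank P r j) \<and>
    (\<forall>j. 0 < j \<longrightarrow> num_rank S s (m + j) = num_rank Q q j) \<and>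
    (0 < m \<and> 0 < k \<longrightarrow> num_pairs S s 1 (m + k) = num_rank P r 1 * num_rank Q q k) \<and>
    flag_poly (m + k) S s = flag_poly m P r * flag_poly k Q q"
proof -
  define s where "s = case_sum r (\<lambda>y. m + q y)"
  define q' where "q' = case_sum r q"
  have "s (Inl x) = r x" "q' (Inr y) = q y" for x y by (auto simp: s_def q'_def)
  note L = left_copy[OF P(1) Q(1), where s = s, OF this(1)]
    and R = right_copy[OF P(1) Q(1), where s = q', OF this(2)]
  let ?P = "map_prod Inl Inl ` P :: (nat + nat) rel" and ?Q = "map_prod Inr Inr ` Q :: (nat + nat) rel"
  have shift: "\<forall>y\<in>Field ?Q. s y = m + q' y"
    unfolding Field_copies[OF P(1) Q(1)] by (auto simp: s_def q'_def)
  have e: "euler_number ?P s = sg m - 1" "euler_number ?Q q' = sg k - 1"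
    using L R P Q by auto
  note O = osum_complex[OF L(1) R(1) disjoint_copies[OF P(1) Q(1)] shift e]
    osum_euler_number[OF L(1) R(1) disjoint_copies[OF P(1) Q(1)] shift e]
    osum_num_rank_bot[OF L(1) R(1) disjoint_copies[OF P(1) Q(1)] shift e]
    osum_num_rank_top[OF L(1) R(1) disjoint_copies[OF P(1) Q(1)] shift e]
    osum_num_pairs[OF L(1) R(1) disjoint_copies[OF P(1) Q(1)] shift e]
    osum_flag_poly[OF L(1) R(1) disjoint_copies[OF P(1) Q(1)] shift e]
  interpret S: euler_complex "m + k" "osum ?P ?Q" s by (rule O(1))
  have inj: "inj_on sum_encode (Field (osum ?P ?Q))" by (rule inj_sum_encode)
  define d where "d = s \<circ> sum_decode"
  have d: "d (sum_encode x) = s x" for x by (simp add: d_def)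
  define T where "T = map_prod sum_encode sum_encode ` osum ?P ?Q"
  note rel = S.relabel_complex[OF inj d, folded T_def] S.relabel_euler_number[OF inj d, folded T_def]
    S.relabel_num_rank[OF inj d, folded T_def] S.relabel_num_pairs[OF inj d, folded T_def]
    S.relabel_flag_poly[OF inj d, folded T_def]
  have "num_rank T d j = num_rank P r j" if "0 < j" "j \<le> m" for j
    using O(3)[OF that] by (simp only: rel L)
  moreover have "num_rank T d (m + j) = num_rank Q q j" if "0 < j" for j
    using O(4)[OF that] by (simp only: rel R)
  moreover have "num_pairs T d 1 (m + k) = num_rank P r 1 * num_rank Q q k" if "0 < m \<and> 0 < k"
    using O(5) that by (simp only: rel L R)
  moreover have "flag_poly (m + k) T d = flag_poly m P r * flag_poly k Q q"
    using O(6) by (simp only: rel L R)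
  moreover have "euler_number T d = sg (m + k) - 1"
    using O(2) by (simp only: rel)
  ultimately show ?thesis
    using rel(1) by blast
qed

lemma realizable_ordinal_sum:
  assumes "realizable m (sg m - 1) v z i" "realizable k (sg k - 1) v' z' i'" "0 < m" "0 < k"
  shows "realizable (m + k) (sg (m + k) - 1) v z' (v * z')"
proof -
  obtain P Q :: "nat rel" and r q where P: "euler_complex m P r" "euler_number P r = sg m - 1"
      "num_rank P r 1 = v"
    and Q: "euler_complex k Q q" "euler_number Q q = sg k - 1" "num_rank Q q k = z'"
    using assms unfolding realizable_def by blast
  obtain S :: "nat rel" and s where S: "euler_complex (m + k) S s" "euler_number S s = sg (m + k) - 1"
    "\<And>j. 0 < j \<Longrightarrow> j \<le> m \<Longrightarrow> num_rank S s j = num_rank P r j"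
    "\<And>j. 0 < j \<Longrightarrow> num_rank S s (m + j) = num_rank Q q j"
    "num_pairs S s 1 (m + k) = num_rank P r 1 * num_rank Q q k"
    using ex_ordinal_sum[OF P(1,2) Q(1,2)] assms(3,4) by blast
  show ?thesis
    using realizableI[OF S(1)] S(3)[of 1] S(4)[of k] S(2,5) P(3) Q(3) assms(3,4) by simp
qed

lemma realizable_cprod:
  assumes "realizable m e v z i" "realizable k e' v' z' i'" "1 \<le> m" "2 \<le> k"
    "sg (m + k - 1) = - 1 - e * (1 + sg k)"
  shows "realizable (m + k - 1) (- (e * (e' - int z' * sg k)) + int z' * sg (m + k - 1))
    (v * v') z' (v * i')"
proof -
  obtain A L :: "nat rel" and a l where A: "euler_complex m A a" "euler_number A a = e"
      "num_rank A a 1 = v"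
    and L: "euler_complex k L l" "euler_number L l = e'" "num_rank L l 1 = v'" "num_rank L l k = z'"
      "num_pairs L l 1 k = i'"
    using assms(1,2) unfolding realizable_def by blast
  have s: "sg (m + k - 1) = - 1 - euler_number A a * (1 + sg k)"
    using assms(5) A by simp
  note C = cprod_complex[OF A(1) L(1) assms(3,4) s] cprod_euler_number[OF A(1) L(1) assms(3,4) s]
    cprod_num_rank_1[OF A(1) L(1) assms(3,4) s] cprod_num_rank_top[OF A(1) L(1) assms(3,4) s]
    cprod_num_pairs[OF A(1) L(1) assms(3,4) s]
  show ?thesis
    using realizableI[OF C(1)] unfolding C(2-5) A L .
qed

section \<open>Ladders and the complex for odd rank\<close>

definition two_points :: "nat rel" where
  "two_points = {(0, 0), (1, 1)}"

lemma two_points_sets: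
  "Field two_points = {0, 1}" "x \<in> {0, 1} \<Longrightarrow> two_points `` {x} = {x}"
  "x \<in> {0, 1} \<Longrightarrow> two_points\<inverse> `` {x} = {x}" "(x, y) \<in> two_points \<Longrightarrow> x = y"
  by (auto simp: two_points_def Field_def)

lemma two_points_complex: "euler_complex 1 two_points (\<lambda>_. 1)"
proof
  show "Partial_order two_points"
    by (rule Partial_orderI) (auto simp: two_points_def)
  show "two_points \<noteq> {}" by (simp add: two_points_def)
qed (use two_points_sets in auto)

lemma two_points_numbers:
  "euler_number two_points (\<lambda>_. 1) = -2" "num_rank two_points (\<lambda>_. 1) 1 = 2"
proof -
  show "euler_number two_points (\<lambda>_. 1) = -2"
    by (simp add: euler_number_def two_points_sets)
  have "num_rank two_points (\<lambda>_. 1) 1 = card {0, 1 :: nat}"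
    unfolding num_rank_def two_points_sets by (rule arg_cong[of _ _ card]) auto
  then show "num_rank two_points (\<lambda>_. 1) 1 = 2" by simp
qed

lemma realizable_1: "\<exists>i. realizable 1 (-2) 2 2 i"
  using realizableI[OF two_points_complex] two_points_numbers by metis

text \<open>The ordinal sum of \<open>n + 2\<close> copies of \<open>two_points\<close>. The rank
  starts at 2 because in rank 1 vertices and top elements coincide and form only two pairs.\<close>

lemma realizable_ladder: "realizable (n + 2) (sg n - 1) 2 2 4"
proof (induction n)
  case 0
  obtain i where i: "realizable 1 (sg 1 - 1) 2 2 i" using realizable_1 by auto
  show ?case
    using realizable_ordinal_sum[OF i i zero_less_one zero_less_one] by (simp add: one_add_one)
next
  case (Suc n)
  obtain i where i: "realizable 1 (sg 1 - 1) 2 2 i" using realizable_1 by auto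
  have "realizable (n + 2) (sg (n + 2) - 1) 2 2 4" using Suc by simp
  then show ?case
    using realizable_ordinal_sum[OF i _ zero_less_one] by fastforce
qed

text \<open>For odd \<open>n \<ge> 7\<close>: a four-dimensional complex with Euler characteristic 6 on four vertices
  is multiplied by a complex with \<open>N\<close> pairs of facets, collapsed at the top, which has Euler
  characteristic \<open>12 - 10 N\<close>; disjoint ladders restore the Euler characteristic 2.\<close>

lemma realizable_odd:
  assumes "0 < N"
  shows "realizable (2 * t + 7) (-2) (8 + 2 * (5 * N - 5)) (2 * N + 2 * (5 * N - 5)) (16 * N + 4 * (5 * N - 5))"
proof -
  have C: "realizable 2 0 2 2 4"
    using realizable_ladder[of 0] by (simp add: numeral_2_eq_2)
  \<comment> \<open>Three disjoint 2-gons on top of one: six top elements over only two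
    vertices.\<close>
  have "realizable 4 0 2 6 12"
    using realizable_ordinal_sum[of 2 2 2 4 2 6 6 12] C realizable_multiple[OF C, of 3] by simp
  \<comment> \<open>As \<open>C\<close> has Euler number 0, only the six contracted elements count,
    each with sign -1.\<close>
  then have W: "realizable 5 (-6) 4 6 24"
    using realizable_cprod[OF C, of 4 0 2 6 12] by simp
  have "realizable (2 * t + 2) 0 (N * 2) (N * 2) (N * 4)"
    using realizable_multiple[OF realizable_ladder[of "2 * t"] assms] by simp
  moreover obtain i where "realizable 1 (-2) 2 2 i" using realizable_1 by blast
  ultimately have "realizable (2 * t + 3) (-2) 2 (2 * N) (4 * N)"
    using realizable_ordinal_sum[of 1 2 2 i "2 * t + 2" "N * 2" "N * 2" "N * 4"] assms
    by (simp add: mult_ac numeral_3_eq_3)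
  \<comment> \<open>The rank \<open>2 * t + 3\<close> is odd, so \<open>1 + sg k\<close> vanishes
    and the Euler number -6 of \<open>W\<close> is admissible. The new Euler number is
    \<open>6 * (2 * N - 2) - 2 * N\<close>.\<close>
  from realizable_cprod[OF W this]
  have M: "realizable (2 * t + 7) (10 * int N - 12) 8 (2 * N) (16 * N)"
    by (simp add: algebra_simps)
  show ?thesis
  \<comment> \<open>For \<open>N = 1\<close> the Euler number is already -2, and no ladder may be
    added, while \<open>realizable_multiple\<close> asks for at least one.\<close>
  proof (cases "N = 1")
    case True
    then show ?thesis using M by simp
  next
    case False
    then have "0 < 5 * N - 5" using assms by simp
    from realizable_multiple[OF realizable_ladder[of "2 * t + 5"] this]
    have "realizable (2 * t + 7) (int (5 * N - 5) * (-2)) ((5 * N - 5) * 2) ((5 * N - 5) * 2) ((5 * N - 5) * 4)"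
      by (simp add: add.commute[of 7])
    from realizable_union[OF M this] show ?thesis
      using assms by (simp add: of_nat_diff mult_ac)
  qed
qed

section \<open>Attaining coefficients by star products\<close>

text \<open>That \<open>[w]\<close> attains the value \<open>x\<close>, in terms of the poset without its bounds and an explicit
  \<open>cd\<close>-index, as both are compatible with ordinal sums.\<close>

definition block :: "cd list \<Rightarrow> int \<Rightarrow> bool" where
  "block w x \<longleftrightarrow> (\<exists>(P :: nat rel) r F. euler_complex (cd_length w) P r \<and>
     euler_number P r = sg (cd_length w) - 1 \<and> flag_poly (cd_length w) P r = ncsubst cd_to_ab F \<and>
     homogeneous (cd_length w) F \<and> Poly_Mapping.lookup F w = x)"

lemma block_append:
  assumes "block u x" "block v y"
  shows "block (u @ v) (x * y)"
proof -
  obtain P Q :: "nat rel" and r q F G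
    where P: "euler_complex (cd_length u) P r" "euler_number P r = sg (cd_length u) - 1"
        "flag_poly (cd_length u) P r = ncsubst cd_to_ab F" "homogeneous (cd_length u) F"
        "Poly_Mapping.lookup F u = x"
      and Q: "euler_complex (cd_length v) Q q" "euler_number Q q = sg (cd_length v) - 1"
        "flag_poly (cd_length v) Q q = ncsubst cd_to_ab G" "homogeneous (cd_length v) G"
        "Poly_Mapping.lookup G v = y"
    using assms unfolding block_def by blast
  obtain S :: "nat rel" and s where S: "euler_complex (cd_length u + cd_length v) S s"
    "euler_number S s = sg (cd_length u + cd_length v) - 1"
    "flag_poly (cd_length u + cd_length v) S s = flag_poly (cd_length u) P r * flag_poly (cd_length v) Q q"
    using ex_ordinal_sum[OF P(1,2) Q(1,2)] by blast
  have "flag_poly (cd_length u + cd_length v) S s = ncsubst cd_to_ab (F * G)"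
    using S(3) P(3) Q(3) by (simp add: ncsubst_mult)
  moreover have "homogeneous (cd_length u + cd_length v) (F * G)"
    using homogeneous_mult[OF P(4) Q(4)] .
  moreover have "Poly_Mapping.lookup (F * G) (u @ v) = x * y"
    using lookup_mult_homogeneous[OF P(4)] P(5) Q(5) by simp
  ultimately show ?thesis
    using S(1,2) unfolding block_def cd_length_simps by blast
qed

lemma block_Nil: "block [] 1"
proof -
  have "Chains ({} :: nat rel) = {{}}" by (auto simp: Chains_def)
  then have "flag_poly 0 ({} :: nat rel) (\<lambda>_. 0) = ncsubst cd_to_ab 1"
    by (simp add: flag_poly_def)
  moreover have "euler_complex 0 ({} :: nat rel) (\<lambda>_. 0)"
    by standard (auto simp: partial_order_on_def preorder_on_def refl_on_def trans_def antisym_def)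
  moreover have "euler_number ({} :: nat rel) (\<lambda>_. 0) = sg 0 - 1"
    by (simp add: euler_number_def)
  moreover have "homogeneous 0 1" "Poly_Mapping.lookup (1 :: cd ncpoly) [] = 1"
    by (auto simp: homogeneous_def lookup_one zero_list_def when_def)
  ultimately show ?thesis
    unfolding block_def cd_length_simps by blast
qed

lemma block_poset:
  assumes "block w x"
  shows "\<exists>H :: 'a::infinite rel \<in> eulerian_posets (cd_length w + 1). cd_coeff w H = x"
proof -
  obtain P :: "nat rel" and r F where P: "euler_complex (cd_length w) P r"
    "euler_number P r = sg (cd_length w) - 1" "flag_poly (cd_length w) P r = ncsubst cd_to_ab F"
    "Poly_Mapping.lookup F w = x"
    using assms unfolding block_def by blast
  obtain H :: "'a rel" where H: "H \<in> eulerian_posets (cd_length w + 1)"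
    "ab_index H = flag_poly (cd_length w) P r"
    using ex_bounded_poset[OF P(1,2), where 'a = 'a] by blast
  then show ?thesis
    using cd_coeff_unique[OF H(1), of F w] P by auto
qed

text \<open>The explicit polynomial demanded by \<open>block\<close> is the cd-index of the bounded
  poset, whose existence is known. The face numbers are passed along to evaluate its
  coefficients.\<close>

lemma block_of_complex:
  assumes "euler_complex n (P :: nat rel) r" "euler_number P r = sg n - 1"
  shows "\<exists>H :: nat rel \<in> eulerian_posets (n + 1). (\<forall>w. cd_length w = n \<longrightarrow> block w (cd_coeff w H)) \<and>
    (\<forall>k. 0 < k \<and> k \<le> n \<longrightarrow> card {z\<in>Field H. rank H z = k} = num_rank P r k) \<and>
    (0 < n \<longrightarrow> card {(a, z)\<in>H. rank H a = 1 \<and> rank H z = n} = num_pairs P r 1 n)"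
proof -
  obtain H :: "nat rel" where H: "H \<in> eulerian_posets (n + 1)" "ab_index H = flag_poly n P r"
    "\<forall>k. 0 < k \<and> k \<le> n \<longrightarrow> card {z\<in>Field H. rank H z = k} = num_rank P r k"
    "0 < n \<longrightarrow> card {(a, z)\<in>H. rank H a = 1 \<and> rank H z = n} = num_pairs P r 1 n"
    using ex_bounded_poset[OF assms, where 'a = nat] by blast
  have "block w (cd_coeff w H)" if "cd_length w = n" for w
    using assms H(2) ab_index_eq_cd_index[OF H(1)] that unfolding block_def cd_coeff_def by metis
  then show ?thesis
    using H by blast
qed

lemma block_Lc: "block [Lc] 1"
proof -
  obtain H :: "nat rel" where H: "H \<in> eulerian_posets (1 + 1)" "block [Lc] (cd_coeff [Lc] H)"
    using block_of_complex[OF two_points_complex] two_points_numbers by auto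
  then show ?thesis
    using cd_coeff_c_power[OF H(1)] by simp
qed

text \<open>The disjoint union of \<open>N\<close> 2-gons has \<open>2 * N\<close> vertices. One
  2-gon gives 0, two give 2, and many exceed any bound.\<close>

lemma block_Ld:
  assumes "0 < N"
  shows "block [Ld] (2 * int N - 2)"
proof -
  have "realizable 2 0 (N * 2) (N * 2) (N * 4)"
    using realizable_multiple[OF realizable_ladder[of 0] assms] by (simp add: numeral_2_eq_2)
  then obtain P :: "nat rel" and r where P: "euler_complex 2 P r" "euler_number P r = sg 2 - 1"
    "num_rank P r 1 = N * 2"
    unfolding realizable_def by auto
  obtain H :: "nat rel" where H: "H \<in> eulerian_posets (2 + 1)" "block [Ld] (cd_coeff [Ld] H)"
    "card {z\<in>Field H. rank H z = 1} = N * 2"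
    using block_of_complex[OF P(1,2)] P(3) by auto
  then show ?thesis
    using cd_coeff_dc_power[OF H(1), of 0] by (simp add: mult.commute)
qed

text \<open>A star product with one factor per letter, c contributing 1. For a word containing d,
  \<open>N = 1\<close> yields the value 0 and large \<open>N\<close> arbitrarily large
  values.\<close>

lemma block_word: "0 < N \<Longrightarrow> block w ((2 * int N - 2) ^ count_list w Ld)"
proof (induction w)
  case Nil
  then show ?case using block_Nil by simp
next
  case (Cons x w)
  then show ?case
    using block_append[OF block_Lc, of w] block_append[OF block_Ld, of N w] by (cases x) auto
qed

lemma block_dc_power_d:
  assumes "realizable (m + 4) (sg (m + 4) - 1) v z i"
  shows "block (Ld # replicate m Lc @ [Ld]) (int i - 2 * int v - 2 * int z + 4)"
proof -
  obtain P :: "nat rel" and r where P: "euler_complex (m + 4) P r" "euler_number P r = sg (m + 4) - 1"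
    "num_rank P r 1 = v" "num_rank P r (m + 4) = z" "num_pairs P r 1 (m + 4) = i"
    using assms unfolding realizable_def by blast
  let ?w = "Ld # replicate m Lc @ [Ld]"
  have "cd_length ?w = m + 4" by simp
  then obtain H :: "nat rel" where H: "H \<in> eulerian_posets (m + 4 + 1)" "block ?w (cd_coeff ?w H)"
    "card {z\<in>Field H. rank H z = 1} = v" "card {z\<in>Field H. rank H z = m + 4} = z"
    "card {(a, z)\<in>H. rank H a = 1 \<and> rank H z = m + 4} = i"
    using block_of_complex[OF P(1,2)] P(3-5) by fastforce
  then show ?thesis
    using cd_coeff_dc_power_d[OF H(1) refl] by simp
qed

text \<open>For even \<open>m\<close> the required Euler number is 0, so \<open>N\<close> disjoint
  ladders are admissible and give \<open>4 - 4 * N\<close>. For odd \<open>m\<close> at least 3,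
  \<open>realizable_odd\<close> gives \<open>8 - 8 * N\<close>.\<close>

lemma block_dc_power_d_unbounded:
  assumes "m \<noteq> 1"
  shows "\<exists>x\<le>B. block (Ld # replicate m Lc @ [Ld]) x"
proof -
  define N where "N = Suc (nat \<bar>B\<bar> + 2)"
  have N: "0 < N" "4 - 4 * int N \<le> B" "8 - 8 * int N \<le> B"
    unfolding N_def by simp_all
  show ?thesis
  proof (cases "even m")
    case True
    have "realizable (m + 2 + 2) (int N * (sg (m + 2) - 1)) (N * 2) (N * 2) (N * 4)"
      by (rule realizable_multiple[OF realizable_ladder N(1)])
    moreover have "m + 2 + 2 = m + 4" "sg (m + 2) = 1" "sg (m + 4) = 1"
      using True by (simp_all add: minus_one_power_iff)
    ultimately have "realizable (m + 4) (sg (m + 4) - 1) (N * 2) (N * 2) (N * 4)"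
      by (simp only: diff_self mult_zero_right)
    from block_dc_power_d[OF this] N(2) show ?thesis
      by (intro exI[of _ "4 - 4 * int N"]) (simp add: algebra_simps)
  next
    case False
    then obtain s where s: "m = 2 * s + 1" by (elim oddE)
    then have "s \<noteq> 0" using assms by (intro notI) simp
    then obtain t where "s = Suc t" by (metis not0_implies_Suc)
    then have m: "m = 2 * t + 3" using s by simp
    have "realizable (m + 4) (sg (m + 4) - 1) (8 + 2 * (5 * N - 5)) (2 * N + 2 * (5 * N - 5)) (16 * N + 4 * (5 * N - 5))"
      using realizable_odd[OF N(1), of t] by (simp add: m add.commute)
    from block_dc_power_d[OF this] N(1,3) show ?thesis
      by (intro exI[of _ "8 - 8 * int N"]) (simp add: of_nat_diff algebra_simps)
  qed
qed

text \<open>The doubled poset has Euler number 0, which is the value required in rank 6, so any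
  number of disjoint copies may be taken.\<close>

lemma ex_ccdcc_complex:
  assumes "0 < N"
  shows "\<exists>(P :: nat rel) r. euler_complex 6 P r \<and> euler_number P r = 0 \<and>
    num_rank P r 1 = 8 * N \<and> num_rank P r 2 = 24 * N \<and> num_rank P r 3 = 12 * N"
proof -
  interpret K: half_complex 6 k4 fst by (rule k4_half_complex)
  obtain K :: "nat rel" and k where K: "euler_complex 6 K k" "euler_number K k = 0"
    "num_rank K k 1 = 8" "num_rank K k 2 = 24" "num_rank K k 3 = 12"
    using ex_nat_copy[OF K.doubled_complex] K.doubled_euler_number K.doubled_num_rank k4_numbers
    by fastforce
  show ?thesis
    using assms
  proof (induction N rule: nat_induct_non_zero)
    case 1
    then show ?case using K by auto
  next
    case (Suc N)
    then obtain P :: "nat rel" and r where P: "euler_complex 6 P r" "euler_number P r = 0"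
      "num_rank P r 1 = 8 * N" "num_rank P r 2 = 24 * N" "num_rank P r 3 = 12 * N" by blast
    obtain S :: "(nat + nat) rel" and s where S: "euler_complex 6 S s"
      "euler_number S s = euler_number K k + euler_number P r"
      "\<And>j. num_rank S s j = num_rank K k j + num_rank P r j"
      using ex_disjoint_union[OF K(1) P(1)] by blast
    obtain T :: "nat rel" and t where "euler_complex 6 T t" "euler_number T t = euler_number S s"
      "\<And>j. num_rank T t j = num_rank S s j"
      using ex_nat_copy[OF S(1)] by blast
    then show ?case
      using S K P by (intro exI[of _ T] exI[of _ t]) simp
  qed
qed

text \<open>The level formula gives \<open>12 * N - 24 * N + 8 * N - 2\<close> for \<open>N\<close>
  copies.\<close>

lemma block_ccdcc_unbounded: "\<exists>x\<le>B. block [Lc, Lc, Ld, Lc, Lc] x"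
proof -
  define N where "N = Suc (nat \<bar>B\<bar>)"
  have N: "0 < N" "- 4 * int N - 2 \<le> B" unfolding N_def by simp_all
  obtain P :: "nat rel" and r where P: "euler_complex 6 P r" "euler_number P r = sg 6 - 1"
    "num_rank P r 1 = 8 * N" "num_rank P r 2 = 24 * N" "num_rank P r 3 = 12 * N"
    using ex_ccdcc_complex[OF N(1)] by auto
  let ?w = "[Lc, Lc, Ld, Lc, Lc]"
  obtain H :: "nat rel" where H: "H \<in> eulerian_posets (6 + 1)" "block ?w (cd_coeff ?w H)"
    "card {z\<in>Field H. rank H z = 1} = 8 * N" "card {z\<in>Field H. rank H z = 2} = 24 * N"
    "card {z\<in>Field H. rank H z = 3} = 12 * N"
    using block_of_complex[OF P(1,2)] P(3-5) by fastforce
  show ?thesis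
    using H(2) N(2) cd_coeff_ccdcc[OF H(1) refl] H(3-5) by (intro exI[of _ "cd_coeff ?w H"]) simp
qed

text \<open>The words on both sides are realized by \<open>block_word\<close> with
  \<open>N = 2\<close>, so their coefficients are powers of 2 and at least 1.\<close>

lemma block_surrounded:
  assumes "\<And>B. \<exists>x\<le>B. block b x"
  shows "\<exists>x\<le>B. block (u @ b @ v) x"
proof -
  \<comment> \<open>A nonpositive value can only decrease under multiplication by numbers that are
    at least 1.\<close>
  obtain x where x: "x \<le> min B 0" "block b x" using assms by blast
  let ?p = "2 ^ count_list u Ld :: int" and ?q = "2 ^ count_list v Ld :: int"
  have "block (u @ b @ v) (?p * (x * ?q))"
    using block_word[of 2 u] block_word[of 2 v] x(2) by (intro block_append) simp_all
  moreover have "?p * (x * ?q) \<le> x"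
  proof -
    have "1 \<le> ?p * ?q" using one_le_power[of "2::int"] mult_mono[of 1 ?p 1 ?q] by simp
    then show ?thesis
      using mult_left_mono_neg[of 1 "?p * ?q" x] x(1) by (simp add: mult_ac)
  qed
  ultimately show ?thesis using x(1) by (intro exI[of _ "?p * (x * ?q)"]) simp
qed

text \<open>Consider the numbers of c between consecutive letters d. If one of them is not 1, a
  factor d c^m d appears; otherwise the word alternates, where \<open>k = 0\<close> means a single
  d.\<close>

lemma cd_word_cases:
  obtains (power) "w = replicate (length w) Lc"
  | (factor) u m v where "w = u @ (Ld # replicate m Lc @ [Ld]) @ v" "m \<noteq> 1"
  | (alternating) i k j where "w = replicate i Lc @ Ld # concat (replicate k [Lc, Ld]) @ replicate j Lc"
proof -
  have "w = replicate (length w) Lc \<or> (\<exists>u m v. w = u @ (Ld # replicate m Lc @ [Ld]) @ v \<and> m \<noteq> 1) \<or>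
    (\<exists>i k j. w = replicate i Lc @ Ld # concat (replicate k [Lc, Ld]) @ replicate j Lc)"
  proof (induction w)
    case (Cons x w)
    show ?case
    proof (cases x)
      case Lc
      from Cons show ?thesis
      proof (elim disjE exE conjE)
        fix u m v assume "w = u @ (Ld # replicate m Lc @ [Ld]) @ v" "m \<noteq> 1"
        then have "x # w = (Lc # u) @ (Ld # replicate m Lc @ [Ld]) @ v \<and> m \<noteq> 1" using Lc by simp
        then show ?thesis by blast
      next
        fix i k j assume "w = replicate i Lc @ Ld # concat (replicate k [Lc, Ld]) @ replicate j Lc"
        then have "x # w = replicate (Suc i) Lc @ Ld # concat (replicate k [Lc, Ld]) @ replicate j Lc"
          using Lc by simp
        then show ?thesis by blast
      qed (use Lc in simp)
    next
      case Ld
      from Cons show ?thesis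
      proof (elim disjE exE conjE)
        assume "w = replicate (length w) Lc"
        then have "x # w = replicate 0 Lc @ Ld # concat (replicate 0 [Lc, Ld]) @ replicate (length w) Lc"
          using Ld by simp
        then show ?thesis by blast
      next
        fix u m v assume "w = u @ (Ld # replicate m Lc @ [Ld]) @ v" "m \<noteq> 1"
        then have "x # w = (Ld # u) @ (Ld # replicate m Lc @ [Ld]) @ v \<and> m \<noteq> 1" using Ld by simp
        then show ?thesis by blast
      next
        fix i k j assume w: "w = replicate i Lc @ Ld # concat (replicate k [Lc, Ld]) @ replicate j Lc"
        show ?thesis
        proof (cases "i = 1")
          case True
          then have "x # w = replicate 0 Lc @ Ld # concat (replicate (Suc k) [Lc, Ld]) @ replicate j Lc"
            using w Ld by simp
          then show ?thesis by blast
        next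
          case False
          then have "x # w = [] @ (Ld # replicate i Lc @ [Ld]) @ (concat (replicate k [Lc, Ld]) @ replicate j Lc) \<and> i \<noteq> 1"
            using w Ld by simp
          then show ?thesis by blast
        qed
      qed
    qed
  qed simp
  then show thesis using that by blast
qed

theorem theorem3p1:
  fixes w :: "cd list" and n :: nat and Eul :: "'a::infinite rel set"
  assumes "cd_length w = n"
    and "Eul = eulerian_posets (n + 1)"
  shows
    "(one_d_form w \<or> alternating_form w \<longrightarrow>
        (INF P\<in>Eul. ereal (of_int (cd_coeff w P))) = 0 \<and>
        (SUP P\<in>Eul. ereal (of_int (cd_coeff w P))) = \<infinity>) \<and>
     (\<forall>P\<in>Eul. cd_coeff (replicate n Lc) P = 1) \<and>
     (\<not> one_d_form w \<and> \<not> alternating_form w \<and> w \<noteq> replicate n Lc \<longrightarrow>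
        (INF P\<in>Eul. ereal (of_int (cd_coeff w P))) = -\<infinity> \<and>
        (SUP P\<in>Eul. ereal (of_int (cd_coeff w P))) = \<infinity>)"
proof (intro conjI impI ballI)
  have attained: "\<exists>P\<in>Eul. cd_coeff w P = x" if "block w x" for x
    using block_poset[OF that, where 'a = 'a] assms by simp
  have sup: "(SUP P\<in>Eul. ereal (of_int (cd_coeff w P))) = \<infinity>" if d: "Ld \<in> set w"
  proof (rule SUP_PInfty)
    fix k :: nat
    \<comment> \<open>The base is \<open>2 * k + 2\<close>, so every positive power of it is at
      least \<open>k\<close>.\<close>
    obtain P where P: "P \<in> Eul" "cd_coeff w P = (2 * int (k + 2) - 2) ^ count_list w Ld"
      using attained[OF block_word[of "k + 2" w]] by auto
    have "0 < count_list w Ld" using d count_list_0_iff[of w Ld] by auto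
    then have "2 * int (k + 2) - 2 \<le> (2 * int (k + 2) - 2) ^ count_list w Ld"
      by (intro self_le_power) auto
    moreover have "int k \<le> 2 * int (k + 2) - 2" by simp
    ultimately have "int k \<le> cd_coeff w P" unfolding P(2) by (rule order_trans[rotated])
    then have "ereal (real k) \<le> ereal (of_int (cd_coeff w P))"
      by (metis ereal_less_eq(3) of_int_le_iff of_int_of_nat_eq)
    then show "\<exists>P\<in>Eul. ereal (real k) \<le> ereal (of_int (cd_coeff w P))"
      using P(1) by blast
  qed
  show "cd_coeff (replicate n Lc) P = 1" if "P \<in> Eul" for P
    using cd_coeff_c_power[of P n] that assms(2) by simp
  {
    assume "one_d_form w \<or> alternating_form w"
    then obtain i j k where
      w: "w = replicate i Lc @ Ld # concat (replicate k [Lc, Ld]) @ replicate j Lc" "k > 0 \<or> min i j \<le> 1"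
    proof
      assume "one_d_form w"
      then obtain i j where "min i j \<le> 1" "w = replicate i Lc @ [Ld] @ replicate j Lc"
        unfolding one_d_form_def by blast
      then show thesis by (intro that[of i 0 j]) auto
    next
      assume "alternating_form w"
      then obtain i j r where "r \<ge> 2"
        "w = replicate i Lc @ [Ld] @ concat (replicate (r - 1) [Lc, Ld]) @ replicate j Lc"
        unfolding alternating_form_def by blast
      then show thesis by (intro that[of i "r - 1" j]) auto
    qed
    have d: "Ld \<in> set w" by (simp add: w(1))
    \<comment> \<open>With \<open>N = 1\<close> each letter d contributes 0, so the lower bound 0 is
      attained.\<close>
    obtain P where P: "P \<in> Eul" "cd_coeff w P = 0"
      using attained[OF block_word[of 1 w]] d count_list_0_iff[of w Ld] by auto
    show "(INF P\<in>Eul. ereal (of_int (cd_coeff w P))) = 0"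
    proof (rule antisym)
      show "(INF P\<in>Eul. ereal (of_int (cd_coeff w P))) \<le> 0"
        using INF_lower[OF P(1), of "\<lambda>P. ereal (of_int (cd_coeff w P))"] P(2)
        by (simp add: zero_ereal_def)
      show "0 \<le> (INF P\<in>Eul. ereal (of_int (cd_coeff w P)))"
        using cd_coeff_alternating_nonneg[OF _ w(2)] assms(2) w(1) by (intro INF_greatest) simp
    qed
    show "(SUP P\<in>Eul. ereal (of_int (cd_coeff w P))) = \<infinity>"
      using sup[OF d] .
  }
  {
    assume no: "\<not> one_d_form w \<and> \<not> alternating_form w \<and> w \<noteq> replicate n Lc"
    have unbounded: "\<exists>x\<le>B. block w x" for B
    proof (cases w rule: cd_word_cases)
      case power
      then have "w = replicate n Lc"
        using assms(1) by (metis cd_length_replicate cd_letter_length.simps(1) mult.right_neutral)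
      then show ?thesis using no by blast
    next
      case (factor u m v)
      then show ?thesis
        using block_surrounded[OF block_dc_power_d_unbounded[OF factor(2)]] by simp
    next
      case (alternating i k j)
      have "k = 0"
      proof (rule ccontr)
        assume "k \<noteq> 0"
        then have "alternating_form w"
          unfolding alternating_form_def using alternating
          by (intro exI[of _ i] exI[of _ j] exI[of _ "Suc k"]) auto
        then show False using no by blast
      qed
      then have "\<not> min i j \<le> 1"
        using no alternating unfolding one_d_form_def by auto
      \<comment> \<open>Both powers of c have length at least 2, so the word is ccdcc surrounded by
        powers of c.\<close>
      then obtain i' j' where "i = i' + 2" "j = 2 + j'"
        by (metis add.commute le_Suc_ex not_less_eq_eq numeral_2_eq_2 One_nat_def min.bounded_iff)
      then have "replicate i Lc = replicate i' Lc @ [Lc, Lc]" "replicate j Lc = [Lc, Lc] @ replicate j' Lc"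
        by (simp_all only: replicate_add numeral_2_eq_2 replicate.simps)
      then have "w = replicate i' Lc @ [Lc, Lc, Ld, Lc, Lc] @ replicate j' Lc"
        using alternating \<open>k = 0\<close> by simp
      then show ?thesis
        using block_surrounded[OF block_ccdcc_unbounded] by metis
    qed
    show "(INF P\<in>Eul. ereal (of_int (cd_coeff w P))) = -\<infinity>"
    proof (rule ereal_bot)
      fix B :: real
      obtain x where x: "x \<le> \<lfloor>B\<rfloor>" "block w x" using unbounded by blast
      obtain P where P: "P \<in> Eul" "cd_coeff w P = x" using attained[OF x(2)] by blast
      have "of_int x \<le> B" using x(1) by linarith
      then show "(INF P\<in>Eul. ereal (of_int (cd_coeff w P))) \<le> ereal B"
        using P by (intro INF_lower2[OF P(1)]) simp
    qed
    have "Ld \<in> set w"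
    proof (rule ccontr)
      assume "Ld \<notin> set w"
      then have "\<forall>x\<in>set w. x = Lc" by (metis cd.exhaust)
      then have "w = replicate (length w) Lc" by (metis replicate_length_same)
      then show False
        using no assms(1) by (metis cd_length_replicate cd_letter_length.simps(1) mult.right_neutral)
    qed
    then show "(SUP P\<in>Eul. ereal (of_int (cd_coeff w P))) = \<infinity>"
      by (rule sup)
  }
qed

end
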